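(* Let $\tau$ be a signature which is $\kappa$-projectively closed for some $\tau$-theory $T\supseteq\mathsf{ZFC}_\tau$. Let $S$ be the $\tau$-theory consisting of $\mathsf{ZFC}^-_\tau$, those instances of axioms (P1)–(P7) below (for the witnessing family $\tau_0$) which follow from $T$, and the axiom $\forall x\,\exists f\,[f$ is a surjection $\wedge\mathrm{dom}(f)=\kappa\wedge\mathrm{ran}(f)=x]$. Then $S$ is model complete.
   Context: $\in_{\Delta_0}$ extends $\{\in\}$ by relation symbols for $\Delta_0$-formulas, constants $\emptyset,\omega$ and function symbols for the Gödel operations, with $T_{\Delta_0}$ the axioms fixing their meaning. For $\tau\supseteq\in_{\Delta_0}$: $\mathsf Z^-_{\Delta_0}$ is Extensionality + Foundation + $T_{\Delta_0}$; $\mathsf{ZF}^-_\tau$ is $\mathsf Z^-_{\Delta_0}$ plus, for every $\tau$-formula $\phi$, $\forall\vec z[(\forall x\exists y\,\phi(x,y,\vec z))\to\forall X\exists F(F$ function $\wedge\mathrm{dom}F=X\wedge\forall x\in X\,\phi(x,F(x),\vec z))]$; $\mathsf{ZFC}^-_\tau$ adds the axiom of choice, and $\mathsf{ZFC}_\tau$ further adds powerset. For a cardinal $\kappa$: $\mathsf{WFE}_\kappa$ is the set of $R\subseteq\kappa^2$ which are well-founded extensional relations with field some $\alpha\le\kappa$ and top element $0$; $\mathrm{Cod}_\kappa(R)$ is the image of $0$ under the transitive collapse of $(\alpha,R)$. A signature $\tau\supseteq\in_{\Delta_0}\cup\{\kappa\}$ ($\kappa$ a constant) is $\kappa$-projectively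 closed for a $\tau$-theory $T\supseteq\mathsf{ZFC}^-_\tau$ if for some family $\tau_0\subseteq\tau$ of predicate symbols: (P1) $T\models\kappa$ is a cardinal; (P2) for each $R\in\tau_0$, $T\models\forall x_0..x_n(R(\vec x)\to\bigwedge_i x_i\subseteq\kappa)$; (P3) for each quantifier-free $\tau$-formula $\phi$ there is $R_\phi\in\tau_0$ with $T\models\forall\vec x,\vec y[(\bigwedge_i x_i=\mathrm{Cod}_\kappa(y_i)\wedge\phi(\vec x))\leftrightarrow R_\phi(\vec y)]$; (P4) for $R,S\in\tau_0$ some $U\in\tau_0$ has $T\models\forall\vec x,\vec y[(R(\vec x)\vee S(\vec y))\leftrightarrow U(\vec x,\vec y)]$; (P5) same with $\wedge$; (P6) for $R\in\tau_0$ some $U\in\tau_0$ has $T\models\forall\vec x[\bigwedge_i x_i\subseteq\kappa\to(R(\vec x)\leftrightarrow\neg U(\vec x))]$; (P7) for $R\in\tau_0$ and each $i$ some $U\in\tau_0$ has $T\models\forall x_0..x_{i-1}x_{i+1}..x_n[U(\dots)\leftrightarrow\exists x_i(x_i\subseteq\kappa\wedge R(x_0,\dots,x_n))]$.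
   Formalization: Inconsistent as printed, so corrected: the surjection axiom is for nonempty x only; (P3) says some x with x_i = Cod(y_i) satisfies φ; (P4) is restricted to subsets of κ; codes in κ² become subsets of κ by Gödel pairing; 0 always counts as in the field of a code. *)

theory Defs
  imports Main
begin

section \<open>First-order logic\<close>

datatype 'f tm = Var nat | Fn 'f "'f tm list"

datatype ('f, 'r) fm =
    FTrue
  | FEq "'f tm" "'f tm"  (infix "\<^bold>=" 50)
  | Rel 'r "'f tm list"
  | FNot "('f, 'r) fm"  ("\<^bold>\<not> _" [40] 40)
  | FAnd "('f, 'r) fm" "('f, 'r) fm"  (infixr "\<^bold>\<and>" 35)
  | FEx nat "('f, 'r) fm"

abbreviation FOr :: "('f, 'r) fm \<Rightarrow> ('f, 'r) fm \<Rightarrow> ('f, 'r) fm"  (infixr "\<^bold>\<or>" 30)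
  where "\<phi> \<^bold>\<or> \<psi> \<equiv> \<^bold>\<not> (\<^bold>\<not> \<phi> \<^bold>\<and> \<^bold>\<not> \<psi>)"

abbreviation FImp :: "('f, 'r) fm \<Rightarrow> ('f, 'r) fm \<Rightarrow> ('f, 'r) fm"  (infixr "\<^bold>\<longrightarrow>" 25)
  where "\<phi> \<^bold>\<longrightarrow> \<psi> \<equiv> \<^bold>\<not> (\<phi> \<^bold>\<and> \<^bold>\<not> \<psi>)"

abbreviation FIff :: "('f, 'r) fm \<Rightarrow> ('f, 'r) fm \<Rightarrow> ('f, 'r) fm"  (infixr "\<^bold>\<longleftrightarrow>" 25)
  where "\<phi> \<^bold>\<longleftrightarrow> \<psi> \<equiv> (\<phi> \<^bold>\<longrightarrow> \<psi>) \<^bold>\<and> (\<psi> \<^bold>\<longrightarrow> \<phi>)"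

abbreviation FAll :: "nat \<Rightarrow> ('f, 'r) fm \<Rightarrow> ('f, 'r) fm"
  where "FAll v \<phi> \<equiv> \<^bold>\<not> FEx v (\<^bold>\<not> \<phi>)"

definition FAlls :: "nat list \<Rightarrow> ('f, 'r) fm \<Rightarrow> ('f, 'r) fm"
  where "FAlls vs \<phi> = foldr FAll vs \<phi>"

definition FExs :: "nat list \<Rightarrow> ('f, 'r) fm \<Rightarrow> ('f, 'r) fm"
  where "FExs vs \<phi> = foldr FEx vs \<phi>"

definition FConj :: "('f, 'r) fm list \<Rightarrow> ('f, 'r) fm"
  where "FConj \<phi>s = foldr FAnd \<phi>s FTrue"

fun tvars :: "'f tm \<Rightarrow> nat set" where
  "tvars (Var v) = {v}"
| "tvars (Fn f ts) = (\<Union>t\<in>set ts. tvars t)"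

fun fv :: "('f, 'r) fm \<Rightarrow> nat set" where
  "fv FTrue = {}"
| "fv (s \<^bold>= t) = tvars s \<union> tvars t"
| "fv (Rel r ts) = (\<Union>t\<in>set ts. tvars t)"
| "fv (\<^bold>\<not> \<phi>) = fv \<phi>"
| "fv (\<phi> \<^bold>\<and> \<psi>) = fv \<phi> \<union> fv \<psi>"
| "fv (FEx v \<phi>) = fv \<phi> - {v}"

fun quantifier_free :: "('f, 'r) fm \<Rightarrow> bool" where
  "quantifier_free (\<^bold>\<not> \<phi>) = quantifier_free \<phi>"
| "quantifier_free (\<phi> \<^bold>\<and> \<psi>) = (quantifier_free \<phi> \<and> quantifier_free \<psi>)"
| "quantifier_free (FEx v \<phi>) = False"
| "quantifier_free _ = True"

definition FClose :: "('f, 'r) fm \<Rightarrow> ('f, 'r) fm"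
  where "FClose \<phi> = FAlls (sorted_list_of_set (fv \<phi>)) \<phi>"

record ('f, 'r) signature =
  funs :: "'f set"
  rels :: "'r set"
  farity :: "'f \<Rightarrow> nat"
  rarity :: "'r \<Rightarrow> nat"

definition extends :: "('f, 'r) signature \<Rightarrow> ('f, 'r) signature \<Rightarrow> bool" where
  "extends \<tau> \<sigma> \<longleftrightarrow>
     funs \<sigma> \<subseteq> funs \<tau> \<and> rels \<sigma> \<subseteq> rels \<tau> \<and>
     (\<forall>f\<in>funs \<sigma>. farity \<tau> f = farity \<sigma> f) \<and> (\<forall>r\<in>rels \<sigma>. rarity \<tau> r = rarity \<sigma> r)"

fun is_tm :: "('f, 'r) signature \<Rightarrow> 'f tm \<Rightarrow> bool" where
  "is_tm \<tau> (Var v) = True"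
| "is_tm \<tau> (Fn f ts) = (f \<in> funs \<tau> \<and> length ts = farity \<tau> f \<and> (\<forall>t\<in>set ts. is_tm \<tau> t))"

fun is_fm :: "('f, 'r) signature \<Rightarrow> ('f, 'r) fm \<Rightarrow> bool" where
  "is_fm \<tau> FTrue = True"
| "is_fm \<tau> (s \<^bold>= t) = (is_tm \<tau> s \<and> is_tm \<tau> t)"
| "is_fm \<tau> (Rel r ts) = (r \<in> rels \<tau> \<and> length ts = rarity \<tau> r \<and> (\<forall>t\<in>set ts. is_tm \<tau> t))"
| "is_fm \<tau> (\<^bold>\<not> \<phi>) = is_fm \<tau> \<phi>"
| "is_fm \<tau> (\<phi> \<^bold>\<and> \<psi>) = (is_fm \<tau> \<phi> \<and> is_fm \<tau> \<psi>)"
| "is_fm \<tau> (FEx v \<phi>) = is_fm \<tau> \<phi>"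

definition is_theory :: "('f, 'r) signature \<Rightarrow> ('f, 'r) fm set \<Rightarrow> bool"
  where "is_theory \<tau> T \<longleftrightarrow> (\<forall>\<phi>\<in>T. is_fm \<tau> \<phi> \<and> fv \<phi> = {})"

record ('f, 'r, 'u) model =
  Dom :: "'u set"
  FnI :: "'f \<Rightarrow> 'u list \<Rightarrow> 'u"
  RelI :: "'r \<Rightarrow> 'u list \<Rightarrow> bool"

definition is_structure :: "('f, 'r) signature \<Rightarrow> ('f, 'r, 'u) model \<Rightarrow> bool" where
  "is_structure \<tau> M \<longleftrightarrow> Dom M \<noteq> {} \<and>
     (\<forall>f\<in>funs \<tau>. \<forall>as. length as = farity \<tau> f \<and> set as \<subseteq> Dom M \<longrightarrow> FnI M f as \<in> Dom M)"

fun teval :: "('f, 'r, 'u) model \<Rightarrow> (nat \<Rightarrow> 'u) \<Rightarrow> 'f tm \<Rightarrow> 'u" where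
  "teval M e (Var v) = e v"
| "teval M e (Fn f ts) = FnI M f (map (teval M e) ts)"

fun eval :: "('f, 'r, 'u) model \<Rightarrow> (nat \<Rightarrow> 'u) \<Rightarrow> ('f, 'r) fm \<Rightarrow> bool" where
  "eval M e FTrue = True"
| "eval M e (s \<^bold>= t) = (teval M e s = teval M e t)"
| "eval M e (Rel r ts) = RelI M r (map (teval M e) ts)"
| "eval M e (\<^bold>\<not> \<phi>) = (\<not> eval M e \<phi>)"
| "eval M e (\<phi> \<^bold>\<and> \<psi>) = (eval M e \<phi> \<and> eval M e \<psi>)"
| "eval M e (FEx v \<phi>) = (\<exists>a\<in>Dom M. eval M (e(v := a)) \<phi>)"

definition satisfies :: "('f, 'r, 'u) model \<Rightarrow> ('f, 'r) fm \<Rightarrow> bool"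
  where "satisfies M \<phi> \<longleftrightarrow> (\<forall>e. range e \<subseteq> Dom M \<longrightarrow> eval M e \<phi>)"

definition is_model :: "('f, 'r) signature \<Rightarrow> ('f, 'r) fm set \<Rightarrow> ('f, 'r, 'u) model \<Rightarrow> bool"
  where "is_model \<tau> T M \<longleftrightarrow> is_structure \<tau> M \<and> (\<forall>\<phi>\<in>T. satisfies M \<phi>)"

text \<open>HOL cannot quantify over all types inside a formula, so the universe from which the
  domains are drawn is a parameter. When \<open>'u\<close> is infinite and has at least as many elements
  as \<open>\<tau>\<close> has symbols, this is the usual consequence relation, by the downward
  Loewenheim-Skolem theorem.\<close>
definition entails ::
  "'u itself \<Rightarrow> ('f, 'r) signature \<Rightarrow> ('f, 'r) fm set \<Rightarrow> ('f, 'r) fm \<Rightarrow> bool" where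
  "entails U \<tau> T \<phi> \<longleftrightarrow> (\<forall>M :: ('f, 'r, 'u) model. is_model \<tau> T M \<longrightarrow> satisfies M \<phi>)"

definition substructure ::
  "('f, 'r) signature \<Rightarrow> ('f, 'r, 'u) model \<Rightarrow> ('f, 'r, 'u) model \<Rightarrow> bool" where
  "substructure \<tau> M N \<longleftrightarrow> Dom M \<subseteq> Dom N \<and>
     (\<forall>f\<in>funs \<tau>. \<forall>as. length as = farity \<tau> f \<and> set as \<subseteq> Dom M \<longrightarrow> FnI M f as = FnI N f as) \<and>
     (\<forall>r\<in>rels \<tau>. \<forall>as. length as = rarity \<tau> r \<and> set as \<subseteq> Dom M \<longrightarrow> RelI M r as = RelI N r as)"

definition elementary_substructure ::
  "('f, 'r) signature \<Rightarrow> ('f, 'r, 'u) model \<Rightarrow> ('f, 'r, 'u) model \<Rightarrow> bool" where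
  "elementary_substructure \<tau> M N \<longleftrightarrow> substructure \<tau> M N \<and>
     (\<forall>\<phi> e. is_fm \<tau> \<phi> \<and> range e \<subseteq> Dom M \<longrightarrow> eval M e \<phi> = eval N e \<phi>)"

definition model_complete ::
  "'u itself \<Rightarrow> ('f, 'r) signature \<Rightarrow> ('f, 'r) fm set \<Rightarrow> bool" where
  "model_complete U \<tau> T \<longleftrightarrow>
     (\<forall>M N :: ('f, 'r, 'u) model. is_model \<tau> T M \<and> is_model \<tau> T N \<and> substructure \<tau> M N
        \<longrightarrow> elementary_substructure \<tau> M N)"


section \<open>Quantifiers with automatically chosen bound variables\<close>

text \<open>The list \<open>ts\<close> must contain every term that occurs in the scope \<open>B\<close>, apart from
  the newly bound variable: the bound variable is chosen fresh for \<open>ts\<close>.\<close>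

definition fresh :: "'f tm list \<Rightarrow> nat"
  where "fresh ts = Suc (Max (insert 0 (\<Union>t\<in>set ts. tvars t)))"

definition Forall :: "'f tm list \<Rightarrow> ('f tm \<Rightarrow> ('f, 'r) fm) \<Rightarrow> ('f, 'r) fm"
  where "Forall ts B = FAll (fresh ts) (B (Var (fresh ts)))"

definition Exists :: "'f tm list \<Rightarrow> ('f tm \<Rightarrow> ('f, 'r) fm) \<Rightarrow> ('f, 'r) fm"
  where "Exists ts B = FEx (fresh ts) (B (Var (fresh ts)))"


section \<open>The signature of set theory with \<open>\<Delta>\<^sub>0\<close>-predicates and Goedel operations\<close>

text \<open>\<open>\<Delta>\<^sub>0\<close>-formulas of the language \<open>{\<in>}\<close>; \<open>D_Ex x y \<phi>\<close> is
  \<open>\<exists>x\<in>y. \<phi>\<close>.\<close>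
datatype d0 = D_Eq nat nat | D_Mem nat nat | D_Not d0 | D_And d0 d0 | D_Ex nat nat d0

fun is_d0 :: "d0 \<Rightarrow> bool" where
  "is_d0 (D_Not \<phi>) = is_d0 \<phi>"
| "is_d0 (D_And \<phi> \<psi>) = (is_d0 \<phi> \<and> is_d0 \<psi>)"
| "is_d0 (D_Ex x y \<phi>) = (x \<noteq> y \<and> is_d0 \<phi>)"
| "is_d0 _ = True"

text \<open>The ten Goedel operations:
  \<open>{x,y}\<close>, \<open>x \<times> y\<close>, \<open>{(u,v). u \<in> x \<and> v \<in> y \<and> u \<in> v}\<close>, \<open>x - y\<close>,
  \<open>x \<inter> y\<close>, \<open>\<Union>x\<close>, \<open>dom x\<close>, \<open>{(u,v). (v,u) \<in> x}\<close>,
  \<open>{(u,v,w). (u,w,v) \<in> x}\<close>, \<open>{(u,v,w). (v,w,u) \<in> x}\<close>, where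
  \<open>(u,v,w) = ((u,v),w)\<close>.\<close>
datatype goedel_op =
  G_Pair | G_Times | G_Eps | G_Diff | G_Int | G_Union | G_Dom | G_Conv | G_Swap | G_Rot

text \<open>\<open>FX\<close> and \<open>RX\<close> provide the symbols which \<open>\<tau>\<close> may have beyond
  \<open>\<in>\<^sub>\<Delta>\<^sub>0\<close>.\<close>
datatype 'f fsym = F_Empty | F_Omega | F_Goedel goedel_op | FX 'f
datatype 'r rsym = R_Mem | R_D0 d0 | RX 'r

type_synonym 'f stm = "'f fsym tm"
type_synonym ('f, 'r) sfm = "('f fsym, 'r rsym) fm"
type_synonym ('f, 'r) ssig = "('f fsym, 'r rsym) signature"

abbreviation Mem :: "'f stm \<Rightarrow> 'f stm \<Rightarrow> ('f, 'r) sfm"  (infix "\<^bold>\<in>" 50)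
  where "s \<^bold>\<in> t \<equiv> Rel R_Mem [s, t]"

abbreviation Empty :: "'f stm" where "Empty \<equiv> Fn F_Empty []"
abbreviation Omega :: "'f stm" where "Omega \<equiv> Fn F_Omega []"
abbreviation G1 :: "goedel_op \<Rightarrow> 'f stm \<Rightarrow> 'f stm" where "G1 g s \<equiv> Fn (F_Goedel g) [s]"
abbreviation G2 :: "goedel_op \<Rightarrow> 'f stm \<Rightarrow> 'f stm \<Rightarrow> 'f stm" where "G2 g s t \<equiv> Fn (F_Goedel g) [s, t]"

fun d0_fm :: "d0 \<Rightarrow> ('f, 'r) sfm" where
  "d0_fm (D_Eq x y) = (Var x \<^bold>= Var y)"
| "d0_fm (D_Mem x y) = (Var x \<^bold>\<in> Var y)"
| "d0_fm (D_Not \<phi>) = (\<^bold>\<not> d0_fm \<phi>)"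
| "d0_fm (D_And \<phi> \<psi>) = (d0_fm \<phi> \<^bold>\<and> d0_fm \<psi>)"
| "d0_fm (D_Ex x y \<phi>) = FEx x (Var x \<^bold>\<in> Var y \<^bold>\<and> d0_fm \<phi>)"

fun d0_fv :: "d0 \<Rightarrow> nat set" where
  "d0_fv (D_Eq x y) = {x, y}"
| "d0_fv (D_Mem x y) = {x, y}"
| "d0_fv (D_Not \<phi>) = d0_fv \<phi>"
| "d0_fv (D_And \<phi> \<psi>) = d0_fv \<phi> \<union> d0_fv \<psi>"
| "d0_fv (D_Ex x y \<phi>) = insert y (d0_fv \<phi> - {x})"

text \<open>The symbol \<open>R_D0 \<phi>\<close> takes the variables \<open>0, \<dots>, n - 1\<close> of
  \<open>\<phi>\<close> as arguments, where \<open>n\<close> is least such that these include all free ones.\<close>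
definition d0_arity :: "d0 \<Rightarrow> nat" where "d0_arity \<phi> = Suc (Max (d0_fv \<phi>))"

definition sig_D0 :: "('f, 'r) ssig" where
  "sig_D0 = \<lparr>
     funs = {F_Empty, F_Omega} \<union> range F_Goedel,
     rels = {R_Mem} \<union> R_D0 ` {\<phi>. is_d0 \<phi>},
     farity = (\<lambda>f. case f of F_Goedel g \<Rightarrow> (if g \<in> {G_Pair, G_Times, G_Eps, G_Diff, G_Int} then 2 else 1)
                           | _ \<Rightarrow> 0),
     rarity = (\<lambda>r. case r of R_D0 \<phi> \<Rightarrow> d0_arity \<phi> | _ \<Rightarrow> 2)\<rparr>"


section \<open>Set-theoretic notions as formulas\<close>

definition Forall_in :: "'f stm list \<Rightarrow> 'f stm \<Rightarrow> ('f stm \<Rightarrow> ('f, 'r) sfm) \<Rightarrow> ('f, 'r) sfm"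
  where "Forall_in ts s B = Forall (s # ts) (\<lambda>x. x \<^bold>\<in> s \<^bold>\<longrightarrow> B x)"

definition Exists_in :: "'f stm list \<Rightarrow> 'f stm \<Rightarrow> ('f stm \<Rightarrow> ('f, 'r) sfm) \<Rightarrow> ('f, 'r) sfm"
  where "Exists_in ts s B = Exists (s # ts) (\<lambda>x. x \<^bold>\<in> s \<^bold>\<and> B x)"

definition Subset :: "'f stm \<Rightarrow> 'f stm \<Rightarrow> ('f, 'r) sfm"  (infix "\<^bold>\<subseteq>" 50)
  where "s \<^bold>\<subseteq> t = Forall_in [t] s (\<lambda>x. x \<^bold>\<in> t)"

abbreviation OPair :: "'f stm \<Rightarrow> 'f stm \<Rightarrow> 'f stm"
  where "OPair s t \<equiv> G2 G_Pair (G2 G_Pair s s) (G2 G_Pair s t)"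

abbreviation Dom_of :: "'f stm \<Rightarrow> 'f stm"
  where "Dom_of s \<equiv> G1 G_Dom s"

definition Is_func :: "'f stm \<Rightarrow> ('f, 'r) sfm" where
  "Is_func f =
     (Forall_in [f] f (\<lambda>p. Exists [f, p] (\<lambda>x. Exists [f, p, x] (\<lambda>y. p \<^bold>= OPair x y))) \<^bold>\<and>
      Forall [f] (\<lambda>x. Forall [f, x] (\<lambda>y. Forall [f, x, y] (\<lambda>z.
        OPair x y \<^bold>\<in> f \<^bold>\<and> OPair x z \<^bold>\<in> f \<^bold>\<longrightarrow> y \<^bold>= z))))"

definition Has_range :: "'f stm \<Rightarrow> 'f stm \<Rightarrow> ('f, 'r) sfm" where
  "Has_range f r = Forall [f, r] (\<lambda>y. y \<^bold>\<in> r \<^bold>\<longleftrightarrow> Exists [f, r, y] (\<lambda>x. OPair x y \<^bold>\<in> f))"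

definition Is_surj :: "'f stm \<Rightarrow> 'f stm \<Rightarrow> 'f stm \<Rightarrow> ('f, 'r) sfm" where
  "Is_surj f a b = (Is_func f \<^bold>\<and> Dom_of f \<^bold>= a \<^bold>\<and> Has_range f b)"

definition Is_bij :: "'f stm \<Rightarrow> 'f stm \<Rightarrow> 'f stm \<Rightarrow> ('f, 'r) sfm" where
  "Is_bij f a b = (Is_surj f a b \<^bold>\<and>
     Forall [f] (\<lambda>x. Forall [f, x] (\<lambda>y. Forall [f, x, y] (\<lambda>z.
       OPair x z \<^bold>\<in> f \<^bold>\<and> OPair y z \<^bold>\<in> f \<^bold>\<longrightarrow> x \<^bold>= y))))"

definition Is_ord :: "'f stm \<Rightarrow> ('f, 'r) sfm" where
  "Is_ord s = (Forall_in [s] s (\<lambda>x. x \<^bold>\<subseteq> s) \<^bold>\<and>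
     Forall_in [s] s (\<lambda>x. Forall_in [s, x] s (\<lambda>y. x \<^bold>\<in> y \<^bold>\<or> x \<^bold>= y \<^bold>\<or> y \<^bold>\<in> x)))"

definition Is_limit_ord :: "'f stm \<Rightarrow> ('f, 'r) sfm" where
  "Is_limit_ord s = (Is_ord s \<^bold>\<and> \<^bold>\<not> s \<^bold>= Empty \<^bold>\<and>
     Forall_in [s] s (\<lambda>x. Exists_in [s, x] s (\<lambda>y. x \<^bold>\<in> y)))"

definition Is_card :: "'f stm \<Rightarrow> ('f, 'r) sfm" where
  "Is_card s = (Is_ord s \<^bold>\<and>
     Forall_in [s] s (\<lambda>b. \<^bold>\<not> Exists [s, b] (\<lambda>f. Is_bij f b s)))"


section \<open>The axioms of set theory\<close>

fun goedel_ax :: "goedel_op \<Rightarrow> ('f, 'r) sfm" where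
  "goedel_ax G_Pair = Forall [] (\<lambda>x. Forall [x] (\<lambda>y. Forall [x, y] (\<lambda>z.
     z \<^bold>\<in> G2 G_Pair x y \<^bold>\<longleftrightarrow> z \<^bold>= x \<^bold>\<or> z \<^bold>= y)))"
| "goedel_ax G_Times = Forall [] (\<lambda>x. Forall [x] (\<lambda>y. Forall [x, y] (\<lambda>z.
     z \<^bold>\<in> G2 G_Times x y \<^bold>\<longleftrightarrow>
       Exists_in [x, y, z] x (\<lambda>u. Exists_in [x, y, z, u] y (\<lambda>v. z \<^bold>= OPair u v)))))"
| "goedel_ax G_Eps = Forall [] (\<lambda>x. Forall [x] (\<lambda>y. Forall [x, y] (\<lambda>z.
     z \<^bold>\<in> G2 G_Eps x y \<^bold>\<longleftrightarrow>
       Exists_in [x, y, z] x (\<lambda>u. Exists_in [x, y, z, u] y (\<lambda>v. z \<^bold>= OPair u v \<^bold>\<and> u \<^bold>\<in> v)))))"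
| "goedel_ax G_Diff = Forall [] (\<lambda>x. Forall [x] (\<lambda>y. Forall [x, y] (\<lambda>z.
     z \<^bold>\<in> G2 G_Diff x y \<^bold>\<longleftrightarrow> z \<^bold>\<in> x \<^bold>\<and> \<^bold>\<not> z \<^bold>\<in> y)))"
| "goedel_ax G_Int = Forall [] (\<lambda>x. Forall [x] (\<lambda>y. Forall [x, y] (\<lambda>z.
     z \<^bold>\<in> G2 G_Int x y \<^bold>\<longleftrightarrow> z \<^bold>\<in> x \<^bold>\<and> z \<^bold>\<in> y)))"
| "goedel_ax G_Union = Forall [] (\<lambda>x. Forall [x] (\<lambda>z.
     z \<^bold>\<in> G1 G_Union x \<^bold>\<longleftrightarrow> Exists_in [x, z] x (\<lambda>u. z \<^bold>\<in> u)))"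
| "goedel_ax G_Dom = Forall [] (\<lambda>x. Forall [x] (\<lambda>z.
     z \<^bold>\<in> G1 G_Dom x \<^bold>\<longleftrightarrow> Exists [x, z] (\<lambda>u. OPair z u \<^bold>\<in> x)))"
| "goedel_ax G_Conv = Forall [] (\<lambda>x. Forall [x] (\<lambda>z.
     z \<^bold>\<in> G1 G_Conv x \<^bold>\<longleftrightarrow>
       Exists [x, z] (\<lambda>u. Exists [x, z, u] (\<lambda>v. z \<^bold>= OPair u v \<^bold>\<and> OPair v u \<^bold>\<in> x))))"
| "goedel_ax G_Swap = Forall [] (\<lambda>x. Forall [x] (\<lambda>z.
     z \<^bold>\<in> G1 G_Swap x \<^bold>\<longleftrightarrow>
       Exists [x, z] (\<lambda>u. Exists [x, z, u] (\<lambda>v. Exists [x, z, u, v] (\<lambda>w.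
         z \<^bold>= OPair (OPair u v) w \<^bold>\<and> OPair (OPair u w) v \<^bold>\<in> x)))))"
| "goedel_ax G_Rot = Forall [] (\<lambda>x. Forall [x] (\<lambda>z.
     z \<^bold>\<in> G1 G_Rot x \<^bold>\<longleftrightarrow>
       Exists [x, z] (\<lambda>u. Exists [x, z, u] (\<lambda>v. Exists [x, z, u, v] (\<lambda>w.
         z \<^bold>= OPair (OPair u v) w \<^bold>\<and> OPair (OPair v w) u \<^bold>\<in> x)))))"

definition d0_ax :: "d0 \<Rightarrow> ('f, 'r) sfm" where
  "d0_ax \<phi> = FAlls [0..<d0_arity \<phi>] (Rel (R_D0 \<phi>) (map Var [0..<d0_arity \<phi>]) \<^bold>\<longleftrightarrow> d0_fm \<phi>)"

definition T_D0 :: "('f, 'r) sfm set" where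
  "T_D0 = d0_ax ` {\<phi>. is_d0 \<phi>} \<union> range goedel_ax \<union>
     {Forall [] (\<lambda>x. \<^bold>\<not> x \<^bold>\<in> Empty),
      Is_limit_ord Omega \<^bold>\<and> Forall_in [] Omega (\<lambda>x. \<^bold>\<not> Is_limit_ord x)}"

definition extensionality_ax :: "('f, 'r) sfm" where
  "extensionality_ax = Forall [] (\<lambda>x. Forall [x] (\<lambda>y.
     Forall [x, y] (\<lambda>z. z \<^bold>\<in> x \<^bold>\<longleftrightarrow> z \<^bold>\<in> y) \<^bold>\<longrightarrow> x \<^bold>= y))"

definition foundation_ax :: "('f, 'r) sfm" where
  "foundation_ax = Forall [] (\<lambda>x. Exists [x] (\<lambda>y. y \<^bold>\<in> x) \<^bold>\<longrightarrow>
     Exists_in [x] x (\<lambda>y. Forall_in [x, y] x (\<lambda>z. \<^bold>\<not> z \<^bold>\<in> y)))"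

definition Zm_D0 :: "('f, 'r) sfm set"
  where "Zm_D0 = {extensionality_ax, foundation_ax} \<union> T_D0"

text \<open>The instance of the replacement scheme for \<open>\<phi>(x,y,z)\<close>, where \<open>z\<close> stands for
  the other free variables of \<open>\<phi>\<close>; the variables \<open>k\<close> and \<open>k + 1\<close> play the roles
  of \<open>X\<close> and \<open>F\<close>.\<close>
definition replacement_ax :: "('f, 'r) sfm \<Rightarrow> nat \<Rightarrow> nat \<Rightarrow> ('f, 'r) sfm" where
  "replacement_ax \<phi> x y =
     (let k = Suc (Max (fv \<phi> \<union> {x, y})); X = Var k; F = Var (k + 1) in
      FClose (FAll x (FEx y \<phi>) \<^bold>\<longrightarrow>
        FAll k (FEx (k + 1) (Is_func F \<^bold>\<and> Dom_of F \<^bold>= X \<^bold>\<and>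
          FAll x (Var x \<^bold>\<in> X \<^bold>\<longrightarrow> FEx y (OPair (Var x) (Var y) \<^bold>\<in> F \<^bold>\<and> \<phi>))))))"

definition choice_ax :: "('f, 'r) sfm" where
  "choice_ax = Forall [] (\<lambda>X. Exists [X] (\<lambda>F. Is_func F \<^bold>\<and> Dom_of F \<^bold>= X \<^bold>\<and>
     Forall_in [X, F] X (\<lambda>x. \<^bold>\<not> x \<^bold>= Empty \<^bold>\<longrightarrow> Exists_in [X, F, x] x (\<lambda>y. OPair x y \<^bold>\<in> F))))"

definition powerset_ax :: "('f, 'r) sfm" where
  "powerset_ax = Forall [] (\<lambda>x. Exists [x] (\<lambda>p. Forall [x, p] (\<lambda>z. z \<^bold>\<in> p \<^bold>\<longleftrightarrow> z \<^bold>\<subseteq> x)))"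

definition ZFm :: "('f, 'r) ssig \<Rightarrow> ('f, 'r) sfm set"
  where "ZFm \<tau> = Zm_D0 \<union> {replacement_ax \<phi> x y | \<phi> x y. is_fm \<tau> \<phi> \<and> x \<noteq> y}"

definition ZFCm :: "('f, 'r) ssig \<Rightarrow> ('f, 'r) sfm set"
  where "ZFCm \<tau> = ZFm \<tau> \<union> {choice_ax}"

definition ZFC :: "('f, 'r) ssig \<Rightarrow> ('f, 'r) sfm set"
  where "ZFC \<tau> = ZFCm \<tau> \<union> {powerset_ax}"


section \<open>Codes\<close>

text \<open>\<open>R\<close> is a well-founded extensional relation on \<open>\<alpha> \<le> \<kappa>\<close> with top
  element \<open>0\<close>, that is, \<open>0\<close> is the top of the transitive closure of \<open>R\<close>. The
  point \<open>0\<close> always counts as a member of the field, so that the empty relation on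
  \<open>\<alpha> = 1\<close> is a code, namely of the empty set.\<close>
definition Is_WFE_on :: "'f stm \<Rightarrow> 'f stm \<Rightarrow> 'f stm \<Rightarrow> ('f, 'r) sfm" where
  "Is_WFE_on \<kappa> \<alpha> R =
     (R \<^bold>\<subseteq> G2 G_Times \<kappa> \<kappa> \<^bold>\<and>
      (\<alpha> \<^bold>\<in> \<kappa> \<^bold>\<or> \<alpha> \<^bold>= \<kappa>) \<^bold>\<and>
      Forall [\<alpha>, R] (\<lambda>x. x \<^bold>\<in> \<alpha> \<^bold>\<longleftrightarrow>
        x \<^bold>= Empty \<^bold>\<or> Exists [R, x] (\<lambda>y. OPair x y \<^bold>\<in> R \<^bold>\<or> OPair y x \<^bold>\<in> R)) \<^bold>\<and>
      Forall [\<alpha>, R] (\<lambda>A. A \<^bold>\<subseteq> \<alpha> \<^bold>\<and> \<^bold>\<not> A \<^bold>= Empty \<^bold>\<longrightarrow>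
        Exists_in [R, A] A (\<lambda>x. Forall_in [R, A, x] A (\<lambda>y. \<^bold>\<not> OPair y x \<^bold>\<in> R))) \<^bold>\<and>
      Forall_in [\<alpha>, R] \<alpha> (\<lambda>x. Forall_in [\<alpha>, R, x] \<alpha> (\<lambda>y.
        Forall_in [\<alpha>, R, x, y] \<alpha> (\<lambda>z. OPair z x \<^bold>\<in> R \<^bold>\<longleftrightarrow> OPair z y \<^bold>\<in> R) \<^bold>\<longrightarrow> x \<^bold>= y)) \<^bold>\<and>
      Forall [\<alpha>, R] (\<lambda>Q.
        R \<^bold>\<subseteq> Q \<^bold>\<and>
        Forall [Q] (\<lambda>x. Forall [Q, x] (\<lambda>y. Forall [Q, x, y] (\<lambda>z.
          OPair x y \<^bold>\<in> Q \<^bold>\<and> OPair y z \<^bold>\<in> Q \<^bold>\<longrightarrow> OPair x z \<^bold>\<in> Q))) \<^bold>\<longrightarrow>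
        Forall_in [\<alpha>, Q] \<alpha> (\<lambda>x. x \<^bold>= Empty \<^bold>\<or> OPair x Empty \<^bold>\<in> Q)))"

text \<open>\<open>f\<close> is the transitive collapse of \<open>(\<alpha>, R)\<close>:
  \<open>f(x) = {f(y). y \<in> \<alpha> \<and> (y,x) \<in> R}\<close>.\<close>
definition Is_collapse :: "'f stm \<Rightarrow> 'f stm \<Rightarrow> 'f stm \<Rightarrow> ('f, 'r) sfm" where
  "Is_collapse f \<alpha> R =
     (Is_func f \<^bold>\<and> Dom_of f \<^bold>= \<alpha> \<^bold>\<and>
      Forall_in [f, \<alpha>, R] \<alpha> (\<lambda>x. Forall [f, \<alpha>, R, x] (\<lambda>v. OPair x v \<^bold>\<in> f \<^bold>\<longrightarrow>
        Forall [f, \<alpha>, R, x, v] (\<lambda>w. w \<^bold>\<in> v \<^bold>\<longleftrightarrow>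
          Exists_in [f, R, x, w] \<alpha> (\<lambda>y. OPair y x \<^bold>\<in> R \<^bold>\<and> OPair y w \<^bold>\<in> f)))))"

text \<open>\<open>x = Cod\<^sub>\<kappa>(R)\<close> for \<open>R \<subseteq> \<kappa>\<times>\<kappa>\<close>\<close>
definition Is_Cod :: "'f stm \<Rightarrow> 'f stm \<Rightarrow> 'f stm \<Rightarrow> ('f, 'r) sfm" where
  "Is_Cod \<kappa> R x = Exists [\<kappa>, R, x] (\<lambda>\<alpha>. Is_WFE_on \<kappa> \<alpha> R \<^bold>\<and>
     Exists [\<alpha>, R, x] (\<lambda>f. Is_collapse f \<alpha> R \<^bold>\<and> OPair Empty x \<^bold>\<in> f))"

text \<open>The maximum \<open>a \<union> b\<close> of two ordinals, and Goedel's well-order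
  \<open>(a,b) \<prec> (c,d)\<close> of pairs of ordinals: first by maximum, then lexicographically.\<close>
abbreviation Ord_max :: "'f stm \<Rightarrow> 'f stm \<Rightarrow> 'f stm"
  where "Ord_max a b \<equiv> G1 G_Union (G2 G_Pair a b)"

definition Goedel_less :: "'f stm \<Rightarrow> 'f stm \<Rightarrow> 'f stm \<Rightarrow> 'f stm \<Rightarrow> ('f, 'r) sfm" where
  "Goedel_less a b c d =
     (Ord_max a b \<^bold>\<in> Ord_max c d \<^bold>\<or>
      (Ord_max a b \<^bold>= Ord_max c d \<^bold>\<and> (a \<^bold>\<in> c \<^bold>\<or> (a \<^bold>= c \<^bold>\<and> b \<^bold>\<in> d))))"

text \<open>\<open>g\<close> is the restriction to \<open>\<kappa>\<times>\<kappa>\<close> of Goedel's pairing function, that is,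
  \<open>g(a,b)\<close> is the order type of the set of \<open>\<prec>\<close>-predecessors of \<open>(a,b)\<close>.\<close>
definition Is_pairing :: "'f stm \<Rightarrow> 'f stm \<Rightarrow> ('f, 'r) sfm" where
  "Is_pairing \<kappa> g =
     (Is_func g \<^bold>\<and> Dom_of g \<^bold>= G2 G_Times \<kappa> \<kappa> \<^bold>\<and>
      Forall_in [\<kappa>, g] \<kappa> (\<lambda>a. Forall_in [\<kappa>, g, a] \<kappa> (\<lambda>b. Forall [\<kappa>, g, a, b] (\<lambda>v.
        OPair (OPair a b) v \<^bold>\<in> g \<^bold>\<longrightarrow>
        Forall [\<kappa>, g, a, b, v] (\<lambda>w. w \<^bold>\<in> v \<^bold>\<longleftrightarrow>
          Exists_in [g, a, b, w] \<kappa> (\<lambda>c. Exists_in [g, a, b, w, c] \<kappa> (\<lambda>d.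
            Goedel_less c d a b \<^bold>\<and> OPair (OPair c d) w \<^bold>\<in> g)))))))"

text \<open>The set \<open>y \<subseteq> \<kappa>\<close> represents the relation \<open>R \<subseteq> \<kappa>\<times>\<kappa>\<close> via
  Goedel's pairing function, which identifies \<open>\<kappa>\<times>\<kappa>\<close> with \<open>\<kappa>\<close> for
  infinite cardinals \<open>\<kappa>\<close>.\<close>
definition Represents :: "'f stm \<Rightarrow> 'f stm \<Rightarrow> 'f stm \<Rightarrow> ('f, 'r) sfm" where
  "Represents \<kappa> y R =
     (y \<^bold>\<subseteq> \<kappa> \<^bold>\<and> R \<^bold>\<subseteq> G2 G_Times \<kappa> \<kappa> \<^bold>\<and>
      Exists [\<kappa>, y, R] (\<lambda>g. Is_pairing \<kappa> g \<^bold>\<and>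
        Forall_in [\<kappa>, y, R, g] \<kappa> (\<lambda>a. Forall_in [\<kappa>, y, R, g, a] \<kappa> (\<lambda>b.
          OPair a b \<^bold>\<in> R \<^bold>\<longleftrightarrow> Exists_in [R, g, a, b] y (\<lambda>v. OPair (OPair a b) v \<^bold>\<in> g)))))"

text \<open>\<open>x = Cod\<^sub>\<kappa>(y)\<close> for \<open>y \<subseteq> \<kappa>\<close>. The codes have to be subsets of
  \<open>\<kappa>\<close>, because the predicates of a projective family only hold of such sets.\<close>
definition Codes :: "'f stm \<Rightarrow> 'f stm \<Rightarrow> 'f stm \<Rightarrow> ('f, 'r) sfm" where
  "Codes \<kappa> y x = Exists [\<kappa>, y, x] (\<lambda>R. Represents \<kappa> y R \<^bold>\<and> Is_Cod \<kappa> R x)"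


section \<open>Projectively closed signatures\<close>

abbreviation vars :: "nat list \<Rightarrow> 'f tm list"
  where "vars vs \<equiv> map Var vs"

definition FSubsets :: "'f stm \<Rightarrow> nat list \<Rightarrow> ('f, 'r) sfm"
  where "FSubsets \<kappa> vs = FConj (map (\<lambda>v. Var v \<^bold>\<subseteq> \<kappa>) vs)"

definition P1 :: "'f stm \<Rightarrow> ('f, 'r) sfm"
  where "P1 \<kappa> = Is_card \<kappa>"

definition P2 :: "('f, 'r) ssig \<Rightarrow> 'f stm \<Rightarrow> 'r rsym \<Rightarrow> ('f, 'r) sfm" where
  "P2 \<tau> \<kappa> R = (let xs = [0..<rarity \<tau> R] in FAlls xs (Rel R (vars xs) \<^bold>\<longrightarrow> FSubsets \<kappa> xs))"

text \<open>\<open>n\<close> is the length of the tuples; the variables \<open>0, \<dots>, n - 1\<close> are those of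
  \<open>\<phi>\<close>, and the variables \<open>n, \<dots>, 2n - 1\<close> stand for their codes.\<close>
definition P3 :: "'f stm \<Rightarrow> nat \<Rightarrow> ('f, 'r) sfm \<Rightarrow> 'r rsym \<Rightarrow> ('f, 'r) sfm" where
  "P3 \<kappa> n \<phi> R =
     FAlls [n..<n + n]
       (FExs [0..<n] (FConj (map (\<lambda>i. Codes \<kappa> (Var (n + i)) (Var i)) [0..<n]) \<^bold>\<and> \<phi>)
        \<^bold>\<longleftrightarrow> Rel R (vars [n..<n + n]))"

definition P4 :: "('f, 'r) ssig \<Rightarrow> 'f stm \<Rightarrow> 'r rsym \<Rightarrow> 'r rsym \<Rightarrow> 'r rsym \<Rightarrow> ('f, 'r) sfm" where
  "P4 \<tau> \<kappa> R S U =
     (let m = rarity \<tau> R; n = rarity \<tau> S in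
      FAlls [0..<m + n] (FSubsets \<kappa> [0..<m + n] \<^bold>\<longrightarrow>
        (Rel R (vars [0..<m]) \<^bold>\<or> Rel S (vars [m..<m + n]) \<^bold>\<longleftrightarrow> Rel U (vars [0..<m + n]))))"

definition P5 :: "('f, 'r) ssig \<Rightarrow> 'r rsym \<Rightarrow> 'r rsym \<Rightarrow> 'r rsym \<Rightarrow> ('f, 'r) sfm" where
  "P5 \<tau> R S U =
     (let m = rarity \<tau> R; n = rarity \<tau> S in
      FAlls [0..<m + n]
        (Rel R (vars [0..<m]) \<^bold>\<and> Rel S (vars [m..<m + n]) \<^bold>\<longleftrightarrow> Rel U (vars [0..<m + n])))"

definition P6 :: "('f, 'r) ssig \<Rightarrow> 'f stm \<Rightarrow> 'r rsym \<Rightarrow> 'r rsym \<Rightarrow> ('f, 'r) sfm" where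
  "P6 \<tau> \<kappa> R U =
     (let xs = [0..<rarity \<tau> R] in
      FAlls xs (FSubsets \<kappa> xs \<^bold>\<longrightarrow> (Rel R (vars xs) \<^bold>\<longleftrightarrow> \<^bold>\<not> Rel U (vars xs))))"

definition P7 :: "('f, 'r) ssig \<Rightarrow> 'f stm \<Rightarrow> 'r rsym \<Rightarrow> nat \<Rightarrow> 'r rsym \<Rightarrow> ('f, 'r) sfm" where
  "P7 \<tau> \<kappa> R i U =
     (let n = rarity \<tau> R; xs = [0..<i] @ [Suc i..<n] in
      FAlls xs (Rel U (vars xs) \<^bold>\<longleftrightarrow> FEx i (Var i \<^bold>\<subseteq> \<kappa> \<^bold>\<and> Rel R (vars [0..<n]))))"

definition is_qf_fm :: "('f, 'r) signature \<Rightarrow> nat \<Rightarrow> ('f, 'r) fm \<Rightarrow> bool"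
  where "is_qf_fm \<tau> n \<phi> \<longleftrightarrow> is_fm \<tau> \<phi> \<and> quantifier_free \<phi> \<and> fv \<phi> \<subseteq> {..<n}"

definition P_instances :: "('f, 'r) ssig \<Rightarrow> 'f stm \<Rightarrow> 'r rsym set \<Rightarrow> ('f, 'r) sfm set" where
  "P_instances \<tau> \<kappa> \<tau>\<^sub>0 =
     {P1 \<kappa>} \<union>
     {P2 \<tau> \<kappa> R | R. R \<in> \<tau>\<^sub>0} \<union>
     {P3 \<kappa> n \<phi> R | n \<phi> R. is_qf_fm \<tau> n \<phi> \<and> R \<in> \<tau>\<^sub>0 \<and> rarity \<tau> R = n} \<union>
     {P4 \<tau> \<kappa> R S U | R S U. {R, S, U} \<subseteq> \<tau>\<^sub>0 \<and> rarity \<tau> U = rarity \<tau> R + rarity \<tau> S} \<union>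
     {P5 \<tau> R S U | R S U. {R, S, U} \<subseteq> \<tau>\<^sub>0 \<and> rarity \<tau> U = rarity \<tau> R + rarity \<tau> S} \<union>
     {P6 \<tau> \<kappa> R U | R U. {R, U} \<subseteq> \<tau>\<^sub>0 \<and> rarity \<tau> U = rarity \<tau> R} \<union>
     {P7 \<tau> \<kappa> R i U | R i U. {R, U} \<subseteq> \<tau>\<^sub>0 \<and> i < rarity \<tau> R \<and> Suc (rarity \<tau> U) = rarity \<tau> R}"

text \<open>\<open>\<tau>\<close> is \<open>\<kappa>\<close>-projectively closed for \<open>T\<close>, as witnessed by the family
  \<open>\<tau>\<^sub>0\<close> of predicate symbols.\<close>
definition projectively_closed_by ::
  "'u itself \<Rightarrow> ('f, 'r) ssig \<Rightarrow> 'f fsym \<Rightarrow> ('f, 'r) sfm set \<Rightarrow> 'r rsym set \<Rightarrow> bool" where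
  "projectively_closed_by U \<tau> k T \<tau>\<^sub>0 \<longleftrightarrow>
     (let \<kappa> = Fn k [] in
      extends \<tau> sig_D0 \<and> k \<in> funs \<tau> \<and> farity \<tau> k = 0 \<and>
      is_theory \<tau> T \<and> ZFCm \<tau> \<subseteq> T \<and> \<tau>\<^sub>0 \<subseteq> rels \<tau> \<and>
      entails U \<tau> T (P1 \<kappa>) \<and>
      (\<forall>R\<in>\<tau>\<^sub>0. entails U \<tau> T (P2 \<tau> \<kappa> R)) \<and>
      (\<forall>n \<phi>. is_qf_fm \<tau> n \<phi> \<longrightarrow> (\<exists>R\<in>\<tau>\<^sub>0. rarity \<tau> R = n \<and> entails U \<tau> T (P3 \<kappa> n \<phi> R))) \<and>
      (\<forall>R\<in>\<tau>\<^sub>0. \<forall>S\<in>\<tau>\<^sub>0. \<exists>V\<in>\<tau>\<^sub>0.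
         rarity \<tau> V = rarity \<tau> R + rarity \<tau> S \<and> entails U \<tau> T (P4 \<tau> \<kappa> R S V)) \<and>
      (\<forall>R\<in>\<tau>\<^sub>0. \<forall>S\<in>\<tau>\<^sub>0. \<exists>V\<in>\<tau>\<^sub>0.
         rarity \<tau> V = rarity \<tau> R + rarity \<tau> S \<and> entails U \<tau> T (P5 \<tau> R S V)) \<and>
      (\<forall>R\<in>\<tau>\<^sub>0. \<exists>V\<in>\<tau>\<^sub>0. rarity \<tau> V = rarity \<tau> R \<and> entails U \<tau> T (P6 \<tau> \<kappa> R V)) \<and>
      (\<forall>R\<in>\<tau>\<^sub>0. \<forall>i<rarity \<tau> R. \<exists>V\<in>\<tau>\<^sub>0.
         Suc (rarity \<tau> V) = rarity \<tau> R \<and> entails U \<tau> T (P7 \<tau> \<kappa> R i V)))"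

text \<open>Every nonempty set is the range of a function with domain \<open>\<kappa>\<close>; the empty set is
  not, as \<open>\<kappa>\<close> is not empty.\<close>
definition surjection_ax :: "'f stm \<Rightarrow> ('f, 'r) sfm" where
  "surjection_ax \<kappa> =
     Forall [\<kappa>] (\<lambda>x. \<^bold>\<not> x \<^bold>= Empty \<^bold>\<longrightarrow> Exists [\<kappa>, x] (\<lambda>f. Is_surj f \<kappa> x))"

definition S_theory ::
  "'u itself \<Rightarrow> ('f, 'r) ssig \<Rightarrow> 'f fsym \<Rightarrow> ('f, 'r) sfm set \<Rightarrow> 'r rsym set \<Rightarrow> ('f, 'r) sfm set" where
  "S_theory U \<tau> k T \<tau>\<^sub>0 =
     (let \<kappa> = Fn k [] in
      ZFCm \<tau> \<union> {\<phi> \<in> P_instances \<tau> \<kappa> \<tau>\<^sub>0. entails U \<tau> T \<phi>} \<union> {surjection_ax \<kappa>})"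

end

theory Submission
  imports Defs "HOL-Library.Nat_Bijection"
begin

text \<open>In a model of the theory every set is a surjective image of \<open>\<kappa>\<close>, hence has a code
  \<open>y \<subseteq> \<kappa>\<close>; here Goedel's pairing function has to map \<open>\<kappa> \<times> \<kappa>\<close> into \<open>\<kappa>\<close>, which is
  Hessenberg's theorem. Quantifiers over sets thus become quantifiers over codes, which are
  projections in the sense of (P7), and by (P3) every quantifier-free formula about sets is
  expressed by a predicate applied to their codes. As (P4) and (P5) only combine predicates with
  disjoint arguments, Boolean combinations are instead formed as quantifier-free formulas and
  coded once more: every formula \<open>\<phi>(x)\<close> becomes equivalent, uniformly in all models, to a
  quantifier-free formula \<open>\<chi>(y)\<close>, where \<open>y\<close> is an \<open>l\<close>-fold iterated code of \<open>x\<close>.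
  It remains to see that if \<open>y\<close> codes \<open>x\<close> in a model then also in every extension: that
  \<open>y\<close> is a code is expressed by a predicate of \<open>\<tau>\<close>, and the set it codes is determined by the
  pairing function and the collapse, whose defining conditions are equations between terms.\<close>

section \<open>Definable predicates of a structure\<close>

text \<open>Nothing is assumed about how a model M lies in an extension N: a set of M may gain
  elements in N, and a relation well-founded in M may fail to be so in N, where there may be more
  subsets to test it. This is why the statement that y codes x is split. Well-foundedness is part of
  y coding anything at all; by (P3) for the formula \<open>FTrue\<close> that is an atomic
  statement, so it passes to N regardless of the quantifiers hidden in it. That x is the coded set
  is witnessed by a pairing function and a collapse in M, whose equations persist in N; there the
  well-foundedness seen by N forces them to be the witnesses of N. As subsets of \<kappa> need not
  be codes, each negation and projection is relativised to tuples of codes by adding the translation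
  of a true formula. The models are arbitrary and may be ill-founded from outside, so recursion,
  ordinals and Hessenberg's theorem are developed inside them; a calculus of definable predicates
  gives access to the replacement scheme.\<close>

fun rename_tm :: "(nat \<Rightarrow> nat) \<Rightarrow> 'f tm \<Rightarrow> 'f tm" where
  "rename_tm r (Var v) = Var (r v)"
| "rename_tm r (Fn f ts) = Fn f (map (rename_tm r) ts)"

text \<open>Bound variables are renamed together with the free ones, so there is no question of
  capture; the price is that \<open>eval_rename\<close> asks for an injective \<open>r\<close>,
  which keeps an update at \<open>r v\<close> from touching other variables.\<close>

fun rename :: "(nat \<Rightarrow> nat) \<Rightarrow> ('f, 'r) fm \<Rightarrow> ('f, 'r) fm" where
  "rename r FTrue = FTrue"
| "rename r (s \<^bold>= t) = (rename_tm r s \<^bold>= rename_tm r t)"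
| "rename r (Rel R ts) = Rel R (map (rename_tm r) ts)"
| "rename r (\<^bold>\<not> \<phi>) = (\<^bold>\<not> rename r \<phi>)"
| "rename r (\<phi> \<^bold>\<and> \<psi>) = (rename r \<phi> \<^bold>\<and> rename r \<psi>)"
| "rename r (FEx v \<phi>) = FEx (r v) (rename r \<phi>)"

lemma teval_rename: "teval M e (rename_tm r t) = teval M (e \<circ> r) t"
  by (induction t) (auto simp: comp_def cong: map_cong)

lemma eval_rename: "inj r \<Longrightarrow> eval M e (rename r \<phi>) = eval M (e \<circ> r) \<phi>"
proof (induction \<phi> arbitrary: e)
  case (FEx v \<phi>)
  have "e(r v := a) \<circ> r = (e \<circ> r)(v := a)" for a
    using FEx.prems by (auto simp: fun_eq_iff inj_eq)
  moreover have "eval M (e(r v := a)) (rename r \<phi>) = eval M (e(r v := a) \<circ> r) \<phi>" for a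
    by (rule FEx.IH[OF FEx.prems])
  ultimately show ?case by (simp only: eval.simps rename.simps)
qed (auto simp: teval_rename comp_def cong: map_cong)

lemma is_tm_rename [simp]: "is_tm \<tau> (rename_tm r t) = is_tm \<tau> t"
  by (induction t) auto

lemma is_fm_rename [simp]: "is_fm \<tau> (rename r \<phi>) = is_fm \<tau> \<phi>"
  by (induction \<phi>) auto

lemma teval_cong: "(\<And>v. v \<in> tvars t \<Longrightarrow> e v = e' v) \<Longrightarrow> teval M e t = teval M e' t"
proof (induction t)
  case (Fn f ts)
  have "map (teval M e) ts = map (teval M e') ts"
    unfolding map_eq_conv by (intro ballI Fn.IH) (use Fn.prems in auto)
  then show ?case by (simp del: map_eq_conv)
qed simp

lemma eval_cong: "(\<And>v. v \<in> fv \<phi> \<Longrightarrow> e v = e' v) \<Longrightarrow> eval M e \<phi> = eval M e' \<phi>"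
proof (induction \<phi> arbitrary: e e')
  case (FEq s t)
  then show ?case using teval_cong[of s e e' M] teval_cong[of t e e' M] by simp
next
  case (Rel R ts)
  have "map (teval M e) ts = map (teval M e') ts"
    using Rel by (auto intro!: teval_cong)
  then show ?case by (simp del: map_eq_conv)
next
  case (FAnd \<phi> \<psi>)
  from FAnd.IH(1)[of e e'] FAnd.IH(2)[of e e'] FAnd.prems show ?case by auto
next
  case (FEx v \<phi>)
  have "eval M (e(v := a)) \<phi> = eval M (e'(v := a)) \<phi>" for a
    using FEx.prems by (intro FEx.IH) auto
  then show ?case by simp
next
  case (FNot \<phi>)
  show ?case using FNot.IH[of e e'] FNot.prems by simp
qed auto

text \<open>No axiom is assumed at this level: closure of the domain under the functions suffices to
  evaluate formulas.\<close>

locale set_structure =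
  fixes \<tau> :: "('f, 'r) ssig" and M :: "('f fsym, 'r rsym, 'u) model"
  assumes extends_D0: "extends \<tau> sig_D0" and is_structure: "is_structure \<tau> M"
begin

abbreviation D :: "'u set" where "D \<equiv> Dom M"

definition default :: 'u where "default = (SOME d. d \<in> D)"

lemma default_D [simp]: "default \<in> D"
  using is_structure unfolding is_structure_def default_def by (auto intro: someI)

lemma FnI_D: "f \<in> funs \<tau> \<Longrightarrow> length as = farity \<tau> f \<Longrightarrow> set as \<subseteq> D \<Longrightarrow> FnI M f as \<in> D"
  using is_structure unfolding is_structure_def by auto

lemma funs_D0 [simp]: "F_Empty \<in> funs \<tau>" "F_Omega \<in> funs \<tau>" "F_Goedel g \<in> funs \<tau>"
  and farity_D0: "farity \<tau> F_Empty = 0" "farity \<tau> F_Omega = 0"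
    "farity \<tau> (F_Goedel g) = (if g \<in> {G_Pair, G_Times, G_Eps, G_Diff, G_Int} then 2 else 1)"
  using extends_D0 unfolding extends_def sig_D0_def by auto

lemma rels_Mem [simp]: "R_Mem \<in> rels \<tau>" "rarity \<tau> R_Mem = 2"
  using extends_D0 unfolding extends_def sig_D0_def by auto

text \<open>Variables come in three sorts: those with values in \<open>e\<close>, those for parameters, with
  values in \<open>c\<close>, and those which stay available as bound ones.\<close>
definition enc :: "nat + nat + nat \<Rightarrow> nat" where
  "enc x = sum_encode (map_sum id sum_encode x)"

definition dec :: "nat \<Rightarrow> nat + nat + nat" where
  "dec n = map_sum id sum_decode (sum_decode n)"

lemma dec_enc [simp]: "dec (enc x) = x"
  by (cases x) (simp_all add: enc_def dec_def)

lemma enc_dec [simp]: "enc (dec n) = n"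
proof (cases "sum_decode n")
  case (Inl i)
  then show ?thesis by (simp add: enc_def dec_def) (metis sum_decode_inverse)
next
  case (Inr i)
  then show ?thesis by (simp add: enc_def dec_def) (metis sum_decode_inverse)
qed

lemma enc_eq [simp]: "enc x = enc y \<longleftrightarrow> x = y"
  using dec_enc by metis

lemma dec_eq [simp]: "dec x = dec y \<longleftrightarrow> x = y"
  using enc_dec by metis

definition mix :: "(nat \<Rightarrow> 'u) \<Rightarrow> (nat \<Rightarrow> 'u) \<Rightarrow> nat \<Rightarrow> 'u" where
  "mix e c n = case_sum e (case_sum c (\<lambda>_. default)) (dec n)"

text \<open>Replacement is a scheme over formulas, whereas the set theory below is done with HOL
  predicates. Definability with parameters links the two: its introduction rules follow the shape of
  a predicate, so that no instance of the scheme has to be written out as a formula. The sequence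
  \<open>c\<close> holds the parameters.\<close>

definition definable :: "((nat \<Rightarrow> 'u) \<Rightarrow> bool) \<Rightarrow> bool" where
  "definable P \<longleftrightarrow> (\<exists>\<phi> c. is_fm \<tau> \<phi> \<and> range c \<subseteq> D \<and>
     (\<forall>e. range e \<subseteq> D \<longrightarrow> P e = eval M (mix e c) \<phi>))"

definition definable_tm :: "((nat \<Rightarrow> 'u) \<Rightarrow> 'u) \<Rightarrow> bool" where
  "definable_tm t \<longleftrightarrow> (\<exists>s c. is_tm \<tau> s \<and> range c \<subseteq> D \<and>
     (\<forall>e. range e \<subseteq> D \<longrightarrow> t e = teval M (mix e c) s))"

definition interleave :: "(nat \<Rightarrow> 'u) \<Rightarrow> (nat \<Rightarrow> 'u) \<Rightarrow> nat \<Rightarrow> 'u" where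
  "interleave c d n = case_sum c d (sum_decode n)"

lemma range_interleave: "range c \<subseteq> D \<Longrightarrow> range d \<subseteq> D \<Longrightarrow> range (interleave c d) \<subseteq> D"
  unfolding interleave_def by (auto simp: image_subset_iff split: sum.split)

text \<open>Two formulas with parameters of their own are combined by interleaving the parameters.
  The renaming moves only parameter variables, to the places of \<open>interleave\<close> that
  belong to the left or to the right sequence; the other two sorts stay fixed.\<close>

definition spread :: "(nat \<Rightarrow> nat + nat) \<Rightarrow> nat \<Rightarrow> nat" where
  "spread w n = enc (map_sum id (map_sum (sum_encode \<circ> w) id) (dec n))"

lemma inj_spread: "inj w \<Longrightarrow> inj (spread w)"
proof (rule injI)
  fix m n assume w: "inj w" and "spread w m = spread w n"
  then have "map_sum id (map_sum (sum_encode \<circ> w) id) (dec m) = map_sum id (map_sum (sum_encode \<circ> w) id) (dec n)"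
    by (simp add: spread_def)
  moreover have "inj (map_sum id (map_sum (sum_encode \<circ> w) id))"
    by (intro sum.inj_map inj_compose inj_sum_encode w inj_on_id)
  ultimately have "dec m = dec n" by (rule injD[rotated])
  then show "m = n" by simp
qed

lemma mix_spread:
  "mix e (interleave c d) \<circ> spread Inl = mix e c"
  "mix e (interleave c d) \<circ> spread Inr = mix e d"
  by (auto simp: fun_eq_iff mix_def spread_def interleave_def split: sum.split)

lemma teval_spread:
  "teval M (mix e (interleave c d)) (rename_tm (spread Inl) s) = teval M (mix e c) s"
  "teval M (mix e (interleave c d)) (rename_tm (spread Inr) s) = teval M (mix e d) s"
  by (simp_all only: teval_rename mix_spread)

lemma eval_spread:
  "eval M (mix e (interleave c d)) (rename (spread Inl) \<phi>) = eval M (mix e c) \<phi>"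
  "eval M (mix e (interleave c d)) (rename (spread Inr) \<phi>) = eval M (mix e d) \<phi>"
  by (simp_all only: eval_rename[OF inj_spread[OF inj_Inl]] eval_rename[OF inj_spread[OF inj_Inr]] mix_spread)

definition cons_env :: "'u \<Rightarrow> (nat \<Rightarrow> 'u) \<Rightarrow> nat \<Rightarrow> 'u" where
  "cons_env a e n = (case n of 0 \<Rightarrow> a | Suc m \<Rightarrow> e m)"

lemma cons_env_simps [simp]: "cons_env a e 0 = a" "cons_env a e (Suc n) = e n"
  by (simp_all add: cons_env_def)

lemma range_cons_env: "a \<in> D \<Longrightarrow> range e \<subseteq> D \<Longrightarrow> range (cons_env a e) \<subseteq> D"
  unfolding cons_env_def by (auto simp: image_subset_iff split: nat.splits)

text \<open>Environments are read in de Bruijn style: under a quantifier position 0 holds the new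
  value and the old ones move up by one. Here variable 0 becomes the bound variable
  \<open>Inr (Inr 0)\<close>, the others move down, and bound variables already in use are pushed up
  so that the map remains injective.\<close>

definition unshift :: "nat \<Rightarrow> nat" where
  "unshift n = enc (case dec n of
     Inl i \<Rightarrow> (case i of 0 \<Rightarrow> Inr (Inr 0) | Suc k \<Rightarrow> Inl k)
   | Inr (Inl i) \<Rightarrow> Inr (Inl i)
   | Inr (Inr i) \<Rightarrow> Inr (Inr (Suc i)))"

lemma inj_unshift: "inj unshift"
proof (rule injI)
  fix m n assume "unshift m = unshift n"
  then show "m = n" unfolding dec_eq[symmetric]
    by (auto simp del: dec_eq simp: unshift_def split: sum.splits nat.splits)
qed

lemma mix_unshift: "(mix e c)(enc (Inr (Inr 0)) := a) \<circ> unshift = mix (cons_env a e) c"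
  by (auto simp: fun_eq_iff mix_def unshift_def cons_env_def
      split: sum.splits nat.splits)

definition shift_var :: "nat \<Rightarrow> nat" where
  "shift_var n = enc (map_sum Suc id (dec n))"

lemma mix_shift_var: "mix e c \<circ> shift_var = mix (\<lambda>i. e (Suc i)) c"
  by (auto simp: fun_eq_iff mix_def shift_var_def split: sum.splits)

lemma definable_tm_var: "definable_tm (\<lambda>e. e i)"
  unfolding definable_tm_def
  by (rule exI[of _ "Var (enc (Inl i))"], rule exI[of _ "\<lambda>_. default"]) (auto simp: mix_def)

lemma definable_tm_const: "a \<in> D \<Longrightarrow> definable_tm (\<lambda>e. a)"
  unfolding definable_tm_def
  by (rule exI[of _ "Var (enc (Inr (Inl 0)))"], rule exI[of _ "\<lambda>_. a"]) (auto simp: mix_def)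

lemma definable_tm_Fn1:
  assumes "f \<in> funs \<tau>" "farity \<tau> f = 1" "definable_tm s"
  shows "definable_tm (\<lambda>e. FnI M f [s e])"
proof -
  from assms(3) obtain s' c where "is_tm \<tau> s'" "range c \<subseteq> D"
    "\<forall>e. range e \<subseteq> D \<longrightarrow> s e = teval M (mix e c) s'"
    unfolding definable_tm_def by blast
  then show ?thesis unfolding definable_tm_def
    by (intro exI[of _ "Fn f [s']"] exI[of _ c]) (use assms in auto)
qed

lemma definable_tm_Fn2:
  assumes "f \<in> funs \<tau>" "farity \<tau> f = 2" "definable_tm s" "definable_tm t"
  shows "definable_tm (\<lambda>e. FnI M f [s e, t e])"
proof -
  from assms(3) obtain s' c where s: "is_tm \<tau> s'" "range c \<subseteq> D"
    "\<forall>e. range e \<subseteq> D \<longrightarrow> s e = teval M (mix e c) s'"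
    unfolding definable_tm_def by blast
  from assms(4) obtain t' d where t: "is_tm \<tau> t'" "range d \<subseteq> D"
    "\<forall>e. range e \<subseteq> D \<longrightarrow> t e = teval M (mix e d) t'"
    unfolding definable_tm_def by blast
  show ?thesis unfolding definable_tm_def
    by (intro exI[of _ "Fn f [rename_tm (spread Inl) s', rename_tm (spread Inr) t']"]
        exI[of _ "interleave c d"])
      (use assms s t range_interleave in \<open>simp add: teval_spread\<close>)
qed

lemma definable_Rel2:
  assumes "R \<in> rels \<tau>" "rarity \<tau> R = 2" "definable_tm s" "definable_tm t"
  shows "definable (\<lambda>e. RelI M R [s e, t e])"
proof -
  from assms(3) obtain s' c where s: "is_tm \<tau> s'" "range c \<subseteq> D"
    "\<forall>e. range e \<subseteq> D \<longrightarrow> s e = teval M (mix e c) s'"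
    unfolding definable_tm_def by blast
  from assms(4) obtain t' d where t: "is_tm \<tau> t'" "range d \<subseteq> D"
    "\<forall>e. range e \<subseteq> D \<longrightarrow> t e = teval M (mix e d) t'"
    unfolding definable_tm_def by blast
  show ?thesis unfolding definable_def
    by (intro exI[of _ "Rel R [rename_tm (spread Inl) s', rename_tm (spread Inr) t']"]
        exI[of _ "interleave c d"])
      (use assms s t range_interleave in \<open>simp add: teval_spread\<close>)
qed

lemma definable_eq:
  assumes "definable_tm s" "definable_tm t"
  shows "definable (\<lambda>e. s e = t e)"
proof -
  from assms(1) obtain s' c where s: "is_tm \<tau> s'" "range c \<subseteq> D"
    "\<forall>e. range e \<subseteq> D \<longrightarrow> s e = teval M (mix e c) s'"
    unfolding definable_tm_def by blast
  from assms(2) obtain t' d where t: "is_tm \<tau> t'" "range d \<subseteq> D"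
    "\<forall>e. range e \<subseteq> D \<longrightarrow> t e = teval M (mix e d) t'"
    unfolding definable_tm_def by blast
  show ?thesis unfolding definable_def
    by (intro exI[of _ "rename_tm (spread Inl) s' \<^bold>= rename_tm (spread Inr) t'"]
        exI[of _ "interleave c d"])
      (use assms s t range_interleave in \<open>simp add: teval_spread\<close>)
qed

lemma definable_not: "definable P \<Longrightarrow> definable (\<lambda>e. \<not> P e)"
proof -
  assume "definable P"
  then obtain \<phi> c where "is_fm \<tau> \<phi>" "range c \<subseteq> D"
    "\<forall>e. range e \<subseteq> D \<longrightarrow> P e = eval M (mix e c) \<phi>"
    unfolding definable_def by blast
  then show ?thesis unfolding definable_def
    by (intro exI[of _ "\<^bold>\<not> \<phi>"] exI[of _ c]) simp
qed

lemma definable_conj: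
  assumes "definable P" "definable Q"
  shows "definable (\<lambda>e. P e \<and> Q e)"
proof -
  from assms(1) obtain \<phi> c where s: "is_fm \<tau> \<phi>" "range c \<subseteq> D"
    "\<forall>e. range e \<subseteq> D \<longrightarrow> P e = eval M (mix e c) \<phi>"
    unfolding definable_def by blast
  from assms(2) obtain \<psi> d where t: "is_fm \<tau> \<psi>" "range d \<subseteq> D"
    "\<forall>e. range e \<subseteq> D \<longrightarrow> Q e = eval M (mix e d) \<psi>"
    unfolding definable_def by blast
  show ?thesis unfolding definable_def
    by (intro exI[of _ "rename (spread Inl) \<phi> \<^bold>\<and> rename (spread Inr) \<psi>"]
        exI[of _ "interleave c d"])
      (use assms s t range_interleave in \<open>simp add: eval_spread\<close>)
qed

lemma definable_ex:
  assumes "definable (\<lambda>e. P (\<lambda>i. e (Suc i)) (e 0))"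
  shows "definable (\<lambda>e. \<exists>a\<in>D. P e a)"
proof -
  from assms obtain \<phi> c where s: "is_fm \<tau> \<phi>" "range c \<subseteq> D"
    "\<And>e. range e \<subseteq> D \<Longrightarrow> P (\<lambda>i. e (Suc i)) (e 0) = eval M (mix e c) \<phi>"
    unfolding definable_def by blast
  have "(\<exists>a\<in>D. P e a) = eval M (mix e c) (FEx (enc (Inr (Inr 0))) (rename unshift \<phi>))" if e: "range e \<subseteq> D" for e
  proof -
    have "P e a = eval M ((mix e c)(enc (Inr (Inr 0)) := a)) (rename unshift \<phi>)" if "a \<in> D" for a
      using s(3)[OF range_cons_env[OF that e]] by (simp add: eval_rename inj_unshift mix_unshift)
    then show ?thesis by simp
  qed
  then show ?thesis unfolding definable_def
    by (intro exI[of _ "FEx (enc (Inr (Inr 0))) (rename unshift \<phi>)"] exI[of _ c]) (use s in simp)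
qed

text \<open>Weakening for a term that passes below a quantifier, where position 0 is taken by the
  bound value.\<close>

lemma definable_tm_shift:
  assumes "definable_tm t"
  shows "definable_tm (\<lambda>e. t (\<lambda>i. e (Suc i)))"
proof -
  from assms obtain s c where s: "is_tm \<tau> s" "range c \<subseteq> D"
    "\<And>e. range e \<subseteq> D \<Longrightarrow> t e = teval M (mix e c) s"
    unfolding definable_tm_def by blast
  have "t (\<lambda>i. e (Suc i)) = teval M (mix e c) (rename_tm shift_var s)" if e: "range e \<subseteq> D" for e
    using s(3)[of "\<lambda>i. e (Suc i)"] that by (auto simp: teval_rename mix_shift_var)
  then show ?thesis unfolding definable_tm_def
    by (intro exI[of _ "rename_tm shift_var s"] exI[of _ c]) (use s in simp)
qed

lemma definable_cong:
  assumes "definable Q" "\<And>e. range e \<subseteq> D \<Longrightarrow> P e = Q e"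
  shows "definable P"
  using assms unfolding definable_def by simp

lemma definable_disj:
  assumes "definable P" "definable Q"
  shows "definable (\<lambda>e. P e \<or> Q e)"
  by (rule definable_cong[OF definable_not[OF definable_conj[OF
    definable_not[OF assms(1)] definable_not[OF assms(2)]]]]) blast

lemma definable_imp:
  assumes "definable P" "definable Q"
  shows "definable (\<lambda>e. P e \<longrightarrow> Q e)"
  by (rule definable_cong[OF definable_disj[OF definable_not[OF assms(1)] assms(2)]]) blast

lemma definable_iff:
  assumes "definable P" "definable Q"
  shows "definable (\<lambda>e. P e \<longleftrightarrow> Q e)"
  by (rule definable_cong[OF definable_conj[OF definable_imp[OF assms] definable_imp[OF assms(2,1)]]])
    blast

lemma definable_all:
  assumes "definable (\<lambda>e. P (\<lambda>i. e (Suc i)) (e 0))"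
  shows "definable (\<lambda>e. \<forall>a\<in>D. P e a)"
  by (rule definable_cong[OF definable_not[OF definable_ex[of "\<lambda>e a. \<not> P e a",
    OF definable_not[OF assms]]]]) blast

text \<open>The external extension of a point, which turns statements inside the model into
  statements about HOL sets. Since \<open>RelI\<close> is arbitrary outside the domain, both sides
  of the membership are confined to it.\<close>

definition el :: "'u \<Rightarrow> 'u set" where
  "el x = {z \<in> D. x \<in> D \<and> RelI M R_Mem [z, x]}"

lemma el_D: "z \<in> el x \<Longrightarrow> z \<in> D" and el_owner_D: "z \<in> el x \<Longrightarrow> x \<in> D"
  by (simp_all add: el_def)

declare el_D [dest]

lemma definable_tm_D: "definable_tm t \<Longrightarrow> range e \<subseteq> D \<Longrightarrow> t e \<in> D"
proof -
  assume "definable_tm t" and e: "range e \<subseteq> D"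
  then obtain s c where s: "is_tm \<tau> s" "range c \<subseteq> D" "t e = teval M (mix e c) s"
    unfolding definable_tm_def by blast
  have "range (mix e c) \<subseteq> D" using e s(2) by (auto simp: mix_def image_subset_iff split: sum.split)
  with s(1) have "teval M (mix e c) s \<in> D"
  proof (induction s)
    case (Fn f ts)
    then show ?case by (auto intro!: FnI_D)
  qed auto
  with s(3) show ?thesis by simp
qed

lemma definable_mem:
  assumes "definable_tm s" "definable_tm t"
  shows "definable (\<lambda>e. s e \<in> el (t e))"
  by (rule definable_cong[OF definable_Rel2[of R_Mem, OF _ _ assms]])
    (simp_all add: el_def assms definable_tm_D)

lemma definable_bex:
  assumes "definable_tm t" "definable (\<lambda>e. P (\<lambda>i. e (Suc i)) (e 0))"
  shows "definable (\<lambda>e. \<exists>a\<in>el (t e). P e a)"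
proof -
  have "definable (\<lambda>e. \<exists>a\<in>D. a \<in> el (t e) \<and> P e a)"
    by (intro definable_ex definable_conj definable_mem assms definable_tm_var definable_tm_shift)
  then show ?thesis by (rule definable_cong) auto
qed

lemma definable_ball:
  assumes "definable_tm t" "definable (\<lambda>e. P (\<lambda>i. e (Suc i)) (e 0))"
  shows "definable (\<lambda>e. \<forall>a\<in>el (t e). P e a)"
  by (rule definable_cong[OF definable_not[OF definable_bex[of t "\<lambda>e a. \<not> P e a",
    OF assms(1) definable_not[OF assms(2)]]]]) blast

lemma definable_subset:
  assumes "definable_tm s" "definable_tm t"
  shows "definable (\<lambda>e. el (s e) \<subseteq> el (t e))"
  unfolding subset_eq
  by (intro definable_ball definable_mem assms definable_tm_var definable_tm_shift)

lemmas definable_basic_intros =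
  definable_tm_var definable_tm_const definable_mem definable_eq definable_subset definable_not
  definable_conj definable_disj definable_imp definable_iff definable_ex definable_all
  definable_bex definable_ball

end

section \<open>Evaluation of formulas with automatically chosen bound variables\<close>

lemma finite_tvars: "finite (tvars t)"
  by (induction t) auto

lemma fresh_not_tvars: "t \<in> set ts \<Longrightarrow> v \<in> tvars t \<Longrightarrow> v \<noteq> fresh ts"
proof -
  assume "t \<in> set ts" "v \<in> tvars t"
  then have "v \<in> insert 0 (\<Union>t\<in>set ts. tvars t)" by auto
  then have "v \<le> Max (insert 0 (\<Union>t\<in>set ts. tvars t))"
    by (intro Max_ge) (auto intro: finite_tvars)
  then show ?thesis by (simp add: fresh_def)
qed

lemma teval_fresh: "t \<in> set ts \<Longrightarrow> teval M (e(fresh ts := a)) t = teval M e t"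
  using fresh_not_tvars by (intro teval_cong) fastforce

lemma teval_fresh_Var: "teval M (e(fresh ts := a)) (Var (fresh ts)) = a"
  by simp

lemma eval_Forall:
  "eval M e (Forall ts B) \<longleftrightarrow> (\<forall>a\<in>Dom M. eval M (e(fresh ts := a)) (B (Var (fresh ts))))"
  by (simp add: Forall_def)

lemma eval_Exists:
  "eval M e (Exists ts B) \<longleftrightarrow> (\<exists>a\<in>Dom M. eval M (e(fresh ts := a)) (B (Var (fresh ts))))"
  by (simp add: Exists_def)

text \<open>Iterated updates are replaced by one environment that agrees with \<open>e\<close> off
  the quantified variables, so that order and repetition of variables cease to matter.\<close>

lemma eval_FAlls:
  "range e \<subseteq> Dom M \<Longrightarrow> eval M e (FAlls vs \<phi>) \<longleftrightarrow>
     (\<forall>e'. range e' \<subseteq> Dom M \<and> (\<forall>v. v \<notin> set vs \<longrightarrow> e' v = e v) \<longrightarrow> eval M e' \<phi>)"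
proof (induction vs arbitrary: e)
  case Nil
  then show ?case by (auto simp: FAlls_def dest: ext)
next
  case (Cons v vs)
  have "eval M e (FAlls (v # vs) \<phi>) \<longleftrightarrow> (\<forall>a\<in>Dom M. eval M (e(v := a)) (FAlls vs \<phi>))"
    by (simp add: FAlls_def)
  also have "\<dots> \<longleftrightarrow> (\<forall>a\<in>Dom M. \<forall>e'. range e' \<subseteq> Dom M \<and>
      (\<forall>u. u \<notin> set vs \<longrightarrow> e' u = (e(v := a)) u) \<longrightarrow> eval M e' \<phi>)"
    by (intro ball_cong refl Cons.IH) (use Cons.prems in auto)
  also have "\<dots> \<longleftrightarrow> (\<forall>e'. range e' \<subseteq> Dom M \<and> (\<forall>u. u \<notin> set (v # vs) \<longrightarrow> e' u = e u) \<longrightarrow> eval M e' \<phi>)"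
  proof (intro iffI ballI allI impI)
    fix e' assume H: "\<forall>a\<in>Dom M. \<forall>e'. range e' \<subseteq> Dom M \<and>
      (\<forall>u. u \<notin> set vs \<longrightarrow> e' u = (e(v := a)) u) \<longrightarrow> eval M e' \<phi>"
      and e': "range e' \<subseteq> Dom M \<and> (\<forall>u. u \<notin> set (v # vs) \<longrightarrow> e' u = e u)"
    have "e' v \<in> Dom M" using e' by auto
    moreover have "\<forall>u. u \<notin> set vs \<longrightarrow> e' u = (e(v := e' v)) u" using e' by auto
    ultimately show "eval M e' \<phi>" using H e' by blast
  next
    fix a e' assume H: "\<forall>e'. range e' \<subseteq> Dom M \<and> (\<forall>u. u \<notin> set (v # vs) \<longrightarrow> e' u = e u) \<longrightarrow> eval M e' \<phi>"
      and e': "range e' \<subseteq> Dom M \<and> (\<forall>u. u \<notin> set vs \<longrightarrow> e' u = (e(v := a)) u)"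
    then show "eval M e' \<phi>" by auto
  qed
  finally show ?case .
qed

lemma satisfies_FAlls:
  "satisfies M (FAlls vs \<phi>) \<longleftrightarrow> satisfies M \<phi>"
  unfolding satisfies_def by (auto simp: eval_FAlls)

lemma eval_FExs:
  assumes "range e \<subseteq> Dom M"
  shows "eval M e (FExs vs \<phi>) \<longleftrightarrow>
     (\<exists>e'. range e' \<subseteq> Dom M \<and> (\<forall>v. v \<notin> set vs \<longrightarrow> e' v = e v) \<and> eval M e' \<phi>)"
proof -
  have "eval M e (FExs vs \<phi>) \<longleftrightarrow> \<not> eval M e (FAlls vs (\<^bold>\<not> \<phi>))" for e
    by (induction vs arbitrary: e) (auto simp: FExs_def FAlls_def)
  then show ?thesis using eval_FAlls[OF assms, of vs "\<^bold>\<not> \<phi>"] by auto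
qed

lemma eval_FConj: "eval M e (FConj \<phi>s) \<longleftrightarrow> (\<forall>\<phi>\<in>set \<phi>s. eval M e \<phi>)"
  by (induction \<phi>s) (auto simp: FConj_def)

section \<open>Goedel operations and set-theoretic formulas evaluated in a structure\<close>

context set_structure
begin

definition up :: "'u \<Rightarrow> 'u \<Rightarrow> 'u" where "up x y = FnI M (F_Goedel G_Pair) [x, y]"
definition pr :: "'u \<Rightarrow> 'u \<Rightarrow> 'u" where "pr x y = up (up x x) (up x y)"
definition ti :: "'u \<Rightarrow> 'u \<Rightarrow> 'u" where "ti x y = FnI M (F_Goedel G_Times) [x, y]"
definition ep :: "'u \<Rightarrow> 'u \<Rightarrow> 'u" where "ep x y = FnI M (F_Goedel G_Eps) [x, y]"
definition df :: "'u \<Rightarrow> 'u \<Rightarrow> 'u" where "df x y = FnI M (F_Goedel G_Diff) [x, y]"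
definition it :: "'u \<Rightarrow> 'u \<Rightarrow> 'u" where "it x y = FnI M (F_Goedel G_Int) [x, y]"
definition un :: "'u \<Rightarrow> 'u" where "un x = FnI M (F_Goedel G_Union) [x]"
definition dm :: "'u \<Rightarrow> 'u" where "dm x = FnI M (F_Goedel G_Dom) [x]"
definition cv :: "'u \<Rightarrow> 'u" where "cv x = FnI M (F_Goedel G_Conv) [x]"
definition sw :: "'u \<Rightarrow> 'u" where "sw x = FnI M (F_Goedel G_Swap) [x]"
definition ro :: "'u \<Rightarrow> 'u" where "ro x = FnI M (F_Goedel G_Rot) [x]"
definition em :: "'u" where "em = FnI M F_Empty []"
definition om :: "'u" where "om = FnI M F_Omega []"

lemmas goedel_defs = up_def ti_def ep_def df_def it_def un_def dm_def cv_def sw_def ro_def em_def om_def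

lemma goedel_D [simp]:
  "x \<in> D \<Longrightarrow> y \<in> D \<Longrightarrow> up x y \<in> D" "x \<in> D \<Longrightarrow> y \<in> D \<Longrightarrow> pr x y \<in> D"
  "x \<in> D \<Longrightarrow> y \<in> D \<Longrightarrow> ti x y \<in> D" "x \<in> D \<Longrightarrow> y \<in> D \<Longrightarrow> ep x y \<in> D"
  "x \<in> D \<Longrightarrow> y \<in> D \<Longrightarrow> df x y \<in> D" "x \<in> D \<Longrightarrow> y \<in> D \<Longrightarrow> it x y \<in> D"
  "x \<in> D \<Longrightarrow> un x \<in> D" "x \<in> D \<Longrightarrow> dm x \<in> D" "x \<in> D \<Longrightarrow> cv x \<in> D"
  "x \<in> D \<Longrightarrow> sw x \<in> D" "x \<in> D \<Longrightarrow> ro x \<in> D" "em \<in> D" "om \<in> D"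
  unfolding pr_def goedel_defs by (auto intro!: FnI_D simp: farity_D0)

lemma definable_tm_goedel:
  "definable_tm s \<Longrightarrow> definable_tm t \<Longrightarrow> definable_tm (\<lambda>e. up (s e) (t e))"
  "definable_tm s \<Longrightarrow> definable_tm t \<Longrightarrow> definable_tm (\<lambda>e. pr (s e) (t e))"
  "definable_tm s \<Longrightarrow> definable_tm t \<Longrightarrow> definable_tm (\<lambda>e. ti (s e) (t e))"
  "definable_tm s \<Longrightarrow> definable_tm (\<lambda>e. un (s e))"
  "definable_tm s \<Longrightarrow> definable_tm (\<lambda>e. dm (s e))"
  "definable_tm s \<Longrightarrow> definable_tm (\<lambda>e. cv (s e))"
  unfolding pr_def goedel_defs
  by (intro definable_tm_Fn1 definable_tm_Fn2; (assumption | simp add: farity_D0))+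

lemmas definable_intros = definable_basic_intros definable_tm_goedel

lemma ball_el: "(\<forall>a\<in>D. a \<in> el s \<longrightarrow> P a) = (\<forall>a\<in>el s. P a)"
  and bex_el: "(\<exists>a\<in>D. a \<in> el s \<and> P a) = (\<exists>a\<in>el s. P a)"
  by auto

lemma RelI_Mem: "x \<in> D \<Longrightarrow> y \<in> D \<Longrightarrow> RelI M R_Mem [x, y] \<longleftrightarrow> x \<in> el y"
  by (simp add: el_def)

text \<open>\<open>teval (Var v)\<close> must not be unfolded before the updates of \<open>e\<close> have been
  resolved by freshness.\<close>
lemmas eval_rules =
  eval_Forall eval_Exists teval_fresh teval_fresh_Var RelI_Mem Forall_in_def Exists_in_def
  ball_el bex_el goedel_defs[symmetric] pr_def[symmetric]

lemma eval_Subset: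
  "teval M e s \<in> D \<Longrightarrow> teval M e t \<in> D \<Longrightarrow>
    eval M e (s \<^bold>\<subseteq> t) \<longleftrightarrow> el (teval M e s) \<subseteq> el (teval M e t)"
  by (simp add: Subset_def eval_rules subset_eq del: teval.simps(1) fun_upd_apply)

definition single_valued :: "'u \<Rightarrow> bool" where
  "single_valued f \<longleftrightarrow> (\<forall>x\<in>D. \<forall>y\<in>D. \<forall>z\<in>D. pr x y \<in> el f \<and> pr x z \<in> el f \<longrightarrow> y = z)"

definition func :: "'u \<Rightarrow> bool" where
  "func f \<longleftrightarrow> (\<forall>p\<in>el f. \<exists>x\<in>D. \<exists>y\<in>D. p = pr x y) \<and> single_valued f"

lemma eval_Is_func: "teval M e f \<in> D \<Longrightarrow> eval M e (Is_func f) \<longleftrightarrow> func (teval M e f)"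
  by (simp add: Is_func_def func_def single_valued_def eval_rules del: teval.simps(1) fun_upd_apply; blast)

definition surj_on :: "'u \<Rightarrow> 'u \<Rightarrow> 'u \<Rightarrow> bool" where
  "surj_on f a b \<longleftrightarrow> func f \<and> dm f = a \<and> (\<forall>y\<in>D. y \<in> el b \<longleftrightarrow> (\<exists>x\<in>D. pr x y \<in> el f))"

lemma eval_Is_surj:
  "teval M e f \<in> D \<Longrightarrow> teval M e a \<in> D \<Longrightarrow> teval M e b \<in> D \<Longrightarrow>
    eval M e (Is_surj f a b) \<longleftrightarrow> surj_on (teval M e f) (teval M e a) (teval M e b)"
  by (simp add: Is_surj_def Has_range_def surj_on_def eval_Is_func eval_rules
      del: teval.simps(1) fun_upd_apply; blast)

definition bij :: "'u \<Rightarrow> 'u \<Rightarrow> 'u \<Rightarrow> bool" where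
  "bij f a b \<longleftrightarrow> surj_on f a b \<and>
     (\<forall>x\<in>D. \<forall>y\<in>D. \<forall>z\<in>D. pr x z \<in> el f \<and> pr y z \<in> el f \<longrightarrow> x = y)"

lemma eval_Is_bij:
  "teval M e f \<in> D \<Longrightarrow> teval M e a \<in> D \<Longrightarrow> teval M e b \<in> D \<Longrightarrow>
    eval M e (Is_bij f a b) \<longleftrightarrow> bij (teval M e f) (teval M e a) (teval M e b)"
  by (simp add: Is_bij_def bij_def eval_Is_surj eval_rules del: teval.simps(1) fun_upd_apply; blast)

definition ordinal :: "'u \<Rightarrow> bool" where
  "ordinal s \<longleftrightarrow> (\<forall>x\<in>el s. el x \<subseteq> el s) \<and> (\<forall>x\<in>el s. \<forall>y\<in>el s. x \<in> el y \<or> x = y \<or> y \<in> el x)"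

lemma eval_Is_ord: "teval M e s \<in> D \<Longrightarrow> eval M e (Is_ord s) \<longleftrightarrow> ordinal (teval M e s)"
  by (simp add: Is_ord_def ordinal_def eval_rules eval_Subset del: teval.simps(1) fun_upd_apply; blast)

definition limit_ordinal :: "'u \<Rightarrow> bool" where
  "limit_ordinal s \<longleftrightarrow> ordinal s \<and> s \<noteq> em \<and> (\<forall>x\<in>el s. \<exists>y\<in>el s. x \<in> el y)"

lemma eval_Is_limit_ord:
  "teval M e s \<in> D \<Longrightarrow> eval M e (Is_limit_ord s) \<longleftrightarrow> limit_ordinal (teval M e s)"
  by (simp add: Is_limit_ord_def limit_ordinal_def eval_rules eval_Is_ord del: teval.simps(1) fun_upd_apply)

definition cardinal :: "'u \<Rightarrow> bool" where
  "cardinal s \<longleftrightarrow> ordinal s \<and> (\<forall>b\<in>el s. \<not> (\<exists>f\<in>D. bij f b s))"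

lemma eval_Is_card: "teval M e s \<in> D \<Longrightarrow> eval M e (Is_card s) \<longleftrightarrow> cardinal (teval M e s)"
  by (simp add: Is_card_def cardinal_def eval_rules eval_Is_ord eval_Is_bij
      del: teval.simps(1) fun_upd_apply; blast)

end

section \<open>Elementary set theory in a model\<close>

lemma finite_fv: "finite (fv \<phi>)"
  by (induction \<phi>) (auto intro: finite_tvars)

locale zf_model = set_structure \<tau> M for \<tau> :: "('f, 'r) ssig" and M :: "('f fsym, 'r rsym, 'u) model" +
  assumes ZFm: "\<phi> \<in> ZFm \<tau> \<Longrightarrow> satisfies M \<phi>"
begin

lemma ZFm_eval: "\<phi> \<in> ZFm \<tau> \<Longrightarrow> range e \<subseteq> D \<Longrightarrow> eval M e \<phi>"
  using ZFm unfolding satisfies_def by blast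

lemma Zm_D0_eval: "\<phi> \<in> Zm_D0 \<Longrightarrow> eval M (\<lambda>_. default) \<phi>"
  by (rule ZFm_eval) (auto simp: ZFm_def)

lemma el_eqI: "x \<in> D \<Longrightarrow> y \<in> D \<Longrightarrow> el x = el y \<Longrightarrow> x = y"
  using Zm_D0_eval[of extensionality_ax]
  by (simp add: Zm_D0_def extensionality_ax_def eval_rules set_eq_iff del: teval.simps(1) fun_upd_apply) blast

lemma foundation: "x \<in> D \<Longrightarrow> el x \<noteq> {} \<Longrightarrow> \<exists>y\<in>el x. \<forall>z\<in>el x. z \<notin> el y"
  using Zm_D0_eval[of foundation_ax]
  by (simp add: Zm_D0_def foundation_ax_def eval_rules del: teval.simps(1) fun_upd_apply) blast

lemma goedel_ax_eval: "eval M (\<lambda>_. default) (goedel_ax g)"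
  by (rule Zm_D0_eval) (auto simp: Zm_D0_def T_D0_def)

lemma el_up [simp]:
  assumes "x \<in> D" "y \<in> D"
  shows "el (up x y) = {x, y}"
proof -
  have "\<forall>x\<in>D. \<forall>y\<in>D. \<forall>z\<in>D. z \<in> el (up x y) \<longleftrightarrow> z = x \<or> z = y"
    using goedel_ax_eval[of G_Pair]
    by (simp (no_asm_use) add: eval_rules del: teval.simps(1) fun_upd_apply; blast)
  note * = this[rule_format, OF assms]
  show ?thesis using assms * by auto
qed

lemma el_ti:
  assumes "x \<in> D" "y \<in> D"
  shows "el (ti x y) = {pr u v | u v. u \<in> el x \<and> v \<in> el y}" (is "?L = ?R")
proof -
  have "\<forall>x\<in>D. \<forall>y\<in>D. \<forall>z\<in>D. z \<in> el (ti x y) \<longleftrightarrow> (\<exists>u\<in>el x. \<exists>v\<in>el y. z = pr u v)"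
    using goedel_ax_eval[of G_Times]
    by (simp (no_asm_use) add: eval_rules del: teval.simps(1) fun_upd_apply; blast)
  note * = this[rule_format, OF assms]
  have "?L \<subseteq> D" using assms by auto
  moreover have "?R \<subseteq> D" using assms by (auto simp: el_D)
  moreover have "z \<in> ?L \<longleftrightarrow> z \<in> ?R" if "z \<in> D" for z using *[OF that] by blast
  ultimately show ?thesis by blast
qed

lemma el_ep:
  assumes "x \<in> D" "y \<in> D"
  shows "el (ep x y) = {pr u v | u v. u \<in> el x \<and> v \<in> el y \<and> u \<in> el v}" (is "?L = ?R")
proof -
  have "\<forall>x\<in>D. \<forall>y\<in>D. \<forall>z\<in>D. z \<in> el (ep x y) \<longleftrightarrow> (\<exists>u\<in>el x. \<exists>v\<in>el y. z = pr u v \<and> u \<in> el v)"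
    using goedel_ax_eval[of G_Eps]
    by (simp (no_asm_use) add: eval_rules del: teval.simps(1) fun_upd_apply; blast)
  note * = this[rule_format, OF assms]
  have "?L \<subseteq> D" using assms by auto
  moreover have "?R \<subseteq> D" using assms by (auto simp: el_D)
  moreover have "z \<in> ?L \<longleftrightarrow> z \<in> ?R" if "z \<in> D" for z using *[OF that] by blast
  ultimately show ?thesis by blast
qed

lemma el_df [simp]:
  assumes "x \<in> D" "y \<in> D"
  shows "el (df x y) = el x - el y" (is "?L = ?R")
proof -
  have "\<forall>x\<in>D. \<forall>y\<in>D. \<forall>z\<in>D. z \<in> el (df x y) \<longleftrightarrow> z \<in> el x \<and> z \<notin> el y"
    using goedel_ax_eval[of G_Diff]
    by (simp (no_asm_use) add: eval_rules del: teval.simps(1) fun_upd_apply; blast)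
  note * = this[rule_format, OF assms]
  have "?L \<subseteq> D" using assms by auto
  moreover have "?R \<subseteq> D" using assms by (auto simp: el_D)
  moreover have "z \<in> ?L \<longleftrightarrow> z \<in> ?R" if "z \<in> D" for z using *[OF that] by blast
  ultimately show ?thesis by blast
qed

lemma el_it [simp]:
  assumes "x \<in> D" "y \<in> D"
  shows "el (it x y) = el x \<inter> el y" (is "?L = ?R")
proof -
  have "\<forall>x\<in>D. \<forall>y\<in>D. \<forall>z\<in>D. z \<in> el (it x y) \<longleftrightarrow> z \<in> el x \<and> z \<in> el y"
    using goedel_ax_eval[of G_Int]
    by (simp (no_asm_use) add: eval_rules del: teval.simps(1) fun_upd_apply; blast)
  note * = this[rule_format, OF assms]
  have "?L \<subseteq> D" using assms by auto
  moreover have "?R \<subseteq> D" using assms by (auto simp: el_D)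
  moreover have "z \<in> ?L \<longleftrightarrow> z \<in> ?R" if "z \<in> D" for z using *[OF that] by blast
  ultimately show ?thesis by blast
qed

lemma el_un [simp]:
  assumes "x \<in> D"
  shows "el (un x) = (\<Union>y\<in>el x. el y)" (is "?L = ?R")
proof -
  have "\<forall>x\<in>D. \<forall>z\<in>D. z \<in> el (un x) \<longleftrightarrow> (\<exists>u\<in>el x. z \<in> el u)"
    using goedel_ax_eval[of G_Union]
    by (simp (no_asm_use) add: eval_rules del: teval.simps(1) fun_upd_apply; blast)
  note * = this[rule_format, OF assms]
  have "?L \<subseteq> D" using assms by auto
  moreover have "?R \<subseteq> D" using assms by (auto simp: el_D)
  moreover have "z \<in> ?L \<longleftrightarrow> z \<in> ?R" if "z \<in> D" for z using *[OF that] by blast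
  ultimately show ?thesis by blast
qed

lemma el_dm:
  assumes "x \<in> D"
  shows "el (dm x) = {z \<in> D. \<exists>u\<in>D. pr z u \<in> el x}" (is "?L = ?R")
proof -
  have "\<forall>x\<in>D. \<forall>z\<in>D. z \<in> el (dm x) \<longleftrightarrow> (\<exists>u\<in>D. pr z u \<in> el x)"
    using goedel_ax_eval[of G_Dom]
    by (simp (no_asm_use) add: eval_rules del: teval.simps(1) fun_upd_apply; blast)
  note * = this[rule_format, OF assms]
  have "?L \<subseteq> D" using assms by auto
  moreover have "?R \<subseteq> D" using assms by (auto simp: el_D)
  moreover have "z \<in> ?L \<longleftrightarrow> z \<in> ?R" if "z \<in> D" for z using *[OF that] by blast
  ultimately show ?thesis by blast
qed

lemma el_cv:
  assumes "x \<in> D"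
  shows "el (cv x) = {pr u v | u v. u \<in> D \<and> v \<in> D \<and> pr v u \<in> el x}" (is "?L = ?R")
proof -
  have "\<forall>x\<in>D. \<forall>z\<in>D. z \<in> el (cv x) \<longleftrightarrow> (\<exists>u\<in>D. \<exists>v\<in>D. z = pr u v \<and> pr v u \<in> el x)"
    using goedel_ax_eval[of G_Conv]
    by (simp (no_asm_use) add: eval_rules del: teval.simps(1) fun_upd_apply; blast)
  note * = this[rule_format, OF assms]
  have "?L \<subseteq> D" using assms by auto
  moreover have "?R \<subseteq> D" using assms by (auto simp: el_D)
  moreover have "z \<in> ?L \<longleftrightarrow> z \<in> ?R" if "z \<in> D" for z using *[OF that] by blast
  ultimately show ?thesis by blast
qed

lemma el_sw:
  assumes "x \<in> D"
  shows "el (sw x) = {pr (pr u v) w | u v w. u \<in> D \<and> v \<in> D \<and> w \<in> D \<and> pr (pr u w) v \<in> el x}" (is "?L = ?R")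
proof -
  have "\<forall>x\<in>D. \<forall>z\<in>D. z \<in> el (sw x) \<longleftrightarrow> (\<exists>u\<in>D. \<exists>v\<in>D. \<exists>w\<in>D. z = pr (pr u v) w \<and> pr (pr u w) v \<in> el x)"
    using goedel_ax_eval[of G_Swap]
    by (simp (no_asm_use) add: eval_rules del: teval.simps(1) fun_upd_apply; blast)
  note * = this[rule_format, OF assms]
  have "?L \<subseteq> D" using assms by auto
  moreover have "?R \<subseteq> D" using assms by (auto simp: el_D)
  moreover have "z \<in> ?L \<longleftrightarrow> z \<in> ?R" if "z \<in> D" for z using *[OF that] by blast
  ultimately show ?thesis by blast
qed

lemma el_ro:
  assumes "x \<in> D"
  shows "el (ro x) = {pr (pr u v) w | u v w. u \<in> D \<and> v \<in> D \<and> w \<in> D \<and> pr (pr v w) u \<in> el x}" (is "?L = ?R")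
proof -
  have "\<forall>x\<in>D. \<forall>z\<in>D. z \<in> el (ro x) \<longleftrightarrow> (\<exists>u\<in>D. \<exists>v\<in>D. \<exists>w\<in>D. z = pr (pr u v) w \<and> pr (pr v w) u \<in> el x)"
    using goedel_ax_eval[of G_Rot]
    by (simp (no_asm_use) add: eval_rules del: teval.simps(1) fun_upd_apply; blast)
  note * = this[rule_format, OF assms]
  have "?L \<subseteq> D" using assms by auto
  moreover have "?R \<subseteq> D" using assms by (auto simp: el_D)
  moreover have "z \<in> ?L \<longleftrightarrow> z \<in> ?R" if "z \<in> D" for z using *[OF that] by blast
  ultimately show ?thesis by blast
qed

lemma el_em [simp]: "el em = {}"
  using Zm_D0_eval[of "Forall [] (\<lambda>x. \<^bold>\<not> x \<^bold>\<in> Empty)"]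
  by (simp add: Zm_D0_def T_D0_def eval_rules del: teval.simps(1) fun_upd_apply) (blast dest: el_D)

lemma omega_limit: "limit_ordinal om" and omega_least: "n \<in> el om \<Longrightarrow> \<not> limit_ordinal n"
  using Zm_D0_eval[of "Is_limit_ord Omega \<^bold>\<and> Forall_in [] Omega (\<lambda>x. \<^bold>\<not> Is_limit_ord x)"]
  by (simp_all add: Zm_D0_def T_D0_def eval_rules eval_Is_limit_ord del: teval.simps(1) fun_upd_apply)

lemma pr_inject [simp]:
  assumes "a \<in> D" "b \<in> D" "c \<in> D" "d \<in> D"
  shows "pr a b = pr c d \<longleftrightarrow> a = c \<and> b = d"
proof
  assume "pr a b = pr c d"
  then have "{up a a, up a b} = {up c c, up c d}"
    unfolding pr_def using assms by (metis el_up goedel_D(1))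
  then have "{el (up a a), el (up a b)} = {el (up c c), el (up c d)}"
    by (auto simp: doubleton_eq_iff simp del: el_up)
  then have "{{a, a}, {a, b}} = {{c, c}, {c, d}}"
    using assms by simp
  then show "a = c \<and> b = d" by (auto simp: doubleton_eq_iff)
qed simp

lemma pr_mem [simp]:
  assumes "a \<in> D" "b \<in> D" "x \<in> D" "y \<in> D"
  shows "pr a b \<in> el (ti x y) \<longleftrightarrow> a \<in> el x \<and> b \<in> el y"
    and "pr a b \<in> el (ep x y) \<longleftrightarrow> a \<in> el x \<and> b \<in> el y \<and> a \<in> el b"
    and "pr a b \<in> el (cv x) \<longleftrightarrow> pr b a \<in> el x"
  using assms by (auto simp: el_ti el_ep el_cv el_D)

lemma pr3_mem [simp]:
  assumes "a \<in> D" "b \<in> D" "c \<in> D" "x \<in> D"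
  shows "pr (pr a b) c \<in> el (sw x) \<longleftrightarrow> pr (pr a c) b \<in> el x"
    and "pr (pr a b) c \<in> el (ro x) \<longleftrightarrow> pr (pr b c) a \<in> el x"
  using assms by (auto simp: el_sw el_ro)

section \<open>Collection, separation and replacement for definable predicates\<close>

lemma FClose_iff: "satisfies M (FClose \<phi>) \<longleftrightarrow> satisfies M \<phi>"
  by (simp add: FClose_def satisfies_FAlls)

text \<open>The axiom is taken for the formula behind \<open>Q\<close>, with the variables
  \<open>Inl 0\<close> and \<open>Inl 1\<close> in the roles of argument and value and the
  parameters left free. Being universally closed, it holds in the environment \<open>E\<close> that
  carries these parameters.\<close>

lemma collection:
  assumes X: "X \<in> D" and Q: "definable (\<lambda>e. Q (e 0) (e (Suc 0)))"
    and total: "\<And>x. x \<in> D \<Longrightarrow> \<exists>y\<in>D. Q x y"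
  shows "\<exists>F\<in>D. func F \<and> dm F = X \<and> (\<forall>x\<in>el X. \<exists>y\<in>D. pr x y \<in> el F \<and> Q x y)"
proof -
  obtain \<phi> c where \<phi>: "is_fm \<tau> \<phi>" "range c \<subseteq> D"
    "\<And>e. range e \<subseteq> D \<Longrightarrow> Q (e 0) (e (Suc 0)) = eval M (mix e c) \<phi>"
    using Q unfolding definable_def by blast
  define x where "x = enc (Inl 0)"
  define y where "y = enc (Inl 1)"
  define E where "E = mix (\<lambda>_. default) c"
  have xy: "x \<noteq> y" by (simp add: x_def y_def)
  have E: "range E \<subseteq> D" using \<phi>(2) by (auto simp: E_def mix_def image_subset_iff split: sum.split)
  have Exy: "eval M (E(x := a, y := b)) \<phi> \<longleftrightarrow> Q a b" if "a \<in> D" "b \<in> D" for a b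
  proof -
    have "(E(x := a, y := b)) (enc s) = mix (cons_env a (cons_env b (\<lambda>_. default))) c (enc s)" for s
      by (auto simp: E_def x_def y_def mix_def cons_env_def split: sum.splits nat.splits)
    then have "E(x := a, y := b) = mix (cons_env a (cons_env b (\<lambda>_. default))) c"
      by (metis enc_dec ext)
    then show ?thesis
      using \<phi>(3)[OF range_cons_env[OF that(1) range_cons_env[OF that(2), of "\<lambda>_. default"]]] by simp
  qed
  \<comment> \<open>The variable which \<open>replacement_ax\<close> chooses for the domain;
    \<open>k\<close> and \<open>Suc k\<close> lie above all free variables of \<phi>, so assigning
    \<open>X\<close> and \<open>F\<close> to them does not affect its truth.\<close>
  define k where "k = Suc (Max (fv \<phi> \<union> {x, y}))"
  have "v \<le> Max (fv \<phi> \<union> {x, y})" if "v \<in> fv \<phi> \<union> {x, y}" for v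
    using that by (intro Max_ge) (auto simp: finite_fv)
  then have k: "v < k" if "v \<in> fv \<phi> \<union> {x, y}" for v
    using that by (simp add: k_def less_Suc_eq_le)
  have ne: "x \<noteq> k" "y \<noteq> k" "x \<noteq> Suc k" "y \<noteq> Suc k" using k[of x] k[of y] by auto
  let ?ax = "FAll x (FEx y \<phi>) \<^bold>\<longrightarrow>
        FAll k (FEx (Suc k) (Is_func (Var (Suc k)) \<^bold>\<and> Dom_of (Var (Suc k)) \<^bold>= Var k \<^bold>\<and>
          FAll x (Var x \<^bold>\<in> Var k \<^bold>\<longrightarrow> FEx y (OPair (Var x) (Var y) \<^bold>\<in> Var (Suc k) \<^bold>\<and> \<phi>))))"
  have "satisfies M (replacement_ax \<phi> x y)"
    using \<phi>(1) xy by (intro ZFm) (auto simp: ZFm_def)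
  then have "satisfies M ?ax"
    unfolding replacement_ax_def Let_def k_def[symmetric] FClose_iff by simp
  then have "eval M E ?ax" using E unfolding satisfies_def by blast
  moreover have "eval M E (FAll x (FEx y \<phi>))"
    using total Exy by simp
  ultimately obtain F where F: "F \<in> D"
    "eval M (E(k := X, Suc k := F)) (Is_func (Var (Suc k)) \<^bold>\<and> Dom_of (Var (Suc k)) \<^bold>= Var k \<^bold>\<and>
          FAll x (Var x \<^bold>\<in> Var k \<^bold>\<longrightarrow> FEx y (OPair (Var x) (Var y) \<^bold>\<in> Var (Suc k) \<^bold>\<and> \<phi>)))"
    using X by fastforce
  have cong: "eval M (E(k := X, Suc k := F, x := a, y := b)) \<phi> \<longleftrightarrow> Q a b" if "a \<in> D" "b \<in> D" for a b
  proof -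
    have "eval M (E(k := X, Suc k := F, x := a, y := b)) \<phi> = eval M (E(x := a, y := b)) \<phi>"
      using k by (intro eval_cong) fastforce
    then show ?thesis using Exy[OF that] by simp
  qed
  from F X have "func F \<and> dm F = X \<and> (\<forall>x\<in>el X. \<exists>y\<in>D. pr x y \<in> el F \<and> Q x y)"
    by (simp add: eval_Is_func ne ne[symmetric] xy xy[symmetric] RelI_Mem goedel_defs[symmetric]
        pr_def[symmetric] cong) blast
  with F(1) show ?thesis by blast
qed

text \<open>The scheme starts from a relation that is total on the universe; outside
  \<open>X\<close> the implication accepts every value.\<close>

lemma collection':
  assumes X: "X \<in> D" and Q: "definable (\<lambda>e. Q (e 0) (e (Suc 0)))"
    and total: "\<And>x. x \<in> el X \<Longrightarrow> \<exists>y\<in>D. Q x y"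
  shows "\<exists>F\<in>D. func F \<and> dm F = X \<and> (\<forall>x\<in>el X. \<exists>y\<in>D. pr x y \<in> el F \<and> Q x y)"
proof -
  have "\<exists>F\<in>D. func F \<and> dm F = X \<and> (\<forall>x\<in>el X. \<exists>y\<in>D. pr x y \<in> el F \<and> (x \<in> el X \<longrightarrow> Q x y))"
    by (rule collection) (use X total in \<open>auto intro!: definable_intros Q intro: default_D\<close>)
  then show ?thesis by blast
qed

text \<open>The map that sends x to itself if \<open>P x\<close>, and to a fixed \<open>a\<close>
  with \<open>P a\<close> otherwise, is total on \<open>X\<close> and has the wanted subset as its
  range. If there is no such \<open>a\<close> in \<open>X\<close>, the subset is empty.\<close>

lemma separation:
  assumes X: "X \<in> D" and P: "definable (\<lambda>e. P (e 0))"
  shows "\<exists>Y\<in>D. el Y = {z \<in> el X. P z}"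
proof (cases "\<exists>a\<in>el X. P a")
  case False
  then show ?thesis by (intro bexI[of _ em]) auto
next
  case True
  then obtain a where a: "a \<in> el X" "P a" by blast
  have "\<exists>F\<in>D. func F \<and> dm F = X \<and>
      (\<forall>x\<in>el X. \<exists>y\<in>D. pr x y \<in> el F \<and> (P x \<and> y = x \<or> \<not> P x \<and> y = a))"
  proof (rule collection')
    show "\<exists>y\<in>D. P x \<and> y = x \<or> \<not> P x \<and> y = a" if "x \<in> el X" for x
      using that a by (cases "P x") auto
  qed (use X a in \<open>auto intro!: definable_intros P\<close>)
  then obtain F where F: "F \<in> D" "func F" "dm F = X"
    "\<forall>x\<in>el X. \<exists>y\<in>D. pr x y \<in> el F \<and> (P x \<and> y = x \<or> \<not> P x \<and> y = a)" by blast
  have "el (dm (cv F)) = {z \<in> el X. P z}"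
  proof (intro equalityI subsetI)
    fix z assume "z \<in> el (dm (cv F))"
    then obtain x where x: "x \<in> D" "z \<in> D" "pr x z \<in> el F" using F(1) by (auto simp: el_dm)
    then have "x \<in> el X" using F(1,3) by (auto simp: el_dm)
    then obtain y where y: "y \<in> D" "pr x y \<in> el F" "P x \<and> y = x \<or> \<not> P x \<and> y = a" using F(4) by blast
    moreover have "y = z" using F(2) x y(1,2) unfolding func_def single_valued_def by blast
    ultimately show "z \<in> {z \<in> el X. P z}" using \<open>x \<in> el X\<close> a by auto
  next
    fix z assume z: "z \<in> {z \<in> el X. P z}"
    then have "pr z z \<in> el F" using F(4) by blast
    then show "z \<in> el (dm (cv F))" using z F(1) by (auto simp: el_dm intro!: bexI[of _ z])
  qed
  then show ?thesis using F(1) by (intro bexI[of _ "dm (cv F)"]) auto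
qed

text \<open>Collection picks one value for each x; as there is only one, the range
  \<open>dm (cv F)\<close> is the whole image.\<close>

lemma replacement:
  assumes X: "X \<in> D" and Q: "definable (\<lambda>e. Q (e 0) (e (Suc 0)))"
    and total: "\<And>x. x \<in> el X \<Longrightarrow> \<exists>y\<in>D. Q x y"
    and unique: "\<And>x y z. x \<in> el X \<Longrightarrow> y \<in> D \<Longrightarrow> z \<in> D \<Longrightarrow> Q x y \<Longrightarrow> Q x z \<Longrightarrow> y = z"
  shows "\<exists>Y\<in>D. el Y = {y \<in> D. \<exists>x\<in>el X. Q x y}"
proof -
  obtain F where F: "F \<in> D" "func F" "dm F = X" "\<forall>x\<in>el X. \<exists>y\<in>D. pr x y \<in> el F \<and> Q x y"
    using collection'[OF X Q total] by blast
  have "el (dm (cv F)) = {y \<in> D. \<exists>x\<in>el X. Q x y}"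
  proof (intro equalityI subsetI)
    fix z assume "z \<in> el (dm (cv F))"
    then obtain x where x: "x \<in> D" "z \<in> D" "pr x z \<in> el F" using F(1) by (auto simp: el_dm)
    then have "x \<in> el X" using F(1,3) by (auto simp: el_dm)
    then obtain y where y: "y \<in> D" "pr x y \<in> el F" "Q x y" using F(4) by blast
    moreover have "y = z" using F(2) x y(1,2) unfolding func_def single_valued_def by blast
    ultimately show "z \<in> {y \<in> D. \<exists>x\<in>el X. Q x y}" using \<open>x \<in> el X\<close> by auto
  next
    fix z assume "z \<in> {y \<in> D. \<exists>x\<in>el X. Q x y}"
    then obtain x where x: "x \<in> el X" "z \<in> D" "Q x z" by blast
    then obtain y where y: "y \<in> D" "pr x y \<in> el F" "Q x y" using F(4) by blast
    then have "y = z" using x unique by blast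
    then show "z \<in> el (dm (cv F))" using x y F(1) by (auto simp: el_dm)
  qed
  then show ?thesis using F(1) by (intro bexI[of _ "dm (cv F)"]) auto
qed

end

section \<open>Binary unions, foundation and ordinals\<close>

context set_structure
begin

definition bu :: "'u \<Rightarrow> 'u \<Rightarrow> 'u" where "bu x y = un (up x y)"

text \<open>Naming the two terms by bound variables means that a defined notion has to be unfolded
  and checked at variables only.\<close>

lemma definable_subst2:
  assumes P: "\<And>i j. definable (\<lambda>e. P (e i) (e j))" and s: "definable_tm s" and t: "definable_tm t"
  shows "definable (\<lambda>e. P (s e) (t e))"
proof -
  have "definable (\<lambda>e. \<exists>x\<in>D. x = s e \<and> (\<exists>y\<in>D. y = t e \<and> P x y))"
    by (intro definable_ex definable_conj definable_eq definable_tm_var definable_tm_shift[OF s]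
        definable_tm_shift[OF definable_tm_shift[OF t]] P)
  then show ?thesis
    by (rule definable_cong) (use s t definable_tm_D in blast)
qed

end

context zf_model
begin

lemma bu_D [simp]: "x \<in> D \<Longrightarrow> y \<in> D \<Longrightarrow> bu x y \<in> D"
  and el_bu [simp]: "x \<in> D \<Longrightarrow> y \<in> D \<Longrightarrow> el (bu x y) = el x \<union> el y"
  by (simp_all add: bu_def)

lemma definable_tm_bu:
  "definable_tm s \<Longrightarrow> definable_tm t \<Longrightarrow> definable_tm (\<lambda>e. bu (s e) (t e))"
  unfolding bu_def by (intro definable_intros)

text \<open>Foundation applied to a singleton; the pair and the triple then rule out the cycles of
  length two and three that come up in \<open>ordinal_mem\<close>.\<close>

lemma mem_irrefl: "x \<notin> el x"
  using foundation[of "up x x"] by (auto simp: el_D)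

lemma mem_asym: "x \<in> el y \<Longrightarrow> y \<notin> el x"
  using foundation[of "up x y"] by (auto simp: el_D)

lemma mem_cycle3: "x \<in> el y \<Longrightarrow> y \<in> el z \<Longrightarrow> z \<notin> el x"
proof
  assume *: "x \<in> el y" "y \<in> el z" "z \<in> el x"
  then have "x \<in> D" "y \<in> D" "z \<in> D" by auto
  then show False using foundation[of "bu (up x y) (up z z)"] * by auto
qed

lemma ordinal_trans: "ordinal a \<Longrightarrow> x \<in> el a \<Longrightarrow> y \<in> el x \<Longrightarrow> y \<in> el a"
  unfolding ordinal_def by blast

lemma ordinal_mem: "ordinal a \<Longrightarrow> x \<in> el a \<Longrightarrow> ordinal x"
proof -
  assume a: "ordinal a" and x: "x \<in> el a"
  have "z \<in> el x" if "y \<in> el x" "z \<in> el y" for y z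
  proof -
    have "y \<in> el a" "z \<in> el a" using ordinal_trans[OF a] x that by blast+
    then have "z \<in> el x \<or> z = x \<or> x \<in> el z" using a x unfolding ordinal_def by blast
    then show ?thesis using mem_asym that mem_cycle3 by blast
  qed
  moreover have "y \<in> el z \<or> y = z \<or> z \<in> el y" if "y \<in> el x" "z \<in> el x" for y z
    using a x that unfolding ordinal_def by blast
  ultimately show ?thesis unfolding ordinal_def by blast
qed

text \<open>The least element y of a outside c is c itself: the elements of y lie in c by
  minimality, and an element of c equal to or above y would put y into c by transitivity.\<close>

lemma ordinal_subset_mem:
  assumes a: "ordinal a" "a \<in> D" and c: "c \<in> D" "el c \<subseteq> el a" "\<And>x y. x \<in> el c \<Longrightarrow> y \<in> el x \<Longrightarrow> y \<in> el c"
    and ne: "c \<noteq> a"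
  shows "c \<in> el a"
proof -
  have "el (df a c) \<noteq> {}" using a c ne el_eqI by auto
  then have "\<exists>y\<in>el (df a c). \<forall>z\<in>el (df a c). z \<notin> el y"
    by (intro foundation) (simp_all add: a c)
  then obtain y where y: "y \<in> el a" "y \<notin> el c" "\<And>z. z \<in> el a \<Longrightarrow> z \<notin> el c \<Longrightarrow> z \<notin> el y"
    using el_df[OF a(2) c(1)] by blast
  have "el y \<subseteq> el c" using y ordinal_trans[OF a(1)] by blast
  moreover have "el c \<subseteq> el y"
  proof
    fix w assume w: "w \<in> el c"
    then have "w \<in> el y \<or> w = y \<or> y \<in> el w" using a(1) c(2) y(1) unfolding ordinal_def by blast
    then show "w \<in> el y" using w y(2) c(3) by blast
  qed
  ultimately have "y = c" using el_eqI[of y c] c(1) y(1) by blast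
  then show ?thesis using y(1) by simp
qed

text \<open>The intersection is transitive. If it differed from both ordinals it would belong to
  both, and thus to itself.\<close>

lemma ordinal_linear:
  assumes "ordinal a" "ordinal b" "a \<in> D" "b \<in> D"
  shows "a \<in> el b \<or> a = b \<or> b \<in> el a"
proof -
  let ?c = "it a b"
  have *: "x \<in> el ?c \<Longrightarrow> y \<in> el x \<Longrightarrow> y \<in> el ?c" for x y
    using assms ordinal_trans[OF assms(1)] ordinal_trans[OF assms(2)] by auto
  have "?c \<in> el a" if "?c \<noteq> a"
    using that by - (rule ordinal_subset_mem[OF assms(1,3)]; (erule (1) * | simp add: assms))
  moreover have "?c \<in> el b" if "?c \<noteq> b"
    using that by - (rule ordinal_subset_mem[OF assms(2,4)]; (erule (1) * | simp add: assms))
  moreover have "\<not> (?c \<in> el a \<and> ?c \<in> el b)" using mem_irrefl[of ?c] assms by auto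
  ultimately show ?thesis by metis
qed

lemma ordinal_subset:
  assumes "ordinal a" "ordinal b" "a \<in> D" "b \<in> D"
  shows "el a \<subseteq> el b \<longleftrightarrow> a \<in> el b \<or> a = b"
  using ordinal_linear[OF assms] ordinal_trans[OF assms(2)] mem_irrefl by blast

lemma ordinalI_linear_image:
  assumes "\<And>x y. x \<in> el a \<Longrightarrow> y \<in> el x \<Longrightarrow> y \<in> el a"
    and "\<And>x y. x \<in> el a \<Longrightarrow> y \<in> el a \<Longrightarrow> x \<in> el y \<or> x = y \<or> y \<in> el x"
  shows "ordinal a"
  using assms unfolding ordinal_def by blast

lemma ordinal_least:
  assumes a: "a \<in> D" and P: "definable (\<lambda>e. P (e 0))" and x: "x \<in> el a" "P x"
  shows "\<exists>m\<in>el a. P m \<and> (\<forall>y\<in>el a. y \<in> el m \<longrightarrow> \<not> P y)"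
proof -
  obtain X where X: "X \<in> D" "el X = {z \<in> el a. P z}" using separation[OF a P] by blast
  then obtain m where "m \<in> el X" "\<forall>z\<in>el X. z \<notin> el m" using foundation[of X] x by blast
  then show ?thesis using X by blast
qed

end

section \<open>Recursion along transitive well-founded relations\<close>

text \<open>The value at b is to be \<open>G\<close> of the set of values at the predecessors of b.
  Minimality concerns only sets X of the model, since the model may be ill-founded from outside.
  Transitivity of \<open>R\<close> makes the set of predecessors of a point downward closed, so that
  it can serve as the domain of a partial solution.\<close>

locale zf_recursion = zf_model \<tau> M for \<tau> :: "('f, 'r) ssig" and M :: "('f fsym, 'r rsym, 'u) model" +
  fixes A R :: 'u and G :: "'u \<Rightarrow> 'u"
  assumes A [simp]: "A \<in> D" and R [simp]: "R \<in> D"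
    and minimal: "\<And>X. X \<in> D \<Longrightarrow> el X \<subseteq> el A \<Longrightarrow> el X \<noteq> {} \<Longrightarrow> \<exists>m\<in>el X. \<forall>b\<in>el X. pr b m \<notin> el R"
    and transitive: "\<And>a b c. a \<in> el A \<Longrightarrow> b \<in> el A \<Longrightarrow> c \<in> el A \<Longrightarrow>
      pr a b \<in> el R \<Longrightarrow> pr b c \<in> el R \<Longrightarrow> pr a c \<in> el R"
    and G_D [simp]: "\<And>s. s \<in> D \<Longrightarrow> G s \<in> D"
    and definable_G: "\<And>t. definable_tm t \<Longrightarrow> definable_tm (\<lambda>e. G (t e))"
begin

lemma minimal_definable:
  assumes P: "definable (\<lambda>e. P (e 0))" and x: "x \<in> el A" "P x"
  shows "\<exists>m\<in>el A. P m \<and> (\<forall>b\<in>el A. pr b m \<in> el R \<longrightarrow> \<not> P b)"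
proof -
  obtain X where X: "X \<in> D" "el X = {z \<in> el A. P z}" using separation[OF A P] by blast
  then obtain m where "m \<in> el X" "\<forall>b\<in>el X. pr b m \<notin> el R" using minimal[of X] x by blast
  then show ?thesis using X by blast
qed

lemma R_irrefl: "a \<in> el A \<Longrightarrow> pr a a \<notin> el R"
  using minimal[of "up a a"] by (auto simp: el_D)

definition downward :: "'u \<Rightarrow> bool" where
  "downward X \<longleftrightarrow> el X \<subseteq> el A \<and> (\<forall>b\<in>el X. \<forall>c\<in>el A. pr c b \<in> el R \<longrightarrow> c \<in> el X)"

text \<open>A solution with domain \<open>X\<close>. The set s of earlier values is quantified
  existentially in place of an image operator; extensionality makes it unique.\<close>

definition sol :: "'u \<Rightarrow> 'u \<Rightarrow> bool" where
  "sol X h \<longleftrightarrow> (\<forall>p\<in>el h. \<exists>b\<in>el X. \<exists>v\<in>D. p = pr b v) \<and> single_valued h \<and>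
     (\<forall>b\<in>el X. \<exists>s\<in>D. pr b (G s) \<in> el h \<and>
        (\<forall>w\<in>D. w \<in> el s \<longleftrightarrow> (\<exists>c\<in>el A. pr c b \<in> el R \<and> pr c w \<in> el h)))"

lemma definable_downward: "definable_tm t \<Longrightarrow> definable (\<lambda>e. downward (t e))"
  by (rule definable_subst2[where P = "\<lambda>x y. downward x"])
    (auto simp: downward_def intro!: definable_intros)

lemma definable_sol: "definable_tm s \<Longrightarrow> definable_tm t \<Longrightarrow> definable (\<lambda>e. sol (s e) (t e))"
  by (rule definable_subst2) (auto simp: sol_def single_valued_def intro!: definable_intros definable_G)

text \<open>At a minimal point where two solutions differ they agree on all predecessors, which
  belong to both domains as these are downward closed. So the sets of earlier values coincide, and
  with them the values.\<close>

lemma sol_unique: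
  assumes X: "downward X" "X \<in> D" "sol X h" "h \<in> D" and Y: "downward Y" "Y \<in> D" "sol Y k" "k \<in> D"
    and b: "b \<in> el X" "b \<in> el Y" and v: "v \<in> D" "pr b v \<in> el h" and w: "w \<in> D" "pr b w \<in> el k"
  shows "v = w"
proof (rule ccontr)
  assume "v \<noteq> w"
  let ?P = "\<lambda>b. b \<in> el X \<and> b \<in> el Y \<and> (\<exists>v\<in>D. \<exists>w\<in>D. pr b v \<in> el h \<and> pr b w \<in> el k \<and> v \<noteq> w)"
  have "\<exists>m\<in>el A. ?P m \<and> (\<forall>b\<in>el A. pr b m \<in> el R \<longrightarrow> \<not> ?P b)"
  proof (rule minimal_definable)
    show "definable (\<lambda>e. ?P (e 0))" using X Y by (intro definable_intros)
    show "b \<in> el A" using b X(1) unfolding downward_def by blast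
    show "?P b" using b v w \<open>v \<noteq> w\<close> by blast
  qed
  then obtain m where m: "m \<in> el A" "?P m" "\<And>c. c \<in> el A \<Longrightarrow> pr c m \<in> el R \<Longrightarrow> \<not> ?P c" by blast
  then obtain v' w' where vw: "v' \<in> D" "w' \<in> D" "pr m v' \<in> el h" "pr m w' \<in> el k" "v' \<noteq> w'" by blast
  obtain s where s: "s \<in> D" "pr m (G s) \<in> el h"
    "\<forall>w\<in>D. w \<in> el s \<longleftrightarrow> (\<exists>c\<in>el A. pr c m \<in> el R \<and> pr c w \<in> el h)"
    using X(3) m(2) unfolding sol_def by blast
  obtain t where t: "t \<in> D" "pr m (G t) \<in> el k"
    "\<forall>w\<in>D. w \<in> el t \<longleftrightarrow> (\<exists>c\<in>el A. pr c m \<in> el R \<and> pr c w \<in> el k)"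
    using Y(3) m(2) unfolding sol_def by blast
  have agree: "pr c u \<in> el h \<longleftrightarrow> pr c u \<in> el k" if c: "c \<in> el A" "pr c m \<in> el R" and u: "u \<in> D" for c u
  proof -
    have "c \<in> el X" "c \<in> el Y" using c m(2) X(1) Y(1) unfolding downward_def by blast+
    moreover from this obtain s' t' where "s' \<in> D" "pr c (G s') \<in> el h" "t' \<in> D" "pr c (G t') \<in> el k"
      using X(3) Y(3) unfolding sol_def by meson
    moreover note m(3)[OF c]
    ultimately show ?thesis using u G_D by metis
  qed
  have "w \<in> el s \<longleftrightarrow> w \<in> el t" if "w \<in> D" for w
    using s(3) t(3) agree that by blast
  then have "s = t" using el_eqI[OF s(1) t(1)] by blast
  moreover have "v' = G s" using X(3) vw s(1,2) m(1) el_D G_D unfolding sol_def single_valued_def by metis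
  moreover have "w' = G t" using Y(3) vw t(1,2) m(1) el_D G_D unfolding sol_def single_valued_def by metis
  ultimately show False using vw by simp
qed

definition value_at :: "'u \<Rightarrow> 'u \<Rightarrow> bool" where
  "value_at b v \<longleftrightarrow> (\<exists>Y\<in>D. \<exists>h\<in>D. downward Y \<and> b \<in> el Y \<and> sol Y h \<and> pr b v \<in> el h)"

lemma value_at_unique: "v \<in> D \<Longrightarrow> w \<in> D \<Longrightarrow> value_at b v \<Longrightarrow> value_at b w \<Longrightarrow> v = w"
  unfolding value_at_def using sol_unique by blast

text \<open>Uniqueness makes \<open>value_at\<close> a definable function, which replacement
  collects into a set \<open>H\<close>. At each b some partial solution h provides the set of
  earlier values, and h agrees with \<open>H\<close> on the predecessors of b.\<close>

lemma sol_glue: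
  assumes X: "X \<in> D" "downward X" and ex: "\<And>b. b \<in> el X \<Longrightarrow> \<exists>v\<in>D. value_at b v"
  shows "\<exists>H\<in>D. sol X H"
proof -
  have "\<exists>H\<in>D. el H = {p \<in> D. \<exists>b\<in>el X. \<exists>v\<in>D. p = pr b v \<and> value_at b v}"
  proof (rule replacement)
    show "definable (\<lambda>e. \<exists>v\<in>D. e (Suc 0) = pr (e 0) v \<and> value_at (e 0) v)"
      unfolding value_at_def by (intro definable_intros definable_downward definable_sol)
    show "\<exists>p\<in>D. \<exists>v\<in>D. p = pr b v \<and> value_at b v" if "b \<in> el X" for b
      using ex[OF that] that by (metis el_D goedel_D(2))
    show "p = q" if "\<exists>v\<in>D. p = pr b v \<and> value_at b v" "\<exists>v\<in>D. q = pr b v \<and> value_at b v" for b p q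
      using that value_at_unique by blast
  qed (rule X)
  then obtain H where H: "H \<in> D" "el H = {p \<in> D. \<exists>b\<in>el X. \<exists>v\<in>D. p = pr b v \<and> value_at b v}" by blast
  have mem: "pr b v \<in> el H \<longleftrightarrow> b \<in> el X \<and> value_at b v" if "b \<in> D" "v \<in> D" for b v
    using that unfolding H(2) by (auto simp: el_D)
  have "sol X H" unfolding sol_def
  proof (intro conjI ballI)
    show "\<exists>b\<in>el X. \<exists>v\<in>D. p = pr b v" if "p \<in> el H" for p using that unfolding H(2) by blast
    show "single_valued H" unfolding single_valued_def using mem value_at_unique by blast
  next
    fix b assume b: "b \<in> el X"
    then obtain v where v: "v \<in> D" "value_at b v" using ex by blast
    then obtain Y h where Y: "Y \<in> D" "h \<in> D" "downward Y" "b \<in> el Y" "sol Y h" "pr b v \<in> el h"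
      unfolding value_at_def by blast
    then obtain s where s: "s \<in> D" "pr b (G s) \<in> el h"
      "\<forall>w\<in>D. w \<in> el s \<longleftrightarrow> (\<exists>c\<in>el A. pr c b \<in> el R \<and> pr c w \<in> el h)"
      unfolding sol_def by blast
    have agree: "pr c w \<in> el h \<longleftrightarrow> pr c w \<in> el H" if c: "c \<in> el A" "pr c b \<in> el R" and w: "w \<in> D" for c w
    proof -
      have cX: "c \<in> el X" "c \<in> el Y" using c b Y X unfolding downward_def by blast+
      then obtain t where "t \<in> D" "pr c (G t) \<in> el h" using Y(5) unfolding sol_def by blast
      then have t: "value_at c (G t)" "G t \<in> D" "pr c (G t) \<in> el h"
        unfolding value_at_def using Y cX by auto
      have "pr c w \<in> el H \<longleftrightarrow> value_at c w" using mem[of c w] c w cX by auto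
      also have "\<dots> \<longleftrightarrow> pr c w \<in> el h"
        using t value_at_unique w Y cX(2) unfolding value_at_def by metis
      finally show ?thesis by simp
    qed
    have "value_at b (G s)" unfolding value_at_def using Y s by blast
    then have "pr b (G s) \<in> el H" using mem[of b "G s"] b s by auto
    then show "\<exists>s\<in>D. pr b (G s) \<in> el H \<and>
        (\<forall>w\<in>D. w \<in> el s \<longleftrightarrow> (\<exists>c\<in>el A. pr c b \<in> el R \<and> pr c w \<in> el H))"
      using s agree by blast
  qed
  then show ?thesis using H(1) by blast
qed

text \<open>At a minimal point m without a value, the partial solutions glue to one on the
  predecessors of m, and this solution can be extended to m after all.\<close>

lemma value_at_exists: "a \<in> el A \<Longrightarrow> \<exists>v\<in>D. value_at a v"
proof (rule ccontr)
  assume "a \<in> el A" "\<not> (\<exists>v\<in>D. value_at a v)"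
  then have "\<exists>m\<in>el A. \<not> (\<exists>v\<in>D. value_at m v) \<and> (\<forall>b\<in>el A. pr b m \<in> el R \<longrightarrow> \<not> \<not> (\<exists>v\<in>D. value_at b v))"
    by (intro minimal_definable)
      (auto simp: value_at_def intro!: definable_intros definable_downward definable_sol)
  then obtain m where m: "m \<in> el A" "\<not> (\<exists>v\<in>D. value_at m v)"
    "\<And>b. b \<in> el A \<Longrightarrow> pr b m \<in> el R \<Longrightarrow> \<exists>v\<in>D. value_at b v" by blast
  have mD: "m \<in> D" using m(1) by blast
  have "\<exists>X\<in>D. el X = {b \<in> el A. pr b m \<in> el R}"
    by (rule separation) (auto intro!: definable_intros mD)
  then obtain X where X: "X \<in> D" "el X = {b \<in> el A. pr b m \<in> el R}" by blast
  have dX: "downward X" unfolding downward_def X(2) using transitive m(1) by blast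
  then obtain H where H: "H \<in> D" "sol X H" using sol_glue[OF X(1)] m(3) X(2) by blast
  \<comment> \<open>The range of \<open>H\<close>, which is the set of values at the predecessors of
    \<open>m\<close>; \<open>K\<close> extends \<open>H\<close> by the value \<open>G s\<close> at
    \<open>m\<close>.\<close>
  define s where "s = dm (cv H)"
  define p where "p = pr m (G s)"
  define Y where "Y = bu X (up m m)"
  define K where "K = bu H (up p p)"
  have D: "s \<in> D" "p \<in> D" "Y \<in> D" "K \<in> D" using H(1) X(1) mD by (simp_all add: s_def p_def Y_def K_def)
  have elY: "el Y = insert m (el X)" using X(1) mD by (simp add: Y_def)
  have elK: "el K = insert p (el H)" using H(1) D(2) by (simp add: K_def)
  have mX: "m \<notin> el X" using X(2) R_irrefl m(1) by blast
  have HX: "b \<in> el X" if "pr b v \<in> el H" "b \<in> D" "v \<in> D" for b v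
    using H(2) that unfolding sol_def by (metis el_D pr_inject)
  have old: "pr b v \<in> el K \<longleftrightarrow> pr b v \<in> el H" if "b \<in> el X" "v \<in> D" for b v
    using that mX mD D(1) el_D[OF that(1)] by (auto simp: elK p_def)
  have new: "pr m v \<in> el K \<longleftrightarrow> v = G s" if "v \<in> D" for v
    using that HX mX mD D(1) by (auto simp: elK p_def)
  have "downward Y" unfolding downward_def elY using dX m(1) X(2) unfolding downward_def by blast
  moreover have "sol Y K" unfolding sol_def
  proof (intro conjI ballI)
    show "\<exists>b\<in>el Y. \<exists>v\<in>D. q = pr b v" if "q \<in> el K" for q
      using that H(2) D(1) unfolding elK elY sol_def p_def by auto
    have "b \<in> el Y" if "pr b v \<in> el K" "b \<in> D" "v \<in> D" for b v
      using that HX mD D(1) by (auto simp: elK elY p_def)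
    then show "single_valued K" unfolding single_valued_def
      using old new H(2) mX unfolding elY sol_def single_valued_def by (metis insertE)
  next
    fix b assume "b \<in> el Y"
    then consider "b = m" | "b \<in> el X" unfolding elY by blast
    then show "\<exists>s\<in>D. pr b (G s) \<in> el K \<and>
        (\<forall>w\<in>D. w \<in> el s \<longleftrightarrow> (\<exists>c\<in>el A. pr c b \<in> el R \<and> pr c w \<in> el K))"
    proof cases
      case 1
      have "w \<in> el s \<longleftrightarrow> (\<exists>c\<in>el X. pr c w \<in> el K)" if "w \<in> D" for w
        using H(1) that HX old unfolding s_def by (auto simp: el_dm dest: el_D)
      then show ?thesis using 1 new[of "G s"] D X(2) by (intro bexI[of _ s]) auto
    next
      case 2
      then obtain t where t: "t \<in> D" "pr b (G t) \<in> el H"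
        "\<forall>w\<in>D. w \<in> el t \<longleftrightarrow> (\<exists>c\<in>el A. pr c b \<in> el R \<and> pr c w \<in> el H)"
        using H(2) unfolding sol_def by blast
      have "c \<in> el X" if "c \<in> el A" "pr c b \<in> el R" for c
        using dX 2 that unfolding downward_def by blast
      then show ?thesis using t old 2 by (intro bexI[of _ t]) auto
    qed
  qed
  moreover have "m \<in> el Y" "pr m (G s) \<in> el K" "G s \<in> D" using elY new[of "G s"] D by auto
  ultimately have "value_at m (G s)" unfolding value_at_def using D by blast
  then show False using m(2) \<open>G s \<in> D\<close> by blast
qed

theorem recursion: "\<exists>H\<in>D. sol A H"
  by (rule sol_glue[OF A]) (auto simp: downward_def value_at_exists)

end

section \<open>Collapses, transitive closures and enumerations\<close>

context set_structure
begin

definition collapse :: "'u \<Rightarrow> 'u \<Rightarrow> 'u \<Rightarrow> bool" where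
  "collapse f a R \<longleftrightarrow> func f \<and> dm f = a \<and>
     (\<forall>x\<in>el a. \<forall>v\<in>D. pr x v \<in> el f \<longrightarrow>
        (\<forall>w\<in>D. w \<in> el v \<longleftrightarrow> (\<exists>y\<in>el a. pr y x \<in> el R \<and> pr y w \<in> el f)))"

text \<open>Well-foundedness as the model sees it: only subsets that are points of the domain are
  tested. Its quantifier over all sets of one model is the reason why it need not persist in an
  extension.\<close>

definition wellfounded :: "'u \<Rightarrow> 'u \<Rightarrow> bool" where
  "wellfounded A R \<longleftrightarrow>
     (\<forall>X\<in>D. el X \<subseteq> el A \<longrightarrow> el X \<noteq> {} \<longrightarrow> (\<exists>m\<in>el X. \<forall>b\<in>el X. pr b m \<notin> el R))"

definition linear :: "'u \<Rightarrow> 'u \<Rightarrow> bool" where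
  "linear A R \<longleftrightarrow>
     (\<forall>a\<in>el A. \<forall>b\<in>el A. \<forall>c\<in>el A. pr a b \<in> el R \<longrightarrow> pr b c \<in> el R \<longrightarrow> pr a c \<in> el R) \<and>
     (\<forall>a\<in>el A. \<forall>b\<in>el A. pr a b \<in> el R \<or> a = b \<or> pr b a \<in> el R)"

text \<open>A replacement for comparing cardinalities: some function maps part of B onto a superset
  of A. Neither the domain nor the range of \<open>f\<close> is prescribed, so covers compose and
  restrict without adjustment.\<close>

definition cov :: "'u \<Rightarrow> 'u \<Rightarrow> bool" where
  "cov A B \<longleftrightarrow> (\<exists>f\<in>D. single_valued f \<and> (\<forall>a\<in>el A. \<exists>b\<in>el B. pr b a \<in> el f))"

lemma single_valuedD:
  "single_valued f \<Longrightarrow> pr x y \<in> el f \<Longrightarrow> pr x z \<in> el f \<Longrightarrow> x \<in> D \<Longrightarrow> y \<in> D \<Longrightarrow> z \<in> D \<Longrightarrow> y = z"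
  unfolding single_valued_def by blast

lemma collapseD:
  "collapse f a R \<Longrightarrow> pr x v \<in> el f \<Longrightarrow> x \<in> el a \<Longrightarrow> v \<in> D \<Longrightarrow> w \<in> D \<Longrightarrow>
    w \<in> el v \<longleftrightarrow> (\<exists>y\<in>el a. pr y x \<in> el R \<and> pr y w \<in> el f)"
  unfolding collapse_def by blast

lemma definable_cov: "definable_tm s \<Longrightarrow> definable_tm t \<Longrightarrow> definable (\<lambda>e. cov (s e) (t e))"
  by (rule definable_subst2) (auto simp: cov_def single_valued_def intro!: definable_intros)

end

context zf_model
begin

lemma dmI: "f \<in> D \<Longrightarrow> x \<in> D \<Longrightarrow> v \<in> D \<Longrightarrow> pr x v \<in> el f \<Longrightarrow> x \<in> el (dm f)"
  by (auto simp: el_dm)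

lemma wellfounded_minimal:
  assumes "wellfounded A R" and A: "A \<in> D" and P: "definable (\<lambda>e. P (e 0))" and x: "x \<in> el A" "P x"
  shows "\<exists>m\<in>el A. P m \<and> (\<forall>b\<in>el A. pr b m \<in> el R \<longrightarrow> \<not> P b)"
proof -
  obtain X where X: "X \<in> D" "el X = {z \<in> el A. P z}" using separation[OF A P] by blast
  then obtain m where "m \<in> el X" "\<forall>b\<in>el X. pr b m \<notin> el R"
    using assms(1) x unfolding wellfounded_def by blast
  then show ?thesis using X by blast
qed

text \<open>Recursion with the identity as \<open>G\<close>: the value at a point is the set of
  values at its predecessors.\<close>

lemma collapse_exists:
  assumes "A \<in> D" "R \<in> D" "wellfounded A R" "linear A R"
  shows "\<exists>f\<in>D. collapse f A R"
proof -
  interpret r: zf_recursion \<tau> M A R "\<lambda>s. s"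
  proof unfold_locales
    show "\<exists>m\<in>el X. \<forall>b\<in>el X. pr b m \<notin> el R" if "X \<in> D" "el X \<subseteq> el A" "el X \<noteq> {}" for X
      using assms(3) that unfolding wellfounded_def by blast
    show "pr a c \<in> el R" if "a \<in> el A" "b \<in> el A" "c \<in> el A" "pr a b \<in> el R" "pr b c \<in> el R" for a b c
      using assms(4) that unfolding linear_def by blast
  qed (simp_all add: assms)
  obtain H where H: "H \<in> D" "r.sol A H" using r.recursion by blast
  have dm: "dm H = A"
  proof (rule el_eqI)
    show "el (dm H) = el A"
      using H unfolding r.sol_def by (auto simp: el_dm) (metis el_D pr_inject)
  qed (simp_all add: H assms)
  have "collapse H A R" unfolding collapse_def
  proof (intro conjI ballI impI)
    show "func H" using H(2) unfolding r.sol_def func_def by (meson el_D)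
    fix x v w assume x: "x \<in> el A" "v \<in> D" "pr x v \<in> el H" "w \<in> D"
    then obtain s where s: "s \<in> D" "pr x s \<in> el H"
      "\<forall>w\<in>D. w \<in> el s \<longleftrightarrow> (\<exists>c\<in>el A. pr c x \<in> el R \<and> pr c w \<in> el H)"
      using H(2) unfolding r.sol_def by blast
    then have "v = s" using single_valuedD[of H x v s] x H(2) unfolding r.sol_def by blast
    then show "w \<in> el v \<longleftrightarrow> (\<exists>y\<in>el A. pr y x \<in> el R \<and> pr y w \<in> el H)"
      using s(3) x(4) by blast
  qed (rule dm)
  then show ?thesis using H(1) by blast
qed

lemma collapse_total:
  assumes "collapse f A R" "f \<in> D" "x \<in> el A"
  shows "\<exists>v\<in>D. pr x v \<in> el f"
proof -
  have "dm f = A" using assms(1) unfolding collapse_def by blast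
  then show ?thesis using el_dm[OF assms(2)] assms(3) by blast
qed

lemma collapse_dom:
  assumes "collapse f A R" "f \<in> D" "pr x v \<in> el f" "x \<in> D" "v \<in> D"
  shows "x \<in> el A"
proof -
  have "dm f = A" using assms(1) unfolding collapse_def by blast
  then show ?thesis using el_dm[OF assms(2)] assms(3-5) by blast
qed

lemma collapse_sv: "collapse f A R \<Longrightarrow> single_valued f"
  unfolding collapse_def func_def by blast

text \<open>At a minimal point where f and g differ, both values consist of the same earlier values
  and are equal by extensionality. Well-foundedness is not contained in the collapse condition
  itself, so each application has to supply it from elsewhere.\<close>

lemma collapse_unique:
  assumes f: "collapse f A R" "f \<in> D" and g: "collapse g A S" "g \<in> D"
    and wf: "wellfounded A S" and A: "A \<in> D"
    and eq: "\<And>x y. x \<in> el A \<Longrightarrow> y \<in> el A \<Longrightarrow> pr x y \<in> el R \<longleftrightarrow> pr x y \<in> el S"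
  shows "f = g"
proof -
  have agree: "pr x v \<in> el f \<longleftrightarrow> pr x v \<in> el g" if "x \<in> el A" "v \<in> D" for x v
  proof (rule ccontr)
    assume bad: "\<not> ?thesis"
    let ?P = "\<lambda>x. \<exists>v\<in>D. \<not> (pr x v \<in> el f \<longleftrightarrow> pr x v \<in> el g)"
    have "\<exists>m\<in>el A. ?P m \<and> (\<forall>b\<in>el A. pr b m \<in> el S \<longrightarrow> \<not> ?P b)"
      by (rule wellfounded_minimal[OF wf A _ that(1)])
        (use that bad f g in \<open>auto intro!: definable_intros\<close>)
    then obtain m where m: "m \<in> el A" "?P m" "\<And>b. b \<in> el A \<Longrightarrow> pr b m \<in> el S \<Longrightarrow> \<not> ?P b" by blast
    obtain v w where v: "v \<in> D" "pr m v \<in> el f" and w: "w \<in> D" "pr m w \<in> el g"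
      using collapse_total f g m(1) by metis
    have "u \<in> el v \<longleftrightarrow> u \<in> el w" if "u \<in> D" for u
      using collapseD[OF f(1) v(2) m(1) v(1) that] collapseD[OF g(1) w(2) m(1) w(1) that]
        m(3) eq m(1) that by blast
    then have "v = w" using el_eqI[OF v(1) w(1)] by blast
    then have "\<not> ?P m"
      using v w single_valuedD[OF collapse_sv[OF f(1)]] single_valuedD[OF collapse_sv[OF g(1)]] m(1) el_D
      by metis
    then show False using m(2) by blast
  qed
  have "el f = el g"
  proof (intro equalityI subsetI)
    fix p assume p: "p \<in> el f"
    then obtain x v where "x \<in> D" "v \<in> D" "p = pr x v" using f(1) unfolding collapse_def func_def by blast
    then show "p \<in> el g" using agree collapse_dom[OF f] p by blast
  next
    fix p assume p: "p \<in> el g"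
    then obtain x v where "x \<in> D" "v \<in> D" "p = pr x v" using g(1) unfolding collapse_def func_def by blast
    then show "p \<in> el f" using agree collapse_dom[OF g] p by blast
  qed
  then show ?thesis using el_eqI f g by blast
qed

text \<open>If one of two points with the common value v preceded the other, v would be an element
  of v; linearity leaves only equality.\<close>

lemma collapse_inj:
  assumes f: "collapse f A R" "f \<in> D" and lin: "linear A R"
    and a: "a \<in> el A" "b \<in> el A" "v \<in> D" "pr a v \<in> el f" "pr b v \<in> el f"
  shows "a = b"
proof -
  have "pr x y \<notin> el R" if "x \<in> el A" "y \<in> el A" "pr x v \<in> el f" "pr y v \<in> el f" for x y
    using collapseD[OF f(1) that(4,2) a(3,3)] that mem_irrefl by blast
  then show ?thesis using lin a unfolding linear_def by blast
qed

text \<open>Transitivity of \<open>R\<close> makes the value a transitive set, and comparability of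
  points makes its elements comparable.\<close>

lemma collapse_ordinal:
  assumes f: "collapse f A R" "f \<in> D" and lin: "linear A R" and a: "a \<in> el A" "v \<in> D" "pr a v \<in> el f"
  shows "ordinal v"
proof (rule ordinalI_linear_image)
  fix x y assume x: "x \<in> el v" and y: "y \<in> el x"
  obtain b where b: "b \<in> el A" "pr b a \<in> el R" "pr b x \<in> el f"
    using collapseD[OF f(1) a(3,1,2)] x by blast
  obtain c where c: "c \<in> el A" "pr c b \<in> el R" "pr c y \<in> el f"
    using collapseD[OF f(1) b(3,1)] x y by blast
  have "pr c a \<in> el R" using lin a b c unfolding linear_def by blast
  then show "y \<in> el v" using collapseD[OF f(1) a(3,1,2)] c y by blast
next
  fix x y assume x: "x \<in> el v" and y: "y \<in> el v"
  obtain b c where b: "b \<in> el A" "pr b x \<in> el f" and c: "c \<in> el A" "pr c y \<in> el f"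
    using collapseD[OF f(1) a(3,1,2)] x y by blast
  have "pr b c \<in> el R \<or> b = c \<or> pr c b \<in> el R" using lin b c unfolding linear_def by blast
  then show "x \<in> el y \<or> x = y \<or> y \<in> el x"
    using collapseD[OF f(1) b(2,1)] collapseD[OF f(1) c(2,1)] b c x y
      single_valuedD[OF collapse_sv[OF f(1)]] el_D by metis
qed

lemma collapse_range_ordinal:
  assumes f: "collapse f A R" "f \<in> D" and lin: "linear A R"
  shows "ordinal (dm (cv f))"
proof (rule ordinalI_linear_image)
  have mem: "v \<in> el (dm (cv f)) \<longleftrightarrow> (\<exists>a\<in>el A. pr a v \<in> el f)" if "v \<in> D" for v
    using f(2) that collapse_dom[OF f] by (auto simp: el_dm)
  show "y \<in> el (dm (cv f))" if "x \<in> el (dm (cv f))" "y \<in> el x" for x y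
    using that mem[of x] mem[of y] collapseD[OF f(1)] el_D by meson
  show "x \<in> el y \<or> x = y \<or> y \<in> el x" if x: "x \<in> el (dm (cv f))" and y: "y \<in> el (dm (cv f))" for x y
  proof -
    obtain b c where b: "b \<in> el A" "pr b x \<in> el f" and c: "c \<in> el A" "pr c y \<in> el f"
      using mem x y by blast
    have "pr b c \<in> el R \<or> b = c \<or> pr c b \<in> el R" using lin b c unfolding linear_def by blast
    then show ?thesis
      using collapseD[OF f(1) b(2,1)] collapseD[OF f(1) c(2,1)] b c x y
        single_valuedD[OF collapse_sv[OF f(1)]] el_D by metis
  qed
qed

section \<open>Sets of ordinals ordered by membership, and enumerations\<close>

lemma ordinal_ep:
  assumes b: "b \<in> D" "ordinal b" and A: "A \<in> D" "el A \<subseteq> el b"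
  shows "wellfounded A (ep A A)" "linear A (ep A A)"
proof -
  have R: "pr x y \<in> el (ep A A) \<longleftrightarrow> x \<in> el y" if "x \<in> el A" "y \<in> el A" for x y
    using that A(1) by (simp add: el_D)
  show "wellfounded A (ep A A)" unfolding wellfounded_def
  proof (intro ballI impI)
    fix X assume X: "X \<in> D" "el X \<subseteq> el A" "el X \<noteq> {}"
    then obtain m where "m \<in> el X" "\<forall>z\<in>el X. z \<notin> el m" using foundation by blast
    then show "\<exists>m\<in>el X. \<forall>b\<in>el X. pr b m \<notin> el (ep A A)" using R X(2) by blast
  qed
  show "linear A (ep A A)" unfolding linear_def
  proof (intro conjI ballI impI)
    fix x y z assume *: "x \<in> el A" "y \<in> el A" "z \<in> el A" "pr x y \<in> el (ep A A)" "pr y z \<in> el (ep A A)"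
    then have "x \<in> el y" "y \<in> el z" "ordinal z" using R ordinal_mem[OF b(2)] A(2) by blast+
    then show "pr x z \<in> el (ep A A)" using R[OF *(1,3)] ordinal_trans by blast
  next
    fix x y assume *: "x \<in> el A" "y \<in> el A"
    then have "x \<in> el y \<or> x = y \<or> y \<in> el x" using A(2) b(2) unfolding ordinal_def by blast
    then show "pr x y \<in> el (ep A A) \<or> x = y \<or> pr y x \<in> el (ep A A)"
      using R[OF *] R[OF *(2,1)] by blast
  qed
qed

text \<open>Each x in X is represented by its least preimage under f. The set A of representatives
  collapses to \<alpha>, and going back from \<alpha> to A and on to X gives the bijection. The last
  clause serves the construction of codes, where 0 has to remain the index of the coded set.\<close>

lemma enumeration:
  assumes b: "\<beta> \<in> D" "ordinal \<beta>" and X: "X \<in> D" and f: "f \<in> D" "single_valued f"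
    and onto: "\<And>x. x \<in> el X \<Longrightarrow> \<exists>b\<in>el \<beta>. pr b x \<in> el f"
  shows "\<exists>\<alpha>\<in>D. \<exists>h\<in>D. ordinal \<alpha> \<and> el \<alpha> \<subseteq> el \<beta> \<and> bij h \<alpha> X \<and>
    (\<forall>x\<in>el X. em \<in> el \<beta> \<longrightarrow> pr em x \<in> el f \<longrightarrow> pr em x \<in> el h)"
proof -
  have "\<exists>A\<in>D. el A = {b \<in> el \<beta>. \<exists>x\<in>el X. pr b x \<in> el f \<and> (\<forall>c\<in>el b. pr c x \<notin> el f)}"
    by (rule separation) (use b X f in \<open>auto intro!: definable_intros\<close>)
  then obtain A where A: "A \<in> D"
    "el A = {b \<in> el \<beta>. \<exists>x\<in>el X. pr b x \<in> el f \<and> (\<forall>c\<in>el b. pr c x \<notin> el f)}" by blast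
  let ?R = "ep A A"
  have AR: "wellfounded A ?R" "linear A ?R" using ordinal_ep[OF b A(1)] A(2) by blast+
  have R: "pr x y \<in> el ?R \<longleftrightarrow> x \<in> el y" if "x \<in> el A" "y \<in> el A" for x y
    using that A(1) by (simp add: el_D)
  obtain e where e: "e \<in> D" "collapse e A ?R" using collapse_exists[OF A(1) _ AR] A(1) by auto
  define \<alpha> where "\<alpha> = dm (cv e)"
  have \<alpha>: "\<alpha> \<in> D" "ordinal \<alpha>" using collapse_range_ordinal[OF e(2,1) AR(2)] e by (simp_all add: \<alpha>_def)
  have mem: "v \<in> el \<alpha> \<longleftrightarrow> (\<exists>a\<in>el A. pr a v \<in> el e)" if "v \<in> D" for v
    using e that collapse_dom[OF e(2,1)] unfolding \<alpha>_def by (auto simp: el_dm)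
  have oA: "ordinal a" if "a \<in> el A" for a using that A(2) b ordinal_mem by blast
  \<comment> \<open>Collapsing a set of ordinals never increases a point: at a minimal exception
    \<open>m\<close>, every element of the value would lie in \<open>m\<close>. This keeps \<alpha>
    inside \<beta>.\<close>
  have below: "v \<in> el a \<or> v = a" if a: "a \<in> el A" and v: "v \<in> D" "pr a v \<in> el e" for a v
  proof (rule ccontr)
    assume bad: "\<not> ?thesis"
    let ?P = "\<lambda>a. \<exists>v\<in>D. pr a v \<in> el e \<and> \<not> (v \<in> el a \<or> v = a)"
    have "\<exists>m\<in>el A. ?P m \<and> (\<forall>b\<in>el A. pr b m \<in> el ?R \<longrightarrow> \<not> ?P b)"
      by (rule wellfounded_minimal[OF AR(1) A(1) _ a]) (use v bad e in \<open>auto intro!: definable_intros\<close>)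
    then obtain m where m: "m \<in> el A" "?P m" "\<And>b. b \<in> el A \<Longrightarrow> pr b m \<in> el ?R \<Longrightarrow> \<not> ?P b" by blast
    then obtain u where u: "u \<in> D" "pr m u \<in> el e" "u \<notin> el m" "u \<noteq> m" by blast
    have "w \<in> el m" if w: "w \<in> el u" for w
    proof -
      obtain c where c: "c \<in> el A" "pr c m \<in> el ?R" "pr c w \<in> el e"
        using collapseD[OF e(2) u(2) m(1) u(1)] w by blast
      then have "w \<in> el c \<or> w = c" "c \<in> el m" using m R w by blast+
      then show ?thesis using ordinal_trans[OF oA[OF m(1)]] by blast
    qed
    then have "u \<in> el m \<or> u = m"
      using ordinal_subset[OF collapse_ordinal[OF e(2,1) AR(2) m(1) u(1,2)] oA[OF m(1)] u(1)] m(1)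
      by blast
    then show False using u by blast
  qed
  have \<alpha>\<beta>: "el \<alpha> \<subseteq> el \<beta>"
  proof
    fix v assume v: "v \<in> el \<alpha>"
    then obtain a where "a \<in> el A" "pr a v \<in> el e" using mem by blast
    then show "v \<in> el \<beta>" using below[of a v] v A(2) ordinal_trans[OF b(2)] by blast
  qed
  have "\<exists>h\<in>D. el h = {p \<in> el (ti \<alpha> X). \<exists>v\<in>D. \<exists>x\<in>D. \<exists>a\<in>el A. p = pr v x \<and> pr a v \<in> el e \<and> pr a x \<in> el f}"
    by (rule separation) (use \<alpha>(1) X A(1) e(1) f(1) in \<open>auto intro!: definable_intros\<close>)
  then obtain h where h: "h \<in> D"
    "el h = {p \<in> el (ti \<alpha> X). \<exists>v\<in>D. \<exists>x\<in>D. \<exists>a\<in>el A. p = pr v x \<and> pr a v \<in> el e \<and> pr a x \<in> el f}"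
    by blast
  have hmem: "pr v x \<in> el h \<longleftrightarrow> x \<in> el X \<and> (\<exists>a\<in>el A. pr a v \<in> el e \<and> pr a x \<in> el f)"
    if "v \<in> D" "x \<in> D" for v x
    using that \<alpha>(1) X mem unfolding h(2) by auto
  have single_e: "v = w" if "pr a v \<in> el e" "pr a w \<in> el e" "a \<in> D" "v \<in> D" "w \<in> D" for a v w
    using single_valuedD[OF collapse_sv[OF e(2)]] that by blast
  have single_f: "v = w" if "pr a v \<in> el f" "pr a w \<in> el f" "a \<in> D" "v \<in> D" "w \<in> D" for a v w
    using single_valuedD[OF f(2)] that by blast
  have A_least: "x \<in> el X \<and> (\<forall>c\<in>el a. pr c x \<notin> el f)" if "a \<in> el A" "pr a x \<in> el f" "x \<in> D" for a x
    using that single_f[of a x] unfolding A(2) by (auto simp: el_D)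
  have "bij h \<alpha> X" unfolding bij_def surj_on_def
  proof (intro conjI ballI)
    show "func h" unfolding func_def single_valued_def
    proof (intro conjI ballI impI)
      show "\<exists>v\<in>D. \<exists>x\<in>D. p = pr v x" if "p \<in> el h" for p using that unfolding h(2) by blast
      fix v x y assume v: "v \<in> D" "x \<in> D" "y \<in> D" "pr v x \<in> el h \<and> pr v y \<in> el h"
      obtain a where a: "a \<in> el A" "pr a v \<in> el e" "pr a x \<in> el f" using hmem[OF v(1,2)] v(4) by blast
      obtain c where c: "c \<in> el A" "pr c v \<in> el e" "pr c y \<in> el f" using hmem[OF v(1,3)] v(4) by blast
      have "a = c" using collapse_inj[OF e(2,1) AR(2) a(1) c(1) v(1) a(2) c(2)] .
      then show "x = y" using single_f[OF a(3) _ _ v(2,3)] c(3) a(1) el_D by blast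
    qed
    show "dm h = \<alpha>"
    proof (rule el_eqI)
      show "el (dm h) = el \<alpha>"
      proof (intro equalityI subsetI)
        fix v assume "v \<in> el (dm h)"
        then show "v \<in> el \<alpha>" using h(1) hmem mem by (auto simp: el_dm)
      next
        fix v assume v: "v \<in> el \<alpha>"
        then obtain a where a: "a \<in> el A" "pr a v \<in> el e" using mem by blast
        then obtain x where "x \<in> el X" "pr a x \<in> el f" using A(2) by blast
        then show "v \<in> el (dm h)" using h(1) hmem v a dmI by blast
      qed
    qed (simp_all add: h \<alpha>)
  next
    fix x assume x: "x \<in> D"
    show "x \<in> el X \<longleftrightarrow> (\<exists>v\<in>D. pr v x \<in> el h)"
    proof
      assume xX: "x \<in> el X"
      then obtain b0 where b0: "b0 \<in> el \<beta>" "pr b0 x \<in> el f" using onto by blast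
      have "\<exists>m\<in>el \<beta>. pr m x \<in> el f \<and> (\<forall>y\<in>el \<beta>. y \<in> el m \<longrightarrow> pr y x \<notin> el f)"
        by (rule ordinal_least[OF b(1) _ b0(1)]) (use f x b0 in \<open>auto intro!: definable_intros\<close>)
      then obtain m where m: "m \<in> el \<beta>" "pr m x \<in> el f" "\<forall>y\<in>el \<beta>. y \<in> el m \<longrightarrow> pr y x \<notin> el f" by blast
      then have "m \<in> el A" unfolding A(2) using xX ordinal_trans[OF b(2)] by blast
      then show "\<exists>v\<in>D. pr v x \<in> el h"
        using collapse_total[OF e(2,1)] hmem x xX m(2) by blast
    next
      show "\<exists>v\<in>D. pr v x \<in> el h \<Longrightarrow> x \<in> el X" using hmem x by blast
    qed
  next
    fix v w x assume vwx: "v \<in> D" "w \<in> D" "x \<in> D"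
    show "pr v x \<in> el h \<and> pr w x \<in> el h \<longrightarrow> v = w"
    proof
      assume "pr v x \<in> el h \<and> pr w x \<in> el h"
      note v = vwx this
      obtain a where a: "a \<in> el A" "pr a v \<in> el e" "pr a x \<in> el f" using hmem[OF v(1,3)] v(4) by blast
      obtain c where c: "c \<in> el A" "pr c w \<in> el e" "pr c x \<in> el f" using hmem[OF v(2,3)] v(4) by blast
      \<comment> \<open>Both are the least preimage of \<open>x\<close>, so neither precedes the
        other.\<close>
      have "a \<notin> el c" "c \<notin> el a" using A_least a c v by blast+
      then have "a = c" using AR(2) R a c unfolding linear_def by blast
      then show "v = w" using single_e a c v by blast
    qed
  qed
  moreover have "pr em x \<in> el h" if x: "x \<in> el X" "em \<in> el \<beta>" "pr em x \<in> el f" for x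
  proof -
    \<comment> \<open>Nothing precedes 0, so it is a least preimage; having no predecessors in
      \<open>A\<close>, it collapses to the empty set.\<close>
    have emA: "em \<in> el A" unfolding A(2) using x by auto
    then obtain v where v: "v \<in> D" "pr em v \<in> el e" using collapse_total[OF e(2,1)] by blast
    have "w \<notin> el v" for w
      using collapseD[OF e(2) v(2) emA v(1), of w] R[OF _ emA] by auto
    then have "el v = el em" by auto
    then have "v = em" by (rule el_eqI[OF v(1) goedel_D(12)])
    then show ?thesis using hmem[of em x] v x emA by auto
  qed
  ultimately show ?thesis using \<alpha> h(1) \<alpha>\<beta> by blast
qed

text \<open>Recursion on \<omega>: if s is the set of earlier stages, \<open>un s\<close> is their
  union and \<open>un (un s)\<close> collects the elements of its members. Hence a stage consists of
  x and of the elements of all members of earlier stages, and t is the union of the stages. Closure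
  of P is demanded at members of t only, which is what the induction on stages uses.\<close>

theorem transitive_closure:
  assumes x: "x \<in> D"
  shows "\<exists>t\<in>D. x \<in> el t \<and> (\<forall>z\<in>el t. el z \<subseteq> el t) \<and>
    (\<forall>P\<in>D. x \<in> el P \<longrightarrow> (\<forall>z\<in>el P. z \<in> el t \<longrightarrow> el z \<subseteq> el P) \<longrightarrow> el t \<subseteq> el P)"
proof -
  have oom: "ordinal om" and nonempty: "el om \<noteq> {}" and lim: "\<And>n. n \<in> el om \<Longrightarrow> \<exists>m\<in>el om. n \<in> el m"
    using omega_limit el_eqI[of om em] unfolding limit_ordinal_def by auto
  note om = ordinal_ep[OF _ oom, of om, simplified]
  interpret r: zf_recursion \<tau> M om "ep om om" "\<lambda>s. bu (up x x) (un (un s))"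
  proof unfold_locales
    show "\<exists>m\<in>el X. \<forall>b\<in>el X. pr b m \<notin> el (ep om om)"
      if "X \<in> D" "el X \<subseteq> el om" "el X \<noteq> {}" for X
      using om(1) that unfolding wellfounded_def by blast
    show "pr a c \<in> el (ep om om)" if "a \<in> el om" "b \<in> el om" "c \<in> el om"
      "pr a b \<in> el (ep om om)" "pr b c \<in> el (ep om om)" for a b c
      using om(2) that unfolding linear_def by blast
    show "definable_tm (\<lambda>e. bu (up x x) (un (un (t e))))" if "definable_tm t" for t
      by (intro definable_intros definable_tm_bu that x goedel_D)
  qed (simp_all add: x)
  obtain H where H: "H \<in> D" "r.sol om H" using r.recursion by blast
  have total: "\<exists>s\<in>D. pr n (bu (up x x) (un (un s))) \<in> el H \<and>
      (\<forall>w\<in>D. w \<in> el s \<longleftrightarrow> (\<exists>c\<in>el om. c \<in> el n \<and> pr c w \<in> el H))" if "n \<in> el om" for n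
    using H(2) that unfolding r.sol_def by (auto simp: el_D cong: bex_cong)
  have single: "v = w" if "pr n v \<in> el H" "pr n w \<in> el H" "n \<in> D" "v \<in> D" "w \<in> D" for n v w
    using single_valuedD[of H n v w] H(2) that unfolding r.sol_def by blast
  define t where "t = un (dm (cv H))"
  have dom: "n \<in> el om" if nv: "pr n v \<in> el H" "n \<in> D" "v \<in> D" for n v
  proof -
    have "\<forall>p\<in>el H. \<exists>b\<in>el om. \<exists>v\<in>D. p = pr b v" using H(2) unfolding r.sol_def by (rule conjunct1)
    then obtain b u where b: "b \<in> el om" "u \<in> D" "pr n v = pr b u" using nv(1) by blast
    have "n = b" using b(3) pr_inject[OF nv(2,3) el_D[OF b(1)] b(2)] by blast
    then show ?thesis using b(1) by simp
  qed
  have mem: "z \<in> el t \<longleftrightarrow> (\<exists>n\<in>el om. \<exists>v\<in>D. pr n v \<in> el H \<and> z \<in> el v)" for z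
  proof
    assume "z \<in> el t"
    then obtain v where v: "v \<in> el (dm (cv H))" "z \<in> el v" using H(1) unfolding t_def by auto
    then obtain n where "n \<in> D" "pr n v \<in> el H" using H(1) by (auto simp: el_dm)
    then show "\<exists>n\<in>el om. \<exists>v\<in>D. pr n v \<in> el H \<and> z \<in> el v" using dom v by blast
  next
    assume "\<exists>n\<in>el om. \<exists>v\<in>D. pr n v \<in> el H \<and> z \<in> el v"
    then obtain n v where n: "n \<in> D" "v \<in> D" "pr n v \<in> el H" "z \<in> el v" by blast
    then have "v \<in> el (dm (cv H))" using H(1) by (auto simp: el_dm)
    then show "z \<in> el t" using n H(1) unfolding t_def by auto
  qed
  have "x \<in> el t"
  proof -
    obtain n where n: "n \<in> el om" using nonempty by blast
    then obtain s where "s \<in> D" "pr n (bu (up x x) (un (un s))) \<in> el H" using total by blast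
    then show ?thesis unfolding mem using n x by (intro bexI[of _ n] bexI[of _ "bu (up x x) (un (un s))"]) auto
  qed
  moreover have "w \<in> el t" if zt: "z \<in> el t" and w: "w \<in> el z" for z w
  proof -
    obtain n v where n: "n \<in> el om" "v \<in> D" "pr n v \<in> el H" "z \<in> el v" using zt mem by blast
    then obtain m where m: "m \<in> el om" "n \<in> el m" using lim by blast
    then obtain s where s: "s \<in> D" "pr m (bu (up x x) (un (un s))) \<in> el H"
      "\<forall>w\<in>D. w \<in> el s \<longleftrightarrow> (\<exists>c\<in>el om. c \<in> el m \<and> pr c w \<in> el H)" using total by blast
    then have "v \<in> el s" using n m by blast
    then have "w \<in> el (bu (up x x) (un (un s)))" using s(1) x n(4) w by auto
    then show ?thesis unfolding mem using s m x by (intro bexI[of _ m] bexI[of _ "bu (up x x) (un (un s))"]) auto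
  qed
  moreover have "el t \<subseteq> el P"
    if P: "P \<in> D" "x \<in> el P" and closed: "\<And>z. z \<in> el P \<Longrightarrow> z \<in> el t \<Longrightarrow> el z \<subseteq> el P" for P
  proof
    fix z assume z: "z \<in> el t"
    then obtain n v where n: "n \<in> el om" "v \<in> D" "pr n v \<in> el H" "z \<in> el v" using mem by blast
    show "z \<in> el P"
    proof (rule ccontr)
      assume "z \<notin> el P"
      let ?B = "\<lambda>n. \<exists>v\<in>D. pr n v \<in> el H \<and> \<not> el v \<subseteq> el P"
      have "\<exists>m\<in>el om. ?B m \<and> (\<forall>y\<in>el om. y \<in> el m \<longrightarrow> \<not> ?B y)"
        by (rule ordinal_least[OF _ _ n(1)])
          (use n \<open>z \<notin> el P\<close> H P in \<open>auto intro!: definable_intros\<close>)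
      then obtain m where m: "m \<in> el om" "?B m" "\<And>y. y \<in> el om \<Longrightarrow> y \<in> el m \<Longrightarrow> \<not> ?B y" by blast
      then obtain u y where u: "u \<in> D" "pr m u \<in> el H" "y \<in> el u" "y \<notin> el P" by blast
      obtain s where s: "s \<in> D" "pr m (bu (up x x) (un (un s))) \<in> el H"
        "\<forall>w\<in>D. w \<in> el s \<longleftrightarrow> (\<exists>c\<in>el om. c \<in> el m \<and> pr c w \<in> el H)" using total m(1) by blast
      have "u = bu (up x x) (un (un s))" using single[OF u(2) s(2)] m(1) u(1) s(1) x by auto
      then have "y = x \<or> (\<exists>q\<in>el s. \<exists>z\<in>el q. y \<in> el z)" using u(3) s(1) x by auto
      then obtain q z' where q: "q \<in> el s" "z' \<in> el q" "y \<in> el z'" using u(4) P(2) by blast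
      then obtain c where c: "c \<in> el om" "c \<in> el m" "pr c q \<in> el H" using s(3) by blast
      then have "el q \<subseteq> el P" using m(3) q(1) by blast
      moreover have "z' \<in> el t" unfolding mem using c q by blast
      ultimately show False using closed[of z'] q u(4) by blast
    qed
  qed
  moreover have "t \<in> D" using H(1) by (simp add: t_def)
  ultimately show ?thesis by blast
qed

end

section \<open>Goedel terms for composition, inequality and the order of pairs\<close>

text \<open>Symbols for Goedel operations are interpreted in a substructure as in the whole structure.
  Hence every notion below which is an equation between Goedel terms is absolute, without an
  appeal to transitivity. This is why compositions, collapses and the well-order of pairs are
  expressed by such terms.\<close>

context set_structure
begin

text \<open>The relational composition, \<open>A\<close> first. Swapping A \<times> ran B and
  rotating the product of the converse of B with dom A both give triples ((x,w),y); the intersection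
  is then projected to (x,w).\<close>

definition cmp :: "'u \<Rightarrow> 'u \<Rightarrow> 'u" where
  "cmp A B = dm (it (sw (ti A (dm (cv B)))) (ro (ti (cv B) (dm A))))"

text \<open>Distinctness on V by extensionality: some w belongs to one of the two points and not to
  the other. With e for membership and n for non-membership between \<Union>V and V, these two cases
  are compositions.\<close>

definition neq :: "'u \<Rightarrow> 'u" where
  "neq V = (let e = ep (un V) V; n = df (ti (un V) V) e in bu (cmp (cv e) n) (cmp (cv n) e))"

text \<open>After the domain come the two equations saying that f is a relation and is
  single-valued. In the last equation both sides consist of pairs (x,w): on the left w is an element
  of f(x), on the right w is f(y) for some predecessor y of x.\<close>

definition collapse_eq :: "'u \<Rightarrow> 'u \<Rightarrow> 'u \<Rightarrow> bool" where
  "collapse_eq f a R \<longleftrightarrow> (let V = dm (cv f) in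
     dm f = a \<and> df f (ti a V) = em \<and> it (cmp (cv f) f) (neq V) = em \<and>
     cmp f (cv (ep (un V) V)) = cmp (cv (it R (ti a a))) f)"

text \<open>On an ordinal, equality is incomparability under membership, so the diagonal is a
  difference of terms.\<close>

definition eqk :: "'u \<Rightarrow> 'u" where
  "eqk \<kappa> = df (df (ti \<kappa> \<kappa>) (ep \<kappa> \<kappa>)) (cv (ep \<kappa> \<kappa>))"

text \<open>The first projection of \<kappa> \<times> \<kappa> as a set of pairs ((a,b),a);
  \<open>sndk\<close> is the second one.\<close>

definition fstk :: "'u \<Rightarrow> 'u" where "fstk \<kappa> = sw (ti (eqk \<kappa>) \<kappa>)"
definition sndk :: "'u \<Rightarrow> 'u" where "sndk \<kappa> = ro (ti (eqk \<kappa>) \<kappa>)"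

text \<open>The relation r between p(x) and q(y), regarded as a relation between x and y.\<close>

definition pull :: "'u \<Rightarrow> 'u \<Rightarrow> 'u \<Rightarrow> 'u" where "pull p r q = cmp p (cmp r (cv q))"

text \<open>max(a,b) < max(c,d) holds iff each of a and b is below c or below d. This form uses only
  the two projections and membership.\<close>

definition maxlt :: "'u \<Rightarrow> 'u" where
  "maxlt \<kappa> = (let e = ep \<kappa> \<kappa> in
     it (bu (pull (fstk \<kappa>) e (fstk \<kappa>)) (pull (fstk \<kappa>) e (sndk \<kappa>)))
        (bu (pull (sndk \<kappa>) e (fstk \<kappa>)) (pull (sndk \<kappa>) e (sndk \<kappa>))))"

definition maxeq :: "'u \<Rightarrow> 'u" where
  "maxeq \<kappa> = df (df (ti (ti \<kappa> \<kappa>) (ti \<kappa> \<kappa>)) (maxlt \<kappa>)) (cv (maxlt \<kappa>))"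

definition ltk :: "'u \<Rightarrow> 'u" where
  "ltk \<kappa> = bu (maxlt \<kappa>) (it (maxeq \<kappa>) (bu (pull (fstk \<kappa>) (ep \<kappa> \<kappa>) (fstk \<kappa>))
     (it (pull (fstk \<kappa>) (eqk \<kappa>) (fstk \<kappa>)) (pull (sndk \<kappa>) (ep \<kappa> \<kappa>) (sndk \<kappa>)))))"

definition goedel_less :: "'u \<Rightarrow> 'u \<Rightarrow> 'u \<Rightarrow> 'u \<Rightarrow> bool" where
  "goedel_less a b c d \<longleftrightarrow> bu a b \<in> el (bu c d) \<or>
     bu a b = bu c d \<and> (a \<in> el c \<or> a = c \<and> b \<in> el d)"

lemma term_D [simp]:
  "x \<in> D \<Longrightarrow> y \<in> D \<Longrightarrow> bu x y \<in> D" "x \<in> D \<Longrightarrow> y \<in> D \<Longrightarrow> cmp x y \<in> D" "x \<in> D \<Longrightarrow> neq x \<in> D"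
  "x \<in> D \<Longrightarrow> eqk x \<in> D" "x \<in> D \<Longrightarrow> fstk x \<in> D" "x \<in> D \<Longrightarrow> sndk x \<in> D"
  "x \<in> D \<Longrightarrow> y \<in> D \<Longrightarrow> z \<in> D \<Longrightarrow> pull x y z \<in> D" "x \<in> D \<Longrightarrow> maxlt x \<in> D" "x \<in> D \<Longrightarrow> maxeq x \<in> D"
  "x \<in> D \<Longrightarrow> ltk x \<in> D"
proof -
  show bu: "x \<in> D \<Longrightarrow> y \<in> D \<Longrightarrow> bu x y \<in> D" for x y by (simp add: bu_def)
  show cmp: "x \<in> D \<Longrightarrow> y \<in> D \<Longrightarrow> cmp x y \<in> D" for x y by (simp add: cmp_def)
  show "x \<in> D \<Longrightarrow> neq x \<in> D" for x by (simp add: neq_def bu cmp Let_def)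
  show eqk: "x \<in> D \<Longrightarrow> eqk x \<in> D" for x by (simp add: eqk_def)
  show fstk: "x \<in> D \<Longrightarrow> fstk x \<in> D" and sndk: "x \<in> D \<Longrightarrow> sndk x \<in> D" for x
    by (simp_all add: fstk_def sndk_def eqk)
  show pull: "x \<in> D \<Longrightarrow> y \<in> D \<Longrightarrow> z \<in> D \<Longrightarrow> pull x y z \<in> D" for x y z by (simp add: pull_def cmp)
  show maxlt: "x \<in> D \<Longrightarrow> maxlt x \<in> D" for x by (simp add: maxlt_def bu pull fstk sndk Let_def)
  show maxeq: "x \<in> D \<Longrightarrow> maxeq x \<in> D" for x by (simp add: maxeq_def maxlt)
  show "x \<in> D \<Longrightarrow> ltk x \<in> D" for x by (simp add: ltk_def bu pull fstk sndk maxlt maxeq eqk)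
qed

end

context zf_model
begin

lemma mem_cmp [simp]:
  assumes "A \<in> D" "B \<in> D" "x \<in> D" "w \<in> D"
  shows "pr x w \<in> el (cmp A B) \<longleftrightarrow> (\<exists>y\<in>D. pr x y \<in> el A \<and> pr y w \<in> el B)"
proof -
  have "pr x w \<in> el (cmp A B) \<longleftrightarrow> (\<exists>y\<in>D. pr x y \<in> el A \<and> w \<in> el (dm (cv B)) \<and> pr y w \<in> el B \<and> x \<in> el (dm A))"
    unfolding cmp_def using assms by (subst el_dm) auto
  also have "\<dots> \<longleftrightarrow> (\<exists>y\<in>D. pr x y \<in> el A \<and> pr y w \<in> el B)"
    using assms by (auto simp: el_dm)
  finally show ?thesis .
qed

lemma cmp_pair: "A \<in> D \<Longrightarrow> B \<in> D \<Longrightarrow> z \<in> el (cmp A B) \<Longrightarrow> \<exists>x\<in>D. \<exists>w\<in>D. z = pr x w"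
proof -
  assume "A \<in> D" "B \<in> D" and z: "z \<in> el (cmp A B)"
  then obtain u where "u \<in> D" "pr z u \<in> el (sw (ti A (dm (cv B))))"
    unfolding cmp_def by (auto simp: el_dm)
  moreover from this obtain a b c where "a \<in> D" "b \<in> D" "c \<in> D" "pr z u = pr (pr a b) c"
    using \<open>A \<in> D\<close> \<open>B \<in> D\<close> el_sw[of "ti A (dm (cv B))"] by auto
  ultimately show ?thesis using z by (metis el_D goedel_D(2) pr_inject)
qed

lemma mem_neq:
  assumes "V \<in> D" "u \<in> el V" "v \<in> el V"
  shows "pr u v \<in> el (neq V) \<longleftrightarrow> u \<noteq> v"
proof -
  have D: "u \<in> D" "v \<in> D" using assms by blast+
  have in_un: "w \<in> el u \<Longrightarrow> w \<in> el (un V)" "w \<in> el v \<Longrightarrow> w \<in> el (un V)" for w using assms by auto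
  have "pr u v \<in> el (neq V) \<longleftrightarrow> (\<exists>w\<in>D. w \<in> el u \<and> w \<notin> el v \<or> w \<notin> el u \<and> w \<in> el v)"
    using assms D in_un by (simp add: neq_def Let_def bu_def) blast
  also have "\<dots> \<longleftrightarrow> u \<noteq> v" using el_eqI[OF D] by blast
  finally show ?thesis .
qed

text \<open>\<open>cmp (cv f) f\<close> relates any two values at a common argument, so it has to
  avoid all pairs of distinct values.\<close>

lemma single_valued_eq:
  assumes f: "f \<in> D"
  shows "single_valued f \<longleftrightarrow> it (cmp (cv f) f) (neq (dm (cv f))) = em"
proof
  have V: "v \<in> el (dm (cv f))" if "pr x v \<in> el f" "x \<in> D" "v \<in> D" for x v
    using that f by (auto simp: el_dm)
  {
    assume sv: "single_valued f"
    have "z \<notin> el (it (cmp (cv f) f) (neq (dm (cv f))))" for z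
    proof
      assume "z \<in> el (it (cmp (cv f) f) (neq (dm (cv f))))"
      then have z: "z \<in> el (cmp (cv f) f)" "z \<in> el (neq (dm (cv f)))" using f by simp_all
      then obtain x w where xw: "x \<in> D" "w \<in> D" "z = pr x w" using cmp_pair f by (metis goedel_D(9))
      then obtain y where y: "y \<in> D" "pr y x \<in> el f" "pr y w \<in> el f" using z(1) f by auto
      then have "x = w" using single_valuedD[OF sv] xw by blast
      then show False using z(2) xw mem_neq[of "dm (cv f)" x w] V y f by auto
    qed
    then show "it (cmp (cv f) f) (neq (dm (cv f))) = em"
      using f by (intro el_eqI) auto
  next
    assume *: "it (cmp (cv f) f) (neq (dm (cv f))) = em"
    show "single_valued f" unfolding single_valued_def
    proof (intro ballI impI)
      fix x y z assume x: "x \<in> D" "y \<in> D" "z \<in> D" "pr x y \<in> el f \<and> pr x z \<in> el f"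
      then have "pr y z \<in> el (cmp (cv f) f)" using f by auto
      moreover have "pr y z \<notin> el (it (cmp (cv f) f) (neq (dm (cv f))))" using * by simp
      ultimately have "pr y z \<notin> el (neq (dm (cv f)))" using f by simp
      then show "y = z" using mem_neq[of "dm (cv f)" y z] V x f by auto
    qed
  }
qed

lemma relation_eq:
  assumes f: "f \<in> D" and a: "dm f = a"
  shows "(\<forall>p\<in>el f. \<exists>x\<in>D. \<exists>y\<in>D. p = pr x y) \<longleftrightarrow> df f (ti a (dm (cv f))) = em"
proof
  have aD: "a \<in> D" using assms by auto
  have mem: "pr x y \<in> el (ti a (dm (cv f)))" if "pr x y \<in> el f" "x \<in> D" "y \<in> D" for x y
    using that f a by (auto simp: el_dm)
  {
    assume *: "\<forall>p\<in>el f. \<exists>x\<in>D. \<exists>y\<in>D. p = pr x y"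
    then have "p \<in> el (ti a (dm (cv f)))" if "p \<in> el f" for p using mem that by metis
    then have "el (df f (ti a (dm (cv f)))) = el em" using f aD by auto
    then show "df f (ti a (dm (cv f))) = em" using f aD by (intro el_eqI) auto
  next
    assume "df f (ti a (dm (cv f))) = em"
    then have "el (df f (ti a (dm (cv f)))) = {}" by simp
    then have "el f \<subseteq> el (ti a (dm (cv f)))" using f aD by auto
    then show "\<forall>p\<in>el f. \<exists>x\<in>D. \<exists>y\<in>D. p = pr x y"
      unfolding el_ti[OF aD goedel_D(8)[OF goedel_D(9)[OF f]]] by (blast dest: el_D)
  }
qed

text \<open>Compositions contain only pairs, so the equation between them is an equivalence at all
  pairs (x,w). For x outside a neither side has such a pair; for x in a they are the two sides of
  the collapse condition.\<close>

lemma collapse_eq_iff: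
  assumes f: "f \<in> D" and a: "a \<in> D" and R: "R \<in> D"
  shows "collapse_eq f a R \<longleftrightarrow> collapse f a R"
proof -
  let ?V = "dm (cv f)"
  let ?L = "cmp f (cv (ep (un ?V) ?V))"
  let ?R = "cmp (cv (it R (ti a a))) f"
  have L: "pr x w \<in> el ?L \<longleftrightarrow> (\<exists>v\<in>D. pr x v \<in> el f \<and> w \<in> el v)" if "x \<in> D" "w \<in> D" for x w
  proof -
    have "pr x w \<in> el ?L \<longleftrightarrow> (\<exists>v\<in>D. pr x v \<in> el f \<and> w \<in> el (un ?V) \<and> v \<in> el ?V \<and> w \<in> el v)"
      using that f by auto
    also have "\<dots> \<longleftrightarrow> (\<exists>v\<in>D. pr x v \<in> el f \<and> w \<in> el v)"
    proof -
      have "v \<in> el ?V" if "pr x v \<in> el f" "v \<in> D" for v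
        using that \<open>x \<in> D\<close> f by (auto simp: el_dm)
      moreover have "w \<in> el (un ?V)" if "v \<in> el ?V" "w \<in> el v" for v
        using that f el_un by auto
      ultimately show ?thesis by blast
    qed
    finally show ?thesis .
  qed
  have R': "pr x w \<in> el ?R \<longleftrightarrow> (\<exists>y\<in>D. pr y x \<in> el R \<and> y \<in> el a \<and> x \<in> el a \<and> pr y w \<in> el f)"
    if "x \<in> D" "w \<in> D" for x w
    using that f a R by auto
  have LR: "?L = ?R \<longleftrightarrow> (\<forall>x\<in>D. \<forall>w\<in>D. pr x w \<in> el ?L \<longleftrightarrow> pr x w \<in> el ?R)"
  proof
    assume *: "\<forall>x\<in>D. \<forall>w\<in>D. pr x w \<in> el ?L \<longleftrightarrow> pr x w \<in> el ?R"
    have 1: "\<exists>x\<in>D. \<exists>w\<in>D. z = pr x w" if "z \<in> el ?L" for z using that f by (intro cmp_pair) auto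
    have 2: "\<exists>x\<in>D. \<exists>w\<in>D. z = pr x w" if "z \<in> el ?R" for z using that f a R by (intro cmp_pair) auto
    have "z \<in> el ?L \<longleftrightarrow> z \<in> el ?R" for z using 1[of z] 2[of z] * by metis
    then show "?L = ?R" using f a R by (intro el_eqI) auto
  qed simp
  have "collapse_eq f a R \<longleftrightarrow> func f \<and> dm f = a \<and> ?L = ?R"
    unfolding collapse_eq_def Let_def func_def single_valued_eq[OF f]
    using relation_eq[OF f, of a] by blast
  also have "\<dots> \<longleftrightarrow> collapse f a R"
  proof (cases "func f \<and> dm f = a")
    case True
    then have sv: "single_valued f" and dom: "dm f = a" unfolding func_def by blast+
    have dom': "x \<in> el a \<longleftrightarrow> (\<exists>v\<in>D. pr x v \<in> el f)" if "x \<in> D" for x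
      using that el_dm[OF f] dom by auto
    have "?L = ?R \<longleftrightarrow> (\<forall>x\<in>el a. \<forall>v\<in>D. pr x v \<in> el f \<longrightarrow>
        (\<forall>w\<in>D. w \<in> el v \<longleftrightarrow> (\<exists>y\<in>el a. pr y x \<in> el R \<and> pr y w \<in> el f)))"
    proof
      assume eq: "?L = ?R"
      show "\<forall>x\<in>el a. \<forall>v\<in>D. pr x v \<in> el f \<longrightarrow>
        (\<forall>w\<in>D. w \<in> el v \<longleftrightarrow> (\<exists>y\<in>el a. pr y x \<in> el R \<and> pr y w \<in> el f))"
      proof (intro ballI impI)
        fix x v w assume x: "x \<in> el a" and v: "v \<in> D" "pr x v \<in> el f" and w: "w \<in> D"
        have xD: "x \<in> D" using x by blast
        have "w \<in> el v \<longleftrightarrow> pr x w \<in> el ?L"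
          using L[OF xD w] v single_valuedD[OF sv _ _ xD] by blast
        also have "\<dots> \<longleftrightarrow> (\<exists>y\<in>el a. pr y x \<in> el R \<and> pr y w \<in> el f)"
          using R'[OF xD w] eq x by (auto dest: el_D)
        finally show "w \<in> el v \<longleftrightarrow> (\<exists>y\<in>el a. pr y x \<in> el R \<and> pr y w \<in> el f)" .
      qed
    next
      assume *: "\<forall>x\<in>el a. \<forall>v\<in>D. pr x v \<in> el f \<longrightarrow>
        (\<forall>w\<in>D. w \<in> el v \<longleftrightarrow> (\<exists>y\<in>el a. pr y x \<in> el R \<and> pr y w \<in> el f))"
      show "?L = ?R" unfolding LR
      proof (intro ballI)
        fix x w assume x: "x \<in> D" and w: "w \<in> D"
        show "pr x w \<in> el ?L \<longleftrightarrow> pr x w \<in> el ?R"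
        proof (cases "x \<in> el a")
          case True
          then obtain v where v: "v \<in> D" "pr x v \<in> el f" using dom'[OF x] by blast
          have "pr x w \<in> el ?L \<longleftrightarrow> w \<in> el v"
            using L[OF x w] v single_valuedD[OF sv _ _ x] by blast
          also have "\<dots> \<longleftrightarrow> (\<exists>y\<in>el a. pr y x \<in> el R \<and> pr y w \<in> el f)" using * True v w by blast
          finally show ?thesis using R'[OF x w] True by blast
        next
          case False
          then show ?thesis using L[OF x w] R'[OF x w] dom'[OF x] by blast
        qed
      qed
    qed
    then show ?thesis using True unfolding collapse_def by blast
  qed (auto simp: collapse_def)
  finally show ?thesis .
qed

end

section \<open>Goedel's well-order of pairs as a term\<close>

context zf_model
begin

lemma bu_max:
  assumes "ordinal a" "ordinal b" "a \<in> D" "b \<in> D"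
  shows "bu a b = a \<and> (b \<in> el a \<or> b = a) \<or> bu a b = b \<and> (a \<in> el b \<or> a = b)"
proof -
  have "el (bu a b) = el a \<union> el b" using assms by simp
  moreover consider "el b \<subseteq> el a" "b \<in> el a \<or> b = a" | "el a \<subseteq> el b" "a \<in> el b \<or> a = b"
    using ordinal_linear[OF assms] ordinal_trans[OF assms(1)] ordinal_trans[OF assms(2)] by blast
  ultimately show ?thesis using el_eqI[of "bu a b" a] el_eqI[of "bu a b" b] assms by (metis bu_D sup.absorb1 sup.absorb2)
qed

lemma mem_eqk:
  assumes "ordinal \<kappa>" "\<kappa> \<in> D" "a \<in> D" "b \<in> D"
  shows "pr a b \<in> el (eqk \<kappa>) \<longleftrightarrow> a \<in> el \<kappa> \<and> a = b"
proof -
  have "pr a b \<in> el (eqk \<kappa>) \<longleftrightarrow> a \<in> el \<kappa> \<and> b \<in> el \<kappa> \<and> a \<notin> el b \<and> b \<notin> el a"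
    using assms by (auto simp: eqk_def)
  then show ?thesis using assms(1) mem_irrefl unfolding ordinal_def by blast
qed

lemma mem_fstk:
  assumes "ordinal \<kappa>" "\<kappa> \<in> D" "a \<in> D" "b \<in> D" "c \<in> D"
  shows "pr (pr a b) c \<in> el (fstk \<kappa>) \<longleftrightarrow> a \<in> el \<kappa> \<and> b \<in> el \<kappa> \<and> a = c"
  using assms mem_eqk by (auto simp: fstk_def)

lemma mem_sndk:
  assumes "ordinal \<kappa>" "\<kappa> \<in> D" "a \<in> D" "b \<in> D" "c \<in> D"
  shows "pr (pr a b) c \<in> el (sndk \<kappa>) \<longleftrightarrow> a \<in> el \<kappa> \<and> b \<in> el \<kappa> \<and> b = c"
  using assms mem_eqk by (auto simp: sndk_def)

lemma mem_pull:
  assumes "p \<in> D" "r \<in> D" "q \<in> D" "x \<in> D" "y \<in> D"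
  shows "pr x y \<in> el (pull p r q) \<longleftrightarrow> (\<exists>u\<in>D. \<exists>v\<in>D. pr x u \<in> el p \<and> pr u v \<in> el r \<and> pr y v \<in> el q)"
  using assms by (auto simp: pull_def)

lemma mem_pull_proj:
  assumes \<kappa>: "ordinal \<kappa>" "\<kappa> \<in> D" and r: "r \<in> D"
    and abcd: "a \<in> el \<kappa>" "b \<in> el \<kappa>" "c \<in> el \<kappa>" "d \<in> el \<kappa>"
  shows "pr (pr a b) (pr c d) \<in> el (pull (fstk \<kappa>) r (fstk \<kappa>)) \<longleftrightarrow> pr a c \<in> el r"
    and "pr (pr a b) (pr c d) \<in> el (pull (fstk \<kappa>) r (sndk \<kappa>)) \<longleftrightarrow> pr a d \<in> el r"
    and "pr (pr a b) (pr c d) \<in> el (pull (sndk \<kappa>) r (fstk \<kappa>)) \<longleftrightarrow> pr b c \<in> el r"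
    and "pr (pr a b) (pr c d) \<in> el (pull (sndk \<kappa>) r (sndk \<kappa>)) \<longleftrightarrow> pr b d \<in> el r"
proof -
  have D: "a \<in> D" "b \<in> D" "c \<in> D" "d \<in> D" using abcd by blast+
  note [simp] = mem_fstk[OF \<kappa>] mem_sndk[OF \<kappa>]
  have f: "pr (pr x y) u \<in> el (fstk \<kappa>) \<longleftrightarrow> u = x" and s: "pr (pr x y) u \<in> el (sndk \<kappa>) \<longleftrightarrow> u = y"
    if "x \<in> el \<kappa>" "y \<in> el \<kappa>" "u \<in> D" for x y u
    using that mem_fstk[OF \<kappa> el_D[OF that(1)] el_D[OF that(2)] that(3)]
      mem_sndk[OF \<kappa> el_D[OF that(1)] el_D[OF that(2)] that(3)] by blast+
  show "pr (pr a b) (pr c d) \<in> el (pull (fstk \<kappa>) r (fstk \<kappa>)) \<longleftrightarrow> pr a c \<in> el r"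
    "pr (pr a b) (pr c d) \<in> el (pull (fstk \<kappa>) r (sndk \<kappa>)) \<longleftrightarrow> pr a d \<in> el r"
    "pr (pr a b) (pr c d) \<in> el (pull (sndk \<kappa>) r (fstk \<kappa>)) \<longleftrightarrow> pr b c \<in> el r"
    "pr (pr a b) (pr c d) \<in> el (pull (sndk \<kappa>) r (sndk \<kappa>)) \<longleftrightarrow> pr b d \<in> el r"
    by (subst mem_pull; use D \<kappa> r f[OF abcd(1,2)] f[OF abcd(3,4)] s[OF abcd(1,2)] s[OF abcd(3,4)] in \<open>simp; blast\<close>)+
qed

lemma maxlt_iff:
  assumes \<kappa>: "ordinal \<kappa>" "\<kappa> \<in> D" and abcd: "a \<in> el \<kappa>" "b \<in> el \<kappa>" "c \<in> el \<kappa>" "d \<in> el \<kappa>"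
  shows "pr (pr a b) (pr c d) \<in> el (maxlt \<kappa>) \<longleftrightarrow> bu a b \<in> el (bu c d)"
proof -
  have D: "a \<in> D" "b \<in> D" "c \<in> D" "d \<in> D" using abcd by blast+
  have o: "ordinal a" "ordinal b" "ordinal c" "ordinal d" using abcd ordinal_mem[OF \<kappa>(1)] by blast+
  have ep: "pr x y \<in> el (ep \<kappa> \<kappa>) \<longleftrightarrow> x \<in> el y" if "x \<in> el \<kappa>" "y \<in> el \<kappa>" for x y
    using that \<kappa>(2) el_D by auto
  have "pr (pr a b) (pr c d) \<in> el (maxlt \<kappa>) \<longleftrightarrow> (a \<in> el c \<or> a \<in> el d) \<and> (b \<in> el c \<or> b \<in> el d)"
    unfolding maxlt_def Let_def using mem_pull_proj[OF \<kappa> _ abcd, of "ep \<kappa> \<kappa>"] ep abcd \<kappa>(2) by simp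
  also have "\<dots> \<longleftrightarrow> bu a b \<in> el (bu c d)"
  proof -
    have m: "bu a b \<in> el x \<longleftrightarrow> a \<in> el x \<and> b \<in> el x" if "x = c \<or> x = d" for x
    proof -
      have "ordinal x" using that o by blast
      then show ?thesis using bu_max[OF o(1,2) D(1,2)] ordinal_trans by metis
    qed
    have cd: "bu c d = c \<and> el d \<subseteq> el c \<or> bu c d = d \<and> el c \<subseteq> el d"
      using bu_max[OF o(3,4) D(3,4)] ordinal_trans[OF o(3)] ordinal_trans[OF o(4)] by blast
    have "bu a b \<in> el (bu c d) \<longleftrightarrow> bu a b \<in> el c \<or> bu a b \<in> el d" using D by simp
    then show ?thesis using m cd by blast
  qed
  finally show ?thesis .
qed

lemma mem_ltk:
  assumes \<kappa>: "ordinal \<kappa>" "\<kappa> \<in> D" and abcd: "a \<in> el \<kappa>" "b \<in> el \<kappa>" "c \<in> el \<kappa>" "d \<in> el \<kappa>"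
  shows "pr (pr a b) (pr c d) \<in> el (ltk \<kappa>) \<longleftrightarrow> goedel_less a b c d"
proof -
  have D: "a \<in> D" "b \<in> D" "c \<in> D" "d \<in> D" using abcd by blast+
  have o: "ordinal a" "ordinal b" "ordinal c" "ordinal d" using abcd ordinal_mem[OF \<kappa>(1)] by blast+
  have ep: "pr x y \<in> el (ep \<kappa> \<kappa>) \<longleftrightarrow> x \<in> el y" if "x \<in> el \<kappa>" "y \<in> el \<kappa>" for x y
    using that \<kappa>(2) el_D by auto
  have "ordinal (bu a b)" "ordinal (bu c d)" using bu_max[OF o(1,2) D(1,2)] bu_max[OF o(3,4) D(3,4)] o by metis+
  \<comment> \<open>The maxima are ordinals again, so equality is incomparability, which is how
    \<open>maxeq\<close> is built from \<open>maxlt\<close>.\<close>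
  then have "bu a b = bu c d \<longleftrightarrow> \<not> bu a b \<in> el (bu c d) \<and> \<not> bu c d \<in> el (bu a b)"
    using ordinal_linear[of "bu a b" "bu c d"] mem_irrefl bu_D[OF D(1,2)] bu_D[OF D(3,4)] by metis
  then have "pr (pr a b) (pr c d) \<in> el (maxeq \<kappa>) \<longleftrightarrow> bu a b = bu c d"
    unfolding maxeq_def using maxlt_iff[OF \<kappa> abcd] maxlt_iff[OF \<kappa> abcd(3,4,1,2)] abcd \<kappa>(2) D by simp
  then show ?thesis
    unfolding ltk_def goedel_less_def
    using mem_pull_proj[OF \<kappa> _ abcd, of "ep \<kappa> \<kappa>"] mem_pull_proj(1)[OF \<kappa> _ abcd, of "eqk \<kappa>"] ep abcd \<kappa> D
      maxlt_iff[OF \<kappa> abcd] mem_eqk[OF \<kappa> D(1,3)] by simp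
qed

lemma pairs_el: "\<kappa> \<in> D \<Longrightarrow> p \<in> el (ti \<kappa> \<kappa>) \<Longrightarrow> \<exists>a\<in>el \<kappa>. \<exists>b\<in>el \<kappa>. p = pr a b"
  using el_ti by blast

lemma bu_mem: "ordinal \<kappa> \<Longrightarrow> \<kappa> \<in> D \<Longrightarrow> a \<in> el \<kappa> \<Longrightarrow> b \<in> el \<kappa> \<Longrightarrow> bu a b \<in> el \<kappa> \<and> ordinal (bu a b)"
  using bu_max[of a b] ordinal_mem by (metis el_D)

lemma linear_ltk:
  assumes \<kappa>: "ordinal \<kappa>" "\<kappa> \<in> D"
  shows "linear (ti \<kappa> \<kappa>) (ltk \<kappa>)"
  unfolding linear_def
proof (intro conjI ballI impI)
  note K = pairs_el[OF \<kappa>(2)]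
  have tr: "x \<in> el y \<Longrightarrow> y \<in> el z \<Longrightarrow> x \<in> el z" if "z \<in> el \<kappa>" for x y z
    using ordinal_trans[OF ordinal_mem[OF \<kappa>(1) that]] .
  fix p q r assume pqr: "p \<in> el (ti \<kappa> \<kappa>)" "q \<in> el (ti \<kappa> \<kappa>)" "r \<in> el (ti \<kappa> \<kappa>)"
    and less: "pr p q \<in> el (ltk \<kappa>)" "pr q r \<in> el (ltk \<kappa>)"
  obtain a b where ab: "a \<in> el \<kappa>" "b \<in> el \<kappa>" "p = pr a b" using K[OF pqr(1)] by blast
  obtain c d where cd: "c \<in> el \<kappa>" "d \<in> el \<kappa>" "q = pr c d" using K[OF pqr(2)] by blast
  obtain e f where ef: "e \<in> el \<kappa>" "f \<in> el \<kappa>" "r = pr e f" using K[OF pqr(3)] by blast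
  note abc = ab(1,2) cd(1,2) ef(1,2) ab(3) cd(3) ef(3)
  have "goedel_less a b c d" "goedel_less c d e f"
    using less mem_ltk[OF \<kappa> abc(1-4)] mem_ltk[OF \<kappa> abc(3-6)] abc by blast+
  then have "goedel_less a b e f"
    unfolding goedel_less_def
    using tr[of "bu e f" "bu a b" "bu c d"] tr[OF abc(5), of a c] tr[OF abc(6), of b d] bu_mem[OF \<kappa> abc(5,6)]
    by metis
  then show "pr p r \<in> el (ltk \<kappa>)" using mem_ltk[OF \<kappa> abc(1,2,5,6)] abc by blast
next
  fix p q assume pq: "p \<in> el (ti \<kappa> \<kappa>)" "q \<in> el (ti \<kappa> \<kappa>)"
  obtain a b where ab: "a \<in> el \<kappa>" "b \<in> el \<kappa>" "p = pr a b" using pairs_el[OF \<kappa>(2) pq(1)] by blast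
  obtain c d where cd: "c \<in> el \<kappa>" "d \<in> el \<kappa>" "q = pr c d" using pairs_el[OF \<kappa>(2) pq(2)] by blast
  note abc = ab(1,2) cd(1,2) ab(3) cd(3)
  have lin: "x \<in> el y \<or> x = y \<or> y \<in> el x" if "x \<in> el \<kappa>" "y \<in> el \<kappa>" for x y
    using that \<kappa>(1) unfolding ordinal_def by blast
  have "goedel_less a b c d \<or> a = c \<and> b = d \<or> goedel_less c d a b"
    unfolding goedel_less_def
    using lin[of "bu a b" "bu c d"] lin[OF abc(1,3)] lin[OF abc(2,4)] bu_mem[OF \<kappa> abc(1,2)] bu_mem[OF \<kappa> abc(3,4)]
    by metis
  then show "pr p q \<in> el (ltk \<kappa>) \<or> p = q \<or> pr q p \<in> el (ltk \<kappa>)"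
    using mem_ltk[OF \<kappa> abc(1-4)] mem_ltk[OF \<kappa> abc(3,4,1,2)] abc by blast
qed

text \<open>Minimise in turn the maximum of a pair, the first coordinate among the pairs with this
  maximum, and the second coordinate among those that share both.\<close>

lemma wellfounded_ltk:
  assumes \<kappa>: "ordinal \<kappa>" "\<kappa> \<in> D"
  shows "wellfounded (ti \<kappa> \<kappa>) (ltk \<kappa>)"
  unfolding wellfounded_def
proof (intro ballI impI)
  fix X assume X: "X \<in> D" "el X \<subseteq> el (ti \<kappa> \<kappa>)" "el X \<noteq> {}"
  then obtain p where "p \<in> el X" by blast
  then obtain a0 b0 where ab0: "a0 \<in> el \<kappa>" "b0 \<in> el \<kappa>" "pr a0 b0 \<in> el X"
    using pairs_el[OF \<kappa>(2)] X(2) by blast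
  let ?P = "\<lambda>m. \<exists>a\<in>el \<kappa>. \<exists>b\<in>el \<kappa>. pr a b \<in> el X \<and> bu a b = m"
  have "\<exists>m\<in>el \<kappa>. ?P m \<and> (\<forall>y\<in>el \<kappa>. y \<in> el m \<longrightarrow> \<not> ?P y)"
    by (rule ordinal_least[OF \<kappa>(2) _ conjunct1[OF bu_mem[OF \<kappa> ab0(1,2)]]])
      (use X(1) \<kappa>(2) ab0 in \<open>auto intro!: definable_intros definable_tm_bu\<close>)
  then obtain m where m: "m \<in> el \<kappa>" "?P m" "\<And>y. y \<in> el \<kappa> \<Longrightarrow> y \<in> el m \<Longrightarrow> \<not> ?P y" by blast
  then obtain a1 b1 where ab1: "a1 \<in> el \<kappa>" "b1 \<in> el \<kappa>" "pr a1 b1 \<in> el X" "bu a1 b1 = m" by blast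
  let ?Q = "\<lambda>a. \<exists>b\<in>el \<kappa>. pr a b \<in> el X \<and> bu a b = m"
  have "\<exists>a\<in>el \<kappa>. ?Q a \<and> (\<forall>y\<in>el \<kappa>. y \<in> el a \<longrightarrow> \<not> ?Q y)"
    by (rule ordinal_least[OF \<kappa>(2) _ ab1(1)])
      (use X(1) \<kappa>(2) ab1 m(1) in \<open>auto intro!: definable_intros definable_tm_bu\<close>)
  then obtain a where a: "a \<in> el \<kappa>" "?Q a" "\<And>y. y \<in> el \<kappa> \<Longrightarrow> y \<in> el a \<Longrightarrow> \<not> ?Q y" by blast
  then obtain b1 where b1: "b1 \<in> el \<kappa>" "pr a b1 \<in> el X" "bu a b1 = m" by blast
  let ?R = "\<lambda>b. pr a b \<in> el X \<and> bu a b = m"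
  have "\<exists>b\<in>el \<kappa>. ?R b \<and> (\<forall>y\<in>el \<kappa>. y \<in> el b \<longrightarrow> \<not> ?R y)"
    by (rule ordinal_least[OF \<kappa>(2) _ b1(1)])
      (use X(1) \<kappa>(2) b1 m(1) a(1) in \<open>auto intro!: definable_intros definable_tm_bu\<close>)
  then obtain b where b: "b \<in> el \<kappa>" "pr a b \<in> el X" "bu a b = m" "\<And>y. y \<in> el \<kappa> \<Longrightarrow> y \<in> el b \<Longrightarrow> \<not> ?R y"
    by blast
  have "pr q (pr a b) \<notin> el (ltk \<kappa>)" if q: "q \<in> el X" for q
  proof
    assume less: "pr q (pr a b) \<in> el (ltk \<kappa>)"
    obtain c d where cd: "c \<in> el \<kappa>" "d \<in> el \<kappa>" "q = pr c d" using pairs_el[OF \<kappa>(2)] X(2) q by blast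
    then have gl: "goedel_less c d a b" using less mem_ltk[OF \<kappa> cd(1,2) a(1) b(1)] by simp
    have "bu c d \<notin> el m" using m(3)[of "bu c d"] bu_mem[OF \<kappa> cd(1,2)] cd q by blast
    then show False using gl b a(3)[OF cd(1)] cd q unfolding goedel_less_def by blast
  qed
  then show "\<exists>m\<in>el X. \<forall>b\<in>el X. pr b m \<notin> el (ltk \<kappa>)" using b(2) by blast
qed

end

section \<open>Covers and the range of the pairing function\<close>

context set_structure
begin

text \<open>An internal form of finiteness: every function has bounded values in \<omega> on X. It
  passes from n to n \<times> n by combining bounds, without any arithmetic.\<close>

definition bounded :: "'u \<Rightarrow> bool" where
  "bounded X \<longleftrightarrow> (\<forall>f\<in>D. single_valued f \<longrightarrow>
     (\<exists>k\<in>el om. \<forall>m\<in>el X. \<forall>v\<in>el om. pr m v \<in> el f \<longrightarrow> v \<in> el k))"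

end

context zf_model
begin

lemma covI: "f \<in> D \<Longrightarrow> single_valued f \<Longrightarrow> (\<And>a. a \<in> el A \<Longrightarrow> \<exists>b\<in>el B. pr b a \<in> el f) \<Longrightarrow> cov A B"
  unfolding cov_def by blast

lemma cov_subset:
  assumes "A \<in> D" "B \<in> D" "el A \<subseteq> el B"
  shows "cov A B"
proof -
  have "\<exists>f\<in>D. el f = {p \<in> el (ti A A). \<exists>x\<in>D. p = pr x x}"
    by (rule separation) (use assms in \<open>auto intro!: definable_intros\<close>)
  then obtain f where f: "f \<in> D" "el f = {p \<in> el (ti A A). \<exists>x\<in>D. p = pr x x}" by blast
  have mem: "pr x y \<in> el f \<longleftrightarrow> x \<in> el A \<and> x = y" if "x \<in> D" "y \<in> D" for x y
    unfolding f(2) using that assms by auto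
  show ?thesis
  proof (rule covI[OF f(1)])
    show "single_valued f" unfolding single_valued_def using mem by blast
    show "\<exists>b\<in>el B. pr b a \<in> el f" if "a \<in> el A" for a using mem[of a a] that assms(3) by blast
  qed
qed

lemma cov_trans:
  assumes "cov A B" "cov B C"
  shows "cov A C"
proof -
  obtain f where f: "f \<in> D" "single_valued f" "\<And>a. a \<in> el A \<Longrightarrow> \<exists>b\<in>el B. pr b a \<in> el f"
    using assms(1) unfolding cov_def by blast
  obtain g where g: "g \<in> D" "single_valued g" "\<And>b. b \<in> el B \<Longrightarrow> \<exists>c\<in>el C. pr c b \<in> el g"
    using assms(2) unfolding cov_def by blast
  have mem: "pr x w \<in> el (cmp g f) \<longleftrightarrow> (\<exists>y\<in>D. pr x y \<in> el g \<and> pr y w \<in> el f)" if "x \<in> D" "w \<in> D" for x w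
    using that f g by simp
  show ?thesis
  proof (rule covI[of "cmp g f"])
    show "single_valued (cmp g f)" unfolding single_valued_def
    proof (intro ballI impI)
      fix x y z assume x: "x \<in> D" "y \<in> D" "z \<in> D" "pr x y \<in> el (cmp g f) \<and> pr x z \<in> el (cmp g f)"
      obtain u where u: "u \<in> D" "pr x u \<in> el g" "pr u y \<in> el f" using mem[OF x(1,2)] x(4) by blast
      obtain w where w: "w \<in> D" "pr x w \<in> el g" "pr w z \<in> el f" using mem[OF x(1,3)] x(4) by blast
      have "u = w" using single_valuedD[OF g(2) u(2) w(2) x(1) u(1) w(1)] .
      then show "y = z" using single_valuedD[OF f(2) u(3)] w u x by blast
    qed
    show "\<exists>c\<in>el C. pr c a \<in> el (cmp g f)" if a: "a \<in> el A" for a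
    proof -
      obtain b where b: "b \<in> el B" "pr b a \<in> el f" using f(3)[OF a] by blast
      obtain c where c: "c \<in> el C" "pr c b \<in> el g" using g(3)[OF b(1)] by blast
      show ?thesis using mem[OF el_D[OF c(1)] el_D[OF a]] b c by blast
    qed
  qed (simp add: f g)
qed

lemma cov_times:
  assumes "cov A B" "A \<in> D" "B \<in> D"
  shows "cov (ti A A) (ti B B)"
proof -
  obtain f where f: "f \<in> D" "single_valued f" "\<And>a. a \<in> el A \<Longrightarrow> \<exists>b\<in>el B. pr b a \<in> el f"
    using assms(1) unfolding cov_def by blast
  have "\<exists>h\<in>D. el h = {p \<in> el (ti (ti B B) (ti A A)). \<exists>b\<in>D. \<exists>b'\<in>D. \<exists>a\<in>D. \<exists>a'\<in>D.
      p = pr (pr b b') (pr a a') \<and> pr b a \<in> el f \<and> pr b' a' \<in> el f}"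
    by (rule separation) (use assms(2,3) f(1) in \<open>auto intro!: definable_intros\<close>)
  then obtain h where h: "h \<in> D" "el h = {p \<in> el (ti (ti B B) (ti A A)). \<exists>b\<in>D. \<exists>b'\<in>D. \<exists>a\<in>D. \<exists>a'\<in>D.
      p = pr (pr b b') (pr a a') \<and> pr b a \<in> el f \<and> pr b' a' \<in> el f}" by blast
  show ?thesis
  proof (rule covI[OF h(1)])
    show "single_valued h" unfolding single_valued_def
    proof (intro ballI impI)
      fix x y z assume x: "x \<in> D" "y \<in> D" "z \<in> D" "pr x y \<in> el h \<and> pr x z \<in> el h"
      obtain b b' a a' where 1: "b \<in> D" "b' \<in> D" "a \<in> D" "a' \<in> D" "pr x y = pr (pr b b') (pr a a')"
        "pr b a \<in> el f" "pr b' a' \<in> el f" using x(4) unfolding h(2) by blast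
      obtain c c' d d' where 2: "c \<in> D" "c' \<in> D" "d \<in> D" "d' \<in> D" "pr x z = pr (pr c c') (pr d d')"
        "pr c d \<in> el f" "pr c' d' \<in> el f" using x(4) unfolding h(2) by blast
      have "x = pr b b'" "y = pr a a'" "x = pr c c'" "z = pr d d'" using x 1 2 by auto
      moreover from this have "b = c" "b' = c'" using 1 2 by auto
      ultimately show "y = z" using single_valuedD[OF f(2)] 1 2 by metis
    qed
    show "\<exists>b\<in>el (ti B B). pr b p \<in> el h" if p: "p \<in> el (ti A A)" for p
    proof -
      obtain a a' where a: "a \<in> el A" "a' \<in> el A" "p = pr a a'" using pairs_el[OF assms(2) p] by blast
      obtain b where b: "b \<in> el B" "pr b a \<in> el f" using f(3)[OF a(1)] by blast
      obtain b' where b': "b' \<in> el B" "pr b' a' \<in> el f" using f(3)[OF a(2)] by blast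
      have D: "a \<in> D" "a' \<in> D" "b \<in> D" "b' \<in> D" using a b b' by blast+
      have "pr (pr b b') p \<in> el h" unfolding h(2) using D a b b' assms(2,3) by auto
      moreover have "pr b b' \<in> el (ti B B)" using D b b' assms(3) by simp
      ultimately show ?thesis by blast
    qed
  qed
qed

lemma omega: "ordinal om" "el om \<noteq> {}" "n \<in> el om \<Longrightarrow> \<exists>m\<in>el om. n \<in> el m"
  using omega_limit el_eqI[of om em] unfolding limit_ordinal_def by auto

lemma omega_bound: "k \<in> el om \<Longrightarrow> v \<in> el om \<Longrightarrow> \<exists>m\<in>el om. k \<in> el m \<and> v \<in> el m"
proof -
  assume kv: "k \<in> el om" "v \<in> el om"
  then have "k \<in> el v \<or> k = v \<or> v \<in> el k" using omega(1) unfolding ordinal_def by blast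
  moreover obtain m m' where "m \<in> el om" "k \<in> el m" "m' \<in> el om" "v \<in> el m'" using omega(3) kv by blast
  ultimately show ?thesis using ordinal_trans ordinal_mem[OF omega(1)] by metis
qed

text \<open>A least counterexample is not a limit ordinal, so it is empty or has a greatest element
  l. In the second case a bound for l only has to be enlarged by the one value at l.\<close>

lemma bounded_omega: "n \<in> el om \<Longrightarrow> bounded n"
proof (rule ccontr)
  assume n: "n \<in> el om" "\<not> bounded n"
  have "\<exists>m\<in>el om. \<not> bounded m \<and> (\<forall>y\<in>el om. y \<in> el m \<longrightarrow> \<not> \<not> bounded y)"
    by (rule ordinal_least[OF _ _ n(1)])
      (use n in \<open>auto simp: bounded_def single_valued_def intro!: definable_intros\<close>)
  then obtain m where m: "m \<in> el om" "\<not> bounded m" "\<And>y. y \<in> el om \<Longrightarrow> y \<in> el m \<Longrightarrow> bounded y" by blast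
  have om: "ordinal m" using m(1) ordinal_mem[OF omega(1)] by blast
  have "bounded m"
  proof (cases "m = em")
    case True
    then show ?thesis unfolding bounded_def using omega(2) by auto
  next
    case False
    then obtain l where l: "l \<in> el m" "\<And>z. z \<in> el m \<Longrightarrow> l \<notin> el z"
      using om omega_least[OF m(1)] unfolding limit_ordinal_def by blast
    have lom: "l \<in> el om" using ordinal_trans[OF omega(1) m(1) l(1)] .
    show ?thesis unfolding bounded_def
    proof (intro ballI impI)
      fix f assume f: "f \<in> D" "single_valued f"
      obtain k where k: "k \<in> el om" "\<forall>j\<in>el l. \<forall>v\<in>el om. pr j v \<in> el f \<longrightarrow> v \<in> el k"
        using m(3)[OF lom l(1)] f unfolding bounded_def by blast
      \<comment> \<open>If there is no value in \<omega> at \<open>l\<close>, any natural number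
        will do, and \<open>k\<close> is one at hand.\<close>
      obtain v where v: "v \<in> el om" "\<forall>u\<in>el om. pr l u \<in> el f \<longrightarrow> u = v"
      proof (cases "\<exists>u\<in>el om. pr l u \<in> el f")
        case True
        then obtain u where u: "u \<in> el om" "pr l u \<in> el f" by blast
        then have "\<forall>u'\<in>el om. pr l u' \<in> el f \<longrightarrow> u' = u"
          using single_valuedD[OF f(2)] l(1) by blast
        then show ?thesis using that u(1) by blast
      next
        case False
        then show ?thesis using that k(1) by blast
      qed
      obtain k' where k': "k' \<in> el om" "k \<in> el k'" "v \<in> el k'" using omega_bound k(1) v(1) by blast
      have ok': "ordinal k'" using k'(1) ordinal_mem[OF omega(1)] by blast
      have "u \<in> el k'" if j: "j \<in> el m" "u \<in> el om" "pr j u \<in> el f" for j u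
      proof -
        have "j \<in> el l \<or> j = l" using j(1) l om unfolding ordinal_def by blast
        then show ?thesis using k(2) v(2) k' j ordinal_trans[OF ok'] by blast
      qed
      then show "\<exists>k\<in>el om. \<forall>j\<in>el m. \<forall>v\<in>el om. pr j v \<in> el f \<longrightarrow> v \<in> el k" using k'(1) by blast
    qed
  qed
  then show False using m(2) by blast
qed

text \<open>Each row has a bound; collection turns these bounds into a function on n, whose values
  are bounded in turn.\<close>

lemma bounded_times: "n \<in> el om \<Longrightarrow> bounded (ti n n)"
  unfolding bounded_def
proof (intro ballI impI)
  fix f assume n: "n \<in> el om" and f: "f \<in> D" "single_valued f"
  have nD: "n \<in> D" using n by blast
  let ?Q = "\<lambda>a k. k \<in> el om \<and> (\<forall>b\<in>el n. \<forall>v\<in>el om. pr (pr a b) v \<in> el f \<longrightarrow> v \<in> el k)"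
  have "\<exists>k\<in>D. ?Q a k" if a: "a \<in> el n" for a
  proof -
    have aD: "a \<in> D" using a by blast
    have "\<exists>h\<in>D. el h = {p \<in> el (ti n om). \<exists>b\<in>D. \<exists>v\<in>D. p = pr b v \<and> pr (pr a b) v \<in> el f}"
      by (rule separation) (use nD f(1) aD in \<open>auto intro!: definable_intros\<close>)
    then obtain h where h: "h \<in> D"
      "el h = {p \<in> el (ti n om). \<exists>b\<in>D. \<exists>v\<in>D. p = pr b v \<and> pr (pr a b) v \<in> el f}" by blast
    have mem: "pr b v \<in> el h \<longleftrightarrow> b \<in> el n \<and> v \<in> el om \<and> pr (pr a b) v \<in> el f" if "b \<in> D" "v \<in> D" for b v
      unfolding h(2) using that nD by auto
    have "single_valued h" unfolding single_valued_def
    proof (intro ballI impI)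
      fix b v w assume b: "b \<in> D" "v \<in> D" "w \<in> D" "pr b v \<in> el h \<and> pr b w \<in> el h"
      then have "pr (pr a b) v \<in> el f" "pr (pr a b) w \<in> el f" using mem by simp_all
      then show "v = w" by (rule single_valuedD[OF f(2)]) (simp_all add: b aD)
    qed
    then obtain k where "k \<in> el om" "\<forall>b\<in>el n. \<forall>v\<in>el om. pr b v \<in> el h \<longrightarrow> v \<in> el k"
      using bounded_omega[OF n] h(1) unfolding bounded_def by blast
    then have "?Q a k" using mem nD el_D by metis
    then show ?thesis by blast
  qed
  then have "\<exists>F\<in>D. func F \<and> dm F = n \<and> (\<forall>a\<in>el n. \<exists>k\<in>D. pr a k \<in> el F \<and> ?Q a k)"
    by (intro collection'[OF nD]) (use nD f(1) in \<open>auto intro!: definable_intros\<close>)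
  then obtain F where F: "F \<in> D" "func F" "\<And>a. a \<in> el n \<Longrightarrow> \<exists>k\<in>D. pr a k \<in> el F \<and> ?Q a k" by blast
  obtain k where k: "k \<in> el om" "\<forall>a\<in>el n. \<forall>v\<in>el om. pr a v \<in> el F \<longrightarrow> v \<in> el k"
    using bounded_omega[OF n] F(1,2) unfolding bounded_def func_def by blast
  have ok: "ordinal k" using k(1) ordinal_mem[OF omega(1)] by blast
  have "v \<in> el k" if "p \<in> el (ti n n)" "v \<in> el om" "pr p v \<in> el f" for p v
  proof -
    obtain a b where ab: "a \<in> el n" "b \<in> el n" "p = pr a b" using pairs_el[OF nD] \<open>p \<in> el (ti n n)\<close> by blast
    obtain j where "pr a j \<in> el F" "?Q a j" using F(3)[OF ab(1)] by blast
    then show ?thesis using k(2) ab that ordinal_trans[OF ok] by blast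
  qed
  then show "\<exists>k\<in>el om. \<forall>p\<in>el (ti n n). \<forall>v\<in>el om. pr p v \<in> el f \<longrightarrow> v \<in> el k" using k(1) by blast
qed

text \<open>The bound k would itself be a value of the cover, giving k \<in> k.\<close>

lemma bounded_not_cov: "bounded X \<Longrightarrow> \<not> cov om X"
proof
  assume b: "bounded X" and "cov om X"
  then obtain f where f: "f \<in> D" "single_valued f" "\<And>v. v \<in> el om \<Longrightarrow> \<exists>m\<in>el X. pr m v \<in> el f"
    unfolding cov_def by blast
  obtain k where k: "k \<in> el om" "\<forall>m\<in>el X. \<forall>v\<in>el om. pr m v \<in> el f \<longrightarrow> v \<in> el k"
    using b f unfolding bounded_def by blast
  then show False using f(3) mem_irrefl by blast
qed

lemma infinite_not_mem: "ordinal \<nu> \<Longrightarrow> \<nu> \<in> D \<Longrightarrow> el om \<subseteq> el \<nu> \<longleftrightarrow> \<nu> \<notin> el om"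
  using ordinal_subset[OF omega(1), of \<nu>] ordinal_linear[OF omega(1), of \<nu>] mem_asym mem_irrefl
  by (metis goedel_D(13))

text \<open>Two distinct natural numbers n and m serve as labels: (a,n) is sent to a, and (a,m) to
  the additional element \<mu>.\<close>

lemma cov_succ:
  assumes \<mu>: "ordinal \<mu>" "\<mu> \<in> D" "el om \<subseteq> el \<mu>"
  shows "cov (bu \<mu> (up \<mu> \<mu>)) (ti \<mu> \<mu>)"
proof -
  obtain n where n: "n \<in> el om" using omega(2) by blast
  obtain m where m: "m \<in> el om" "n \<in> el m" using omega(3)[OF n] by blast
  have nm: "n \<in> el \<mu>" "m \<in> el \<mu>" "n \<noteq> m" "n \<in> D" "m \<in> D" using n m \<mu>(3) mem_irrefl by blast+
  have "\<exists>f\<in>D. el f = {p \<in> el (ti (ti \<mu> \<mu>) (bu \<mu> (up \<mu> \<mu>))). \<exists>a\<in>D. \<exists>z\<in>D. \<exists>v\<in>D. p = pr (pr a z) v \<and>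
      (z = n \<and> v = a \<or> z = m \<and> v = \<mu>)}"
    by (rule separation) (use \<mu> nm in \<open>auto intro!: definable_intros\<close>)
  then obtain f where f: "f \<in> D"
    "el f = {p \<in> el (ti (ti \<mu> \<mu>) (bu \<mu> (up \<mu> \<mu>))). \<exists>a\<in>D. \<exists>z\<in>D. \<exists>v\<in>D. p = pr (pr a z) v \<and>
      (z = n \<and> v = a \<or> z = m \<and> v = \<mu>)}" by blast
  show ?thesis
  proof (rule covI[OF f(1)])
    show "single_valued f" unfolding single_valued_def
    proof (intro ballI impI)
      fix x y z assume x: "x \<in> D" "y \<in> D" "z \<in> D" "pr x y \<in> el f \<and> pr x z \<in> el f"
      obtain a u v where 1: "a \<in> D" "u \<in> D" "v \<in> D" "pr x y = pr (pr a u) v"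
        "u = n \<and> v = a \<or> u = m \<and> v = \<mu>" using x(4) unfolding f(2) by blast
      obtain b s t where 2: "b \<in> D" "s \<in> D" "t \<in> D" "pr x z = pr (pr b s) t"
        "s = n \<and> t = b \<or> s = m \<and> t = \<mu>" using x(4) unfolding f(2) by blast
      have "x = pr a u" "y = v" "x = pr b s" "z = t" using x 1 2 by simp_all
      moreover from this have "a = b" "u = s" using 1 2 by simp_all
      ultimately show "y = z" using 1(5) 2(5) nm(3) by auto
    qed
    show "\<exists>b\<in>el (ti \<mu> \<mu>). pr b a \<in> el f" if a: "a \<in> el (bu \<mu> (up \<mu> \<mu>))" for a
    proof (cases "a = \<mu>")
      case True
      then have "pr (pr n m) a \<in> el f" unfolding f(2) using nm \<mu> by auto
      then show ?thesis using nm \<mu> by (intro bexI[of _ "pr n m"]) auto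
    next
      case False
      then have a': "a \<in> el \<mu>" "a \<in> D" using a \<mu>(2) by auto
      then have "pr (pr a n) a \<in> el f" unfolding f(2) using nm \<mu> by auto
      then show ?thesis using nm \<mu> a' by (intro bexI[of _ "pr a n"]) auto
    qed
  qed
qed

end

section \<open>Hessenberg's theorem for the pairing function\<close>

locale goedel_pairing = zf_model \<tau> M for \<tau> :: "('f, 'r) ssig" and M :: "('f fsym, 'r rsym, 'u) model" +
  fixes \<kappa> g :: 'u
  assumes \<kappa>: "ordinal \<kappa>" "\<kappa> \<in> D" and g: "collapse g (ti \<kappa> \<kappa>) (ltk \<kappa>)" "g \<in> D"
begin

lemma g_total: "a \<in> el \<kappa> \<Longrightarrow> b \<in> el \<kappa> \<Longrightarrow> \<exists>v\<in>D. pr (pr a b) v \<in> el g"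
  using collapse_total[OF g, of "pr a b"] \<kappa> by (simp add: el_D)

lemma g_inj: "p \<in> el (ti \<kappa> \<kappa>) \<Longrightarrow> q \<in> el (ti \<kappa> \<kappa>) \<Longrightarrow> v \<in> D \<Longrightarrow> pr p v \<in> el g \<Longrightarrow> pr q v \<in> el g \<Longrightarrow> p = q"
  using collapse_inj[OF g linear_ltk[OF \<kappa>]] .

text \<open>If v were not in \<nu>, then \<nu> would be a subset of v, whose elements are the values
  at the predecessors of (a,b). These lie in \<mu> \<times> \<mu>, where \<mu> is the successor of
  max(a,b), so \<mu> \<times> \<mu> would cover \<nu>. But it is bounded if \<mu> is finite and
  otherwise covered by \<mu>, which does not cover \<nu>.\<close>

lemma g_into:
  assumes \<nu>: "ordinal \<nu>" "\<nu> \<in> D" "el \<nu> \<subseteq> el \<kappa>" "el om \<subseteq> el \<nu>"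
    and IH: "\<And>\<mu>. \<mu> \<in> el \<nu> \<Longrightarrow> el om \<subseteq> el \<mu> \<Longrightarrow> cov (ti \<mu> \<mu>) \<mu>"
    and initial: "\<And>\<mu>. \<mu> \<in> el \<nu> \<Longrightarrow> \<not> cov \<nu> \<mu>"
    and ab: "a \<in> el \<nu>" "b \<in> el \<nu>" and v: "v \<in> D" "pr (pr a b) v \<in> el g"
  shows "v \<in> el \<nu>"
proof (rule ccontr)
  assume "v \<notin> el \<nu>"
  have ab\<kappa>: "a \<in> el \<kappa>" "b \<in> el \<kappa>" using ab \<nu>(3) by blast+
  have ov: "ordinal v"
    by (rule collapse_ordinal[OF g linear_ltk[OF \<kappa>] _ v]) (use ab\<kappa> \<kappa>(2) in \<open>simp add: el_D\<close>)
  have \<nu>v: "el \<nu> \<subseteq> el v"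
    using ordinal_subset[OF \<nu>(1) ov \<nu>(2) v(1)] ordinal_linear[OF \<nu>(1) ov \<nu>(2) v(1)] \<open>v \<notin> el \<nu>\<close> by blast
  define m where "m = bu a b"
  have m: "m \<in> el \<nu>" "ordinal m" "m \<in> D" using bu_mem[OF \<nu>(1,2) ab] unfolding m_def by blast+
  define \<mu> where "\<mu> = bu m (up m m)"
  have \<mu>D: "\<mu> \<in> D" and el\<mu>: "el \<mu> = insert m (el m)" using m(3) by (simp_all add: \<mu>_def)
  \<comment> \<open>\<nu> is not a successor: for m in \<omega> the successor of m does not contain
    \<omega>, and for infinite m it is covered by m \<times> m and hence by m.\<close>
  have "\<mu> \<noteq> \<nu>"
  proof
    assume eq: "\<mu> = \<nu>"
    have "m \<notin> el om"
    proof
      assume "m \<in> el om"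
      then obtain l where l: "l \<in> el om" "m \<in> el l" using omega(3) by blast
      then have "l = m \<or> l \<in> el m" using \<nu>(4) el\<mu> eq by auto
      then show False using l(2) mem_irrefl mem_asym by blast
    qed
    then have om: "el om \<subseteq> el m" using infinite_not_mem[OF m(2,3)] by blast
    have "cov \<nu> (ti m m)" using cov_succ[OF m(2,3) om] eq unfolding \<mu>_def by simp
    then show False using cov_trans IH[OF m(1) om] initial[OF m(1)] by blast
  qed
  have \<mu>\<nu>: "\<mu> \<in> el \<nu>"
  proof (rule ordinal_subset_mem[OF \<nu>(1,2) \<mu>D])
    show "el \<mu> \<subseteq> el \<nu>" unfolding el\<mu> using m(1) ordinal_trans[OF \<nu>(1)] by blast
    show "y \<in> el \<mu>" if "x \<in> el \<mu>" "y \<in> el x" for x y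
      using that unfolding el\<mu> using ordinal_trans[OF m(2)] by blast
  qed (rule \<open>\<mu> \<noteq> \<nu>\<close>)
  have "cov \<nu> (ti \<mu> \<mu>)"
  proof (rule covI[OF g(2)])
    show "single_valued g" using collapse_sv[OF g(1)] .
    fix w assume w: "w \<in> el \<nu>"
    then have "w \<in> el v" "w \<in> D" using \<nu>v by blast+
    moreover have "pr a b \<in> el (ti \<kappa> \<kappa>)" using ab\<kappa> \<kappa>(2) by (simp add: el_D)
    ultimately obtain q where q: "q \<in> el (ti \<kappa> \<kappa>)" "pr q (pr a b) \<in> el (ltk \<kappa>)" "pr q w \<in> el g"
      using collapseD[OF g(1) v(2) _ v(1)] by blast
    obtain c d where cd: "c \<in> el \<kappa>" "d \<in> el \<kappa>" "q = pr c d" using pairs_el[OF \<kappa>(2) q(1)] by blast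
    have "goedel_less c d a b" using mem_ltk[OF \<kappa> cd(1,2) ab\<kappa>] q(2) cd(3) by simp
    then have "bu c d \<in> el m \<or> bu c d = m" unfolding goedel_less_def m_def by blast
    then have "el (bu c d) \<subseteq> el m" using ordinal_trans[OF m(2)] by blast
    then have "el c \<subseteq> el m" "el d \<subseteq> el m" using cd el_D by auto
    then have "c \<in> el \<mu>" "d \<in> el \<mu>"
      using ordinal_subset[OF ordinal_mem[OF \<kappa>(1)] m(2) _ m(3)] cd unfolding el\<mu> by blast+
    then have "q \<in> el (ti \<mu> \<mu>)" using cd \<mu>D by (simp add: el_D)
    then show "\<exists>q\<in>el (ti \<mu> \<mu>). pr q w \<in> el g" using q(3) by blast
  qed
  moreover have "\<not> cov \<nu> (ti \<mu> \<mu>)"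
  proof (cases "\<mu> \<in> el om")
    case True
    then show ?thesis
      using bounded_not_cov[OF bounded_times] cov_trans[OF cov_subset[OF _ \<nu>(2,4)]] goedel_D(13) by blast
  next
    case False
    then have "el om \<subseteq> el \<mu>" using infinite_not_mem[OF ordinal_mem[OF \<nu>(1) \<mu>\<nu>] \<mu>D] by blast
    then show ?thesis using IH[OF \<mu>\<nu>] cov_trans initial[OF \<mu>\<nu>] by blast
  qed
  ultimately show False by blast
qed

text \<open>A least infinite counterexample n is not covered by any \<mu> below it: otherwise n
  \<times> n would be covered by \<mu> \<times> \<mu>, thus by \<mu>, and thus by n. Hence g maps n
  \<times> n injectively into n, and its converse is a cover.\<close>

lemma square_cov: "\<nu> \<in> el \<kappa> \<Longrightarrow> el om \<subseteq> el \<nu> \<Longrightarrow> cov (ti \<nu> \<nu>) \<nu>"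
proof (rule ccontr)
  let ?P = "\<lambda>\<nu>. el om \<subseteq> el \<nu> \<and> \<not> cov (ti \<nu> \<nu>) \<nu>"
  assume \<nu>: "\<nu> \<in> el \<kappa>" "el om \<subseteq> el \<nu>" "\<not> cov (ti \<nu> \<nu>) \<nu>"
  have "\<exists>m\<in>el \<kappa>. ?P m \<and> (\<forall>y\<in>el \<kappa>. y \<in> el m \<longrightarrow> \<not> ?P y)"
    by (rule ordinal_least[OF \<kappa>(2) _ \<nu>(1)]) (use \<nu> in \<open>auto intro!: definable_intros definable_cov\<close>)
  then obtain n where n: "n \<in> el \<kappa>" "?P n" "\<And>y. y \<in> el \<kappa> \<Longrightarrow> y \<in> el n \<Longrightarrow> \<not> ?P y" by blast
  have nD: "n \<in> D" and on: "ordinal n" using n(1) ordinal_mem[OF \<kappa>(1)] by blast+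
  have n\<kappa>: "el n \<subseteq> el \<kappa>" using ordinal_trans[OF \<kappa>(1) n(1)] by blast
  have IH: "cov (ti \<mu> \<mu>) \<mu>" if "\<mu> \<in> el n" "el om \<subseteq> el \<mu>" for \<mu> using n(3) that n\<kappa> by blast
  have "\<not> cov n \<mu>" if \<mu>: "\<mu> \<in> el n" for \<mu>
  proof
    assume c: "cov n \<mu>"
    have \<mu>D: "\<mu> \<in> D" and o\<mu>: "ordinal \<mu>" using \<mu> ordinal_mem[OF on] by blast+
    have "\<mu> \<notin> el om"
      using bounded_not_cov[OF bounded_omega] cov_trans[OF cov_subset[OF _ nD] c] n(2) goedel_D(13) by blast
    then have "cov (ti \<mu> \<mu>) \<mu>" using IH[OF \<mu>] infinite_not_mem[OF o\<mu> \<mu>D] by blast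
    moreover have "cov \<mu> n" using cov_subset[OF \<mu>D nD] ordinal_trans[OF on \<mu>] by blast
    ultimately have "cov (ti n n) n" using cov_trans[OF cov_times[OF c nD \<mu>D]] cov_trans by blast
    then show False using n(2) by blast
  qed
  then have into: "v \<in> el n" if "a \<in> el n" "b \<in> el n" "v \<in> D" "pr (pr a b) v \<in> el g" for a b v
    using g_into[OF on nD n\<kappa> _ IH] n(2) that by blast
  have "cov (ti n n) n"
  proof (rule covI[of "cv g"])
    show "cv g \<in> D" using g(2) by simp
    have dom: "p \<in> el (ti \<kappa> \<kappa>)" if "pr p v \<in> el g" "p \<in> D" "v \<in> D" for p v
      using collapse_dom[OF g that] .
    show "single_valued (cv g)" unfolding single_valued_def
    proof (intro ballI impI)
      fix v p q assume v: "v \<in> D" "p \<in> D" "q \<in> D" "pr v p \<in> el (cv g) \<and> pr v q \<in> el (cv g)"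
      then have "pr p v \<in> el g" "pr q v \<in> el g" using g(2) by simp_all
      then show "p = q" using g_inj dom v by blast
    qed
    show "\<exists>v\<in>el n. pr v p \<in> el (cv g)" if p: "p \<in> el (ti n n)" for p
    proof -
      obtain a b where ab: "a \<in> el n" "b \<in> el n" "p = pr a b" using pairs_el[OF nD p] by blast
      obtain v where v: "v \<in> D" "pr (pr a b) v \<in> el g" using g_total ab n\<kappa> by blast
      have "pr v p \<in> el (cv g)" using v ab g(2) p by (simp add: el_D)
      then show ?thesis using into[OF ab(1,2) v] by blast
    qed
  qed
  then show False using n(2) by blast
qed

text \<open>A cardinal only excludes bijections from smaller ordinals; \<open>enumeration\<close>
  turns a cover by \<mu> into such a bijection, so covers are excluded as well.\<close>

lemma g_into_cardinal:
  assumes "cardinal \<kappa>" "el om \<subseteq> el \<kappa>" "a \<in> el \<kappa>" "b \<in> el \<kappa>" "v \<in> D" "pr (pr a b) v \<in> el g"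
  shows "v \<in> el \<kappa>"
proof (rule g_into[OF \<kappa> order.refl assms(2) square_cov _ assms(3-6)])
  show "\<not> cov \<kappa> \<mu>" if \<mu>: "\<mu> \<in> el \<kappa>" for \<mu>
  proof
    assume "cov \<kappa> \<mu>"
    then obtain f where f: "f \<in> D" "single_valued f" "\<And>a. a \<in> el \<kappa> \<Longrightarrow> \<exists>b\<in>el \<mu>. pr b a \<in> el f"
      unfolding cov_def by blast
    have \<mu>D: "\<mu> \<in> D" and o\<mu>: "ordinal \<mu>" using \<mu> ordinal_mem[OF \<kappa>(1)] by blast+
    obtain \<alpha> h where \<alpha>: "\<alpha> \<in> D" "h \<in> D" "ordinal \<alpha>" "el \<alpha> \<subseteq> el \<mu>" "bij h \<alpha> \<kappa>"
      using enumeration[OF \<mu>D o\<mu> \<kappa>(2) f] by blast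
    have "\<alpha> \<in> el \<kappa>"
      using ordinal_subset[OF \<alpha>(3) o\<mu> \<alpha>(1) \<mu>D] \<alpha>(4) \<mu> ordinal_trans[OF \<kappa>(1)] by blast
    then show False using assms(1) \<alpha> unfolding cardinal_def by blast
  qed
qed

end

section \<open>Codes in a model\<close>

context set_structure
begin

definition wfe :: "'u \<Rightarrow> 'u \<Rightarrow> 'u \<Rightarrow> bool" where
  "wfe \<kappa> \<alpha> R \<longleftrightarrow> el R \<subseteq> el (ti \<kappa> \<kappa>) \<and> (\<alpha> \<in> el \<kappa> \<or> \<alpha> = \<kappa>) \<and>
     (\<forall>x\<in>D. x \<in> el \<alpha> \<longleftrightarrow> x = em \<or> (\<exists>y\<in>D. pr x y \<in> el R \<or> pr y x \<in> el R)) \<and>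
     (\<forall>A\<in>D. el A \<subseteq> el \<alpha> \<and> A \<noteq> em \<longrightarrow> (\<exists>x\<in>el A. \<forall>y\<in>el A. pr y x \<notin> el R)) \<and>
     (\<forall>x\<in>el \<alpha>. \<forall>y\<in>el \<alpha>. (\<forall>z\<in>el \<alpha>. pr z x \<in> el R \<longleftrightarrow> pr z y \<in> el R) \<longrightarrow> x = y) \<and>
     (\<forall>Q\<in>D. el R \<subseteq> el Q \<and>
        (\<forall>x\<in>D. \<forall>y\<in>D. \<forall>z\<in>D. pr x y \<in> el Q \<and> pr y z \<in> el Q \<longrightarrow> pr x z \<in> el Q) \<longrightarrow>
        (\<forall>x\<in>el \<alpha>. x = em \<or> pr x em \<in> el Q))"

definition pairing :: "'u \<Rightarrow> 'u \<Rightarrow> bool" where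
  "pairing \<kappa> g \<longleftrightarrow> func g \<and> dm g = ti \<kappa> \<kappa> \<and>
     (\<forall>a\<in>el \<kappa>. \<forall>b\<in>el \<kappa>. \<forall>v\<in>D. pr (pr a b) v \<in> el g \<longrightarrow>
        (\<forall>w\<in>D. w \<in> el v \<longleftrightarrow> (\<exists>c\<in>el \<kappa>. \<exists>d\<in>el \<kappa>. goedel_less c d a b \<and> pr (pr c d) w \<in> el g)))"

definition represents :: "'u \<Rightarrow> 'u \<Rightarrow> 'u \<Rightarrow> bool" where
  "represents \<kappa> y R \<longleftrightarrow> el y \<subseteq> el \<kappa> \<and> el R \<subseteq> el (ti \<kappa> \<kappa>) \<and>
     (\<exists>g\<in>D. pairing \<kappa> g \<and>
        (\<forall>a\<in>el \<kappa>. \<forall>b\<in>el \<kappa>. pr a b \<in> el R \<longleftrightarrow> (\<exists>v\<in>el y. pr (pr a b) v \<in> el g)))"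

definition codes :: "'u \<Rightarrow> 'u \<Rightarrow> 'u \<Rightarrow> bool" where
  "codes \<kappa> y x \<longleftrightarrow> (\<exists>R\<in>D. represents \<kappa> y R \<and>
     (\<exists>\<alpha>\<in>D. wfe \<kappa> \<alpha> R \<and> (\<exists>f\<in>D. collapse f \<alpha> R \<and> pr em x \<in> el f)))"

text \<open>The part of \<open>codes\<close> which is absolute; it determines \<open>x\<close> once \<open>y\<close> is known to be a
  code.\<close>
definition core :: "'u \<Rightarrow> 'u \<Rightarrow> 'u \<Rightarrow> 'u \<Rightarrow> 'u \<Rightarrow> bool" where
  "core \<kappa> y x g f \<longleftrightarrow>
     (let R = dm (it g (ti (ti \<kappa> \<kappa>) y)); \<alpha> = bu (up em em) (bu (dm R) (dm (cv R))) in
      collapse_eq g (ti \<kappa> \<kappa>) (ltk \<kappa>) \<and> collapse_eq f \<alpha> R \<and> pr em x \<in> el f)"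

end

context zf_model
begin

text \<open>The recursive clause of the pairing function is the collapse condition for the set
  \<open>ltk \<kappa>\<close>. This gives it existence, uniqueness and a description by equations
  between terms.\<close>

lemma pairing_iff:
  assumes \<kappa>: "ordinal \<kappa>" "\<kappa> \<in> D"
  shows "pairing \<kappa> g \<longleftrightarrow> collapse g (ti \<kappa> \<kappa>) (ltk \<kappa>)"
proof -
  have all: "(\<forall>x\<in>el (ti \<kappa> \<kappa>). P x) \<longleftrightarrow> (\<forall>a\<in>el \<kappa>. \<forall>b\<in>el \<kappa>. P (pr a b))"
    and ex: "(\<exists>x\<in>el (ti \<kappa> \<kappa>). P x) \<longleftrightarrow> (\<exists>a\<in>el \<kappa>. \<exists>b\<in>el \<kappa>. P (pr a b))" for P
    unfolding el_ti[OF \<kappa>(2,2)] by blast+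
  have "(\<exists>c\<in>el \<kappa>. \<exists>d\<in>el \<kappa>. goedel_less c d a b \<and> pr (pr c d) w \<in> el g) \<longleftrightarrow>
      (\<exists>c\<in>el \<kappa>. \<exists>d\<in>el \<kappa>. pr (pr c d) (pr a b) \<in> el (ltk \<kappa>) \<and> pr (pr c d) w \<in> el g)"
    if "a \<in> el \<kappa>" "b \<in> el \<kappa>" for a b w
    using mem_ltk[OF \<kappa> _ _ that] by blast
  then show ?thesis unfolding pairing_def collapse_def all ex by (simp cong: ball_cong)
qed

lemma el_eqI_D:
  assumes "a \<in> D" "b \<in> D" and *: "\<And>x. x \<in> D \<Longrightarrow> x \<in> el a \<longleftrightarrow> x \<in> el b"
  shows "a = b"
proof (rule el_eqI[OF assms(1,2)])
  show "el a = el b"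
  proof (intro equalityI subsetI)
    show "x \<in> el b" if "x \<in> el a" for x using *[OF el_D[OF that]] that by blast
    show "x \<in> el a" if "x \<in> el b" for x using *[OF el_D[OF that]] that by blast
  qed
qed

text \<open>R is the preimage of y under g. As a term in g and y it has the same value in a model
  and in its extensions.\<close>

lemma represents_eq:
  assumes \<kappa>: "ordinal \<kappa>" "\<kappa> \<in> D" and g: "g \<in> D" "pairing \<kappa> g" and y: "y \<in> D" "el y \<subseteq> el \<kappa>"
    and R: "R \<in> D" "el R \<subseteq> el (ti \<kappa> \<kappa>)"
      "\<And>a b. a \<in> el \<kappa> \<Longrightarrow> b \<in> el \<kappa> \<Longrightarrow> pr a b \<in> el R \<longleftrightarrow> (\<exists>v\<in>el y. pr (pr a b) v \<in> el g)"
  shows "R = dm (it g (ti (ti \<kappa> \<kappa>) y))"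
proof (rule el_eqI_D)
  have mem: "p \<in> el (dm (it g (ti (ti \<kappa> \<kappa>) y))) \<longleftrightarrow> p \<in> el (ti \<kappa> \<kappa>) \<and> (\<exists>v\<in>el y. pr p v \<in> el g)"
    if "p \<in> D" for p
  proof -
    have "p \<in> el (dm (it g (ti (ti \<kappa> \<kappa>) y))) \<longleftrightarrow> (\<exists>v\<in>D. pr p v \<in> el g \<and> p \<in> el (ti \<kappa> \<kappa>) \<and> v \<in> el y)"
      using that g \<kappa> y by (subst el_dm) auto
    then show ?thesis using el_D by blast
  qed
  have "p \<in> el R \<longleftrightarrow> p \<in> el (ti \<kappa> \<kappa>) \<and> (\<exists>v\<in>el y. pr p v \<in> el g)" for p
  proof (cases "p \<in> el (ti \<kappa> \<kappa>)")
    case True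
    then show ?thesis using pairs_el[OF \<kappa>(2) True] R(3) by blast
  qed (use R(2) in blast)
  then show "p \<in> el R \<longleftrightarrow> p \<in> el (dm (it g (ti (ti \<kappa> \<kappa>) y)))" if "p \<in> D" for p
    using mem[OF that] by blast
qed (use R g \<kappa> y in simp_all)

text \<open>The field of R with 0 added: in this way \<alpha> is computed from R by a term.\<close>

lemma wfe_field:
  assumes w: "wfe \<kappa> \<alpha> R" and D: "\<alpha> \<in> D" "R \<in> D"
  shows "\<alpha> = bu (up em em) (bu (dm R) (dm (cv R)))"
proof (rule el_eqI_D)
  fix x assume x: "x \<in> D"
  have "x \<in> el \<alpha> \<longleftrightarrow> x = em \<or> (\<exists>y\<in>D. pr x y \<in> el R \<or> pr y x \<in> el R)"
    using w x unfolding wfe_def by blast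
  moreover have "x \<in> el (bu (up em em) (bu (dm R) (dm (cv R)))) \<longleftrightarrow>
      x = em \<or> (\<exists>y\<in>D. pr x y \<in> el R \<or> pr y x \<in> el R)"
    using x D by (auto simp: el_dm)
  ultimately show "x \<in> el \<alpha> \<longleftrightarrow> x \<in> el (bu (up em em) (bu (dm R) (dm (cv R))))" by blast
qed (use D in simp_all)

text \<open>Separates the equations, which are absolute, from well-foundedness, which is not and on
  which uniqueness of the collapse rests.\<close>

lemma codes_witness:
  assumes \<kappa>: "ordinal \<kappa>" "\<kappa> \<in> D" and y: "y \<in> D" and c: "codes \<kappa> y x"
  shows "\<exists>g\<in>D. \<exists>f\<in>D. \<exists>\<alpha>\<in>D. \<exists>R\<in>D. R = dm (it g (ti (ti \<kappa> \<kappa>) y)) \<and>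
    \<alpha> = bu (up em em) (bu (dm R) (dm (cv R))) \<and> collapse g (ti \<kappa> \<kappa>) (ltk \<kappa>) \<and>
    collapse f \<alpha> R \<and> pr em x \<in> el f \<and> wellfounded \<alpha> R \<and> em \<in> el \<alpha>"
proof -
  obtain R \<alpha> f where R: "R \<in> D" "represents \<kappa> y R" and \<alpha>: "\<alpha> \<in> D" "wfe \<kappa> \<alpha> R"
    and f: "f \<in> D" "collapse f \<alpha> R" "pr em x \<in> el f" using c unfolding codes_def by blast
  obtain g where g: "g \<in> D" "pairing \<kappa> g"
    "\<And>a b. a \<in> el \<kappa> \<Longrightarrow> b \<in> el \<kappa> \<Longrightarrow> pr a b \<in> el R \<longleftrightarrow> (\<exists>v\<in>el y. pr (pr a b) v \<in> el g)"
    using R(2) unfolding represents_def by blast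
  have "R = dm (it g (ti (ti \<kappa> \<kappa>) y))"
    by (rule represents_eq[OF \<kappa> g(1,2) y _ R(1) _ g(3)]) (use R(2) in \<open>simp_all add: represents_def\<close>)
  moreover have "\<alpha> = bu (up em em) (bu (dm R) (dm (cv R)))" by (rule wfe_field[OF \<alpha>(2,1) R(1)])
  moreover have "collapse g (ti \<kappa> \<kappa>) (ltk \<kappa>)" using g(2) pairing_iff[OF \<kappa>] by simp
  moreover have "wellfounded \<alpha> R" unfolding wellfounded_def
  proof (intro ballI impI)
    fix X assume X: "X \<in> D" "el X \<subseteq> el \<alpha>" "el X \<noteq> {}"
    have "\<forall>A\<in>D. el A \<subseteq> el \<alpha> \<and> A \<noteq> em \<longrightarrow> (\<exists>x\<in>el A. \<forall>y\<in>el A. pr y x \<notin> el R)"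
      using \<alpha>(2) unfolding wfe_def by (elim conjE)
    moreover have "X \<noteq> em" using X(3) by auto
    ultimately show "\<exists>m\<in>el X. \<forall>b\<in>el X. pr b m \<notin> el R" using X by blast
  qed
  moreover have "em \<in> el \<alpha>" using \<alpha>(2) goedel_D(12) unfolding wfe_def by blast
  ultimately show ?thesis using R(1) \<alpha>(1) f g(1) by blast
qed

lemma codes_core:
  assumes \<kappa>: "ordinal \<kappa>" "\<kappa> \<in> D" and y: "y \<in> D" and c: "codes \<kappa> y x"
  shows "\<exists>g\<in>D. \<exists>f\<in>D. core \<kappa> y x g f"
proof -
  obtain g f \<alpha> R where w: "g \<in> D" "f \<in> D" "\<alpha> \<in> D" "R \<in> D" "R = dm (it g (ti (ti \<kappa> \<kappa>) y))"
    "\<alpha> = bu (up em em) (bu (dm R) (dm (cv R)))" "collapse g (ti \<kappa> \<kappa>) (ltk \<kappa>)"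
    "collapse f \<alpha> R" "pr em x \<in> el f" using codes_witness[OF assms] by blast
  have "collapse_eq g (ti \<kappa> \<kappa>) (ltk \<kappa>)" "collapse_eq f \<alpha> R"
    using w(7,8) collapse_eq_iff[OF w(1)] collapse_eq_iff[OF w(2,3,4)] \<kappa>(2) by simp_all
  then show ?thesis using w unfolding core_def Let_def by blast
qed

text \<open>A core carries no well-foundedness. For g this does no harm, as
  \<open>ltk \<kappa>\<close> is well-founded in every model; so g, and then R and \<alpha>, are
  those belonging to the code of x'. The well-foundedness contained in that code identifies the
  collapses f and f'.\<close>

lemma core_codes_unique:
  assumes \<kappa>: "ordinal \<kappa>" "\<kappa> \<in> D" and D: "y \<in> D" "x \<in> D" "x' \<in> D" "g \<in> D" "f \<in> D"
    and core: "core \<kappa> y x g f" and c: "codes \<kappa> y x'"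
  shows "x = x'"
proof -
  obtain g' f' \<alpha> R where w: "g' \<in> D" "f' \<in> D" "\<alpha> \<in> D" "R \<in> D" "R = dm (it g' (ti (ti \<kappa> \<kappa>) y))"
    "\<alpha> = bu (up em em) (bu (dm R) (dm (cv R)))" "collapse g' (ti \<kappa> \<kappa>) (ltk \<kappa>)"
    "collapse f' \<alpha> R" "pr em x' \<in> el f'" "wellfounded \<alpha> R" "em \<in> el \<alpha>"
    using codes_witness[OF \<kappa> D(1) c] by blast
  have "collapse g (ti \<kappa> \<kappa>) (ltk \<kappa>)"
    using core collapse_eq_iff[OF D(4)] \<kappa>(2) unfolding core_def Let_def by simp
  then have "g = g'"
    by (rule collapse_unique[OF _ D(4) w(7,1) wellfounded_ltk[OF \<kappa>]]) (use \<kappa>(2) in simp_all)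
  then have f: "collapse_eq f \<alpha> R" "pr em x \<in> el f"
    using core w(5,6) unfolding core_def Let_def by simp_all
  have "f = f'"
    by (rule collapse_unique[OF _ D(5) w(8,2,10,3)]) (use f(1) collapse_eq_iff[OF D(5) w(3,4)] in simp_all)
  then show ?thesis using single_valuedD[OF collapse_sv[OF w(8)] _ w(9)] f(2) D by simp
qed

lemma codes_unique:
  assumes "ordinal \<kappa>" "\<kappa> \<in> D" "y \<in> D" "x \<in> D" "x' \<in> D" "codes \<kappa> y x" "codes \<kappa> y x'"
  shows "x = x'"
  using codes_core[OF assms(1-3,6)] core_codes_unique assms by blast

text \<open>The members of the transitive closure t of {x} are indexed by an ordinal \<alpha> \<le>
  \<kappa> with x at 0, membership is pulled back to a relation R on the indices, and g turns R into
  a subset of \<kappa>. The indexing h is then the collapse of R.\<close>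

lemma code_exists:
  assumes card: "cardinal \<kappa>" "\<kappa> \<in> D" and surj: "\<And>x. x \<in> D \<Longrightarrow> x \<noteq> em \<Longrightarrow> \<exists>s\<in>D. surj_on s \<kappa> x"
    and x: "x \<in> D"
  shows "\<exists>y\<in>D. codes \<kappa> y x"
proof -
  have \<kappa>: "ordinal \<kappa>" "\<kappa> \<in> D" using card unfolding cardinal_def by blast+
  have onto_cov: "\<exists>b\<in>el \<kappa>. pr b a \<in> el s" if s: "s \<in> D" "surj_on s \<kappa> X" and a: "a \<in> el X" for s X a
  proof -
    have "\<forall>y\<in>D. y \<in> el X \<longleftrightarrow> (\<exists>x\<in>D. pr x y \<in> el s)" and dom: "dm s = \<kappa>"
      using s(2) unfolding surj_on_def by blast+
    then obtain b where b: "b \<in> D" "pr b a \<in> el s" using a by blast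
    then show ?thesis using dmI[OF s(1) b(1) _ b(2)] dom a by blast
  qed
  \<comment> \<open>\<kappa> maps onto \<omega>, which no natural number does.\<close>
  have infinite: "el om \<subseteq> el \<kappa>"
  proof -
    have "om \<noteq> em" using omega(2) by auto
    then obtain s where s: "s \<in> D" "surj_on s \<kappa> om" using surj[of om] by auto
    have "cov om \<kappa>" by (rule covI[OF s(1)]) (use s onto_cov in \<open>auto simp: surj_on_def func_def\<close>)
    then have "\<kappa> \<notin> el om" using bounded_not_cov[OF bounded_omega] by blast
    then show ?thesis using infinite_not_mem[OF \<kappa>] by blast
  qed
  obtain n0 where n0: "n0 \<in> el om" using omega(2) by blast
  have em\<kappa>: "em \<in> el \<kappa>"
  proof -
    have "\<kappa> \<noteq> em" using infinite n0 by auto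
    moreover have "el em \<subseteq> el \<kappa>" by simp
    ultimately show ?thesis using ordinal_subset_mem[OF \<kappa>, of em] by auto
  qed
  obtain g where g: "g \<in> D" "collapse g (ti \<kappa> \<kappa>) (ltk \<kappa>)"
    using collapse_exists[OF goedel_D(3)[OF \<kappa>(2,2)] term_D(10)[OF \<kappa>(2)] wellfounded_ltk[OF \<kappa>]
      linear_ltk[OF \<kappa>]] by blast
  interpret p: goedel_pairing \<tau> M \<kappa> g by unfold_locales (rule \<kappa> g)+
  obtain t where tD: "t \<in> D" and t': "x \<in> el t" "\<forall>z\<in>el t. el z \<subseteq> el t"
    "\<forall>P\<in>D. x \<in> el P \<longrightarrow> (\<forall>z\<in>el P. z \<in> el t \<longrightarrow> el z \<subseteq> el P) \<longrightarrow> el t \<subseteq> el P"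
    using transitive_closure[OF x] by (elim bexE conjE)
  have minimal: "el t \<subseteq> el P" if "P \<in> D" "x \<in> el P" "\<And>z. z \<in> el P \<Longrightarrow> z \<in> el t \<Longrightarrow> el z \<subseteq> el P" for P
    using t'(3)[rule_format, OF that(1,2)] that(3) by blast
  note t = tD t'(1) t'(2)[rule_format] minimal
  have "t \<noteq> em" using t(2) by auto
  then obtain s where s: "s \<in> D" "surj_on s \<kappa> t" using surj t(1) by blast
  have ssv: "single_valued s" using s(2) unfolding surj_on_def func_def by blast
  obtain b0 where b0: "b0 \<in> el \<kappa>" "pr b0 x \<in> el s" using onto_cov[OF s t(2)] by blast
  have bD: "b0 \<in> D" using b0(1) by blast
  \<comment> \<open>Exchanging the values of \<open>s\<close> at \<open>0\<close> and \<open>b0\<close> makes \<open>x\<close> the value at \<open>0\<close>.\<close>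
  have "\<exists>s1\<in>D. el s1 = {p \<in> el (ti \<kappa> t). \<exists>b\<in>D. \<exists>v\<in>D. p = pr b v \<and>
      (b = em \<and> v = x \<or> b \<noteq> em \<and> b \<noteq> b0 \<and> pr b v \<in> el s \<or> b \<noteq> em \<and> b = b0 \<and> pr em v \<in> el s)}"
    by (rule separation) (use \<kappa>(2) t(1) x bD s(1) in \<open>auto intro!: definable_intros\<close>)
  then obtain s1 where s1: "s1 \<in> D" "el s1 = {p \<in> el (ti \<kappa> t). \<exists>b\<in>D. \<exists>v\<in>D. p = pr b v \<and>
      (b = em \<and> v = x \<or> b \<noteq> em \<and> b \<noteq> b0 \<and> pr b v \<in> el s \<or> b \<noteq> em \<and> b = b0 \<and> pr em v \<in> el s)}"
    by blast
  have s1mem: "pr b v \<in> el s1 \<longleftrightarrow> b \<in> el \<kappa> \<and> v \<in> el t \<and>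
      (b = em \<and> v = x \<or> b \<noteq> em \<and> b \<noteq> b0 \<and> pr b v \<in> el s \<or> b \<noteq> em \<and> b = b0 \<and> pr em v \<in> el s)"
    if "b \<in> D" "v \<in> D" for b v
    unfolding s1(2) using that \<kappa>(2) t(1) by auto
  have s1sv: "single_valued s1" unfolding single_valued_def
  proof (intro ballI impI)
    fix b v w assume b: "b \<in> D" "v \<in> D" "w \<in> D" "pr b v \<in> el s1 \<and> pr b w \<in> el s1"
    have em: "em \<in> D" by simp
    show "v = w"
      using b(4) s1mem[OF b(1,2)] s1mem[OF b(1,3)] single_valuedD[OF ssv _ _ b(1-3)]
        single_valuedD[OF ssv _ _ em b(2,3)] by blast
  qed
  have s1onto: "\<exists>b\<in>el \<kappa>. pr b v \<in> el s1" if v: "v \<in> el t" for v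
  proof -
    obtain b where b: "b \<in> el \<kappa>" "pr b v \<in> el s" using onto_cov[OF s v] by blast
    have D: "v \<in> D" "b \<in> D" using v b by blast+
    consider "b = em" "b0 = em" | "b = em" "b0 \<noteq> em" | "b \<noteq> em" "b = b0" | "b \<noteq> em" "b \<noteq> b0" by blast
    then show ?thesis
    proof cases
      case 1
      then have "v = x" using single_valuedD[OF ssv b(2) _ D(2,1) x] b0(2) by simp
      then show ?thesis using s1mem[OF D(2,1)] b v 1 by blast
    next
      case 2
      then show ?thesis using s1mem[OF bD D(1)] b v b0 by blast
    next
      case 3
      then have "v = x" using single_valuedD[OF ssv b(2) _ D(2,1) x] b0(2) by simp
      then show ?thesis using s1mem[of em v] em\<kappa> v D by auto
    next
      case 4
      then show ?thesis using s1mem[OF D(2,1)] b v by blast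
    qed
  qed
  have "pr em x \<in> el s1" using s1mem[of em x] em\<kappa> t(2) x by simp
  then obtain \<alpha> h where \<alpha>: "\<alpha> \<in> D" "ordinal \<alpha>" "el \<alpha> \<subseteq> el \<kappa>" and h: "h \<in> D" "bij h \<alpha> t" "pr em x \<in> el h"
    using enumeration[OF \<kappa>(2,1) t(1) s1(1) s1sv s1onto] em\<kappa> t(2) by blast
  have hfunc: "func h" "dm h = \<alpha>" "\<And>v. v \<in> D \<Longrightarrow> v \<in> el t \<longleftrightarrow> (\<exists>a\<in>D. pr a v \<in> el h)"
    and hinj: "\<And>a b v. pr a v \<in> el h \<Longrightarrow> pr b v \<in> el h \<Longrightarrow> a \<in> D \<Longrightarrow> b \<in> D \<Longrightarrow> v \<in> D \<Longrightarrow> a = b"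
    using h(2) unfolding bij_def surj_on_def by blast+
  have hsv: "v = w" if "pr a v \<in> el h" "pr a w \<in> el h" "a \<in> D" "v \<in> D" "w \<in> D" for a v w
    using single_valuedD hfunc(1) that unfolding func_def by blast
  have hdom: "a \<in> el \<alpha>" "v \<in> el t" if "pr a v \<in> el h" "a \<in> D" "v \<in> D" for a v
    using dmI[OF h(1) that(2,3,1)] hfunc(2,3) that by auto
  have htot: "\<exists>v\<in>el t. pr a v \<in> el h" if "a \<in> el \<alpha>" for a
    using that el_dm[OF h(1)] hfunc(2,3) by blast
  have honto: "\<exists>a\<in>el \<alpha>. pr a v \<in> el h" if "v \<in> el t" for v
    using that hfunc(3) hdom(1) by blast
  have em\<alpha>: "em \<in> el \<alpha>" using hdom(1)[OF h(3)] x by simp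
  have "\<exists>R\<in>D. el R = {p \<in> el (ti \<kappa> \<kappa>). \<exists>a\<in>D. \<exists>b\<in>D. p = pr a b \<and>
      (\<exists>u\<in>D. \<exists>v\<in>D. pr a u \<in> el h \<and> pr b v \<in> el h \<and> u \<in> el v)}"
    by (rule separation) (use \<kappa>(2) h(1) in \<open>auto intro!: definable_intros\<close>)
  then obtain R where R: "R \<in> D" "el R = {p \<in> el (ti \<kappa> \<kappa>). \<exists>a\<in>D. \<exists>b\<in>D. p = pr a b \<and>
      (\<exists>u\<in>D. \<exists>v\<in>D. pr a u \<in> el h \<and> pr b v \<in> el h \<and> u \<in> el v)}" by blast
  have Rmem: "pr a b \<in> el R \<longleftrightarrow> (\<exists>u\<in>D. \<exists>v\<in>D. pr a u \<in> el h \<and> pr b v \<in> el h \<and> u \<in> el v)"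
    if "a \<in> D" "b \<in> D" for a b
  proof -
    have "pr a b \<in> el R \<longleftrightarrow> a \<in> el \<kappa> \<and> b \<in> el \<kappa> \<and> (\<exists>u\<in>D. \<exists>v\<in>D. pr a u \<in> el h \<and> pr b v \<in> el h \<and> u \<in> el v)"
      unfolding R(2) using that \<kappa>(2) by auto
    then show ?thesis using hdom(1) \<alpha>(3) that by blast
  qed
  have Rval: "pr a b \<in> el R \<longleftrightarrow> u \<in> el v" if "pr a u \<in> el h" "pr b v \<in> el h" "a \<in> el \<alpha>" "b \<in> el \<alpha>" "u \<in> D" "v \<in> D"
    for a b u v
  proof -
    have D: "a \<in> D" "b \<in> D" using that by blast+
    show ?thesis using Rmem[OF D] that hsv D by blast
  qed
  have R\<alpha>: "a \<in> el \<alpha>" "b \<in> el \<alpha>" if "pr a b \<in> el R" "a \<in> D" "b \<in> D" for a b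
    using Rmem[OF that(2,3)] that hdom(1) by blast+
  have R\<kappa>: "el R \<subseteq> el (ti \<kappa> \<kappa>)" unfolding R(2) by blast
  have "\<exists>y\<in>D. el y = {v \<in> el \<kappa>. \<exists>p\<in>el R. pr p v \<in> el g}"
    by (rule separation) (use \<kappa>(2) R(1) g(1) in \<open>auto intro!: definable_intros\<close>)
  then obtain y where y: "y \<in> D" "el y = {v \<in> el \<kappa>. \<exists>p\<in>el R. pr p v \<in> el g}" by blast
  have rep: "represents \<kappa> y R" unfolding represents_def
  proof (intro conjI bexI[of _ g] ballI)
    show "el y \<subseteq> el \<kappa>" unfolding y(2) by blast
    show "pairing \<kappa> g" using g(2) pairing_iff[OF \<kappa>] by simp
    fix a b assume ab: "a \<in> el \<kappa>" "b \<in> el \<kappa>"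
    then have abK: "pr a b \<in> el (ti \<kappa> \<kappa>)" using \<kappa>(2) by (simp add: el_D)
    show "pr a b \<in> el R \<longleftrightarrow> (\<exists>v\<in>el y. pr (pr a b) v \<in> el g)"
    proof
      assume abR: "pr a b \<in> el R"
      obtain v where v: "v \<in> D" "pr (pr a b) v \<in> el g" using p.g_total[OF ab] by blast
      \<comment> \<open>Here Hessenberg's theorem enters: \<open>y\<close> was cut down to \<kappa>,
        and a value outside \<kappa> would lose the pair.\<close>
      have "v \<in> el \<kappa>" by (rule p.g_into_cardinal[OF card(1) infinite ab v])
      then show "\<exists>v\<in>el y. pr (pr a b) v \<in> el g" unfolding y(2) using v abR by blast
    next
      assume "\<exists>v\<in>el y. pr (pr a b) v \<in> el g"
      then obtain v q where v: "v \<in> D" "pr (pr a b) v \<in> el g" "q \<in> el R" "pr q v \<in> el g"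
        unfolding y(2) by blast
      then have "q = pr a b" using p.g_inj[OF _ abK v(1)] R\<kappa> by blast
      then show "pr a b \<in> el R" using v(3) by simp
    qed
  qed (use R\<kappa> g in blast)+
  have col: "collapse h \<alpha> R" unfolding collapse_def
  proof (intro conjI ballI impI)
    fix a v w assume a: "a \<in> el \<alpha>" and v: "v \<in> D" "pr a v \<in> el h" and w: "w \<in> D"
    show "w \<in> el v \<longleftrightarrow> (\<exists>b\<in>el \<alpha>. pr b a \<in> el R \<and> pr b w \<in> el h)"
    proof
      assume wv: "w \<in> el v"
      then have "w \<in> el t" using t(3) hdom(2)[OF v(2) _ v(1)] a by blast
      then obtain b where "b \<in> el \<alpha>" "pr b w \<in> el h" using honto by blast
      then show "\<exists>b\<in>el \<alpha>. pr b a \<in> el R \<and> pr b w \<in> el h" using Rval v(2) wv a v(1) w by blast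
    next
      assume "\<exists>b\<in>el \<alpha>. pr b a \<in> el R \<and> pr b w \<in> el h"
      then show "w \<in> el v" using Rval v a w by blast
    qed
  qed (use hfunc in blast)+
  have wfe: "wfe \<kappa> \<alpha> R" unfolding wfe_def
  proof (intro conjI)
    show "el R \<subseteq> el (ti \<kappa> \<kappa>)" by (rule R\<kappa>)
    show "\<alpha> \<in> el \<kappa> \<or> \<alpha> = \<kappa>" using ordinal_subset[OF \<alpha>(2) \<kappa>(1) \<alpha>(1) \<kappa>(2)] \<alpha>(3) by blast
    show "\<forall>a\<in>D. a \<in> el \<alpha> \<longleftrightarrow> a = em \<or> (\<exists>b\<in>D. pr a b \<in> el R \<or> pr b a \<in> el R)"
    proof (intro ballI iffI)
      fix a assume aD: "a \<in> D" and a: "a \<in> el \<alpha>"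
      obtain z where z: "z \<in> el t" "pr a z \<in> el h" using htot[OF a] by blast
      \<comment> \<open>The members of \<open>t\<close> that are \<open>x\<close> or elements of a
        member of \<open>t\<close>. They include \<open>x\<close> and are closed under elements, so
        they exhaust \<open>t\<close>; every index other than 0 therefore has an R-successor and
        lies in the field.\<close>
      have "\<exists>P\<in>D. el P = {w \<in> el t. w = x \<or> (\<exists>u\<in>el t. w \<in> el u)}"
        by (rule separation) (use t(1) x in \<open>auto intro!: definable_intros\<close>)
      then obtain P where P: "P \<in> D" "el P = {w \<in> el t. w = x \<or> (\<exists>u\<in>el t. w \<in> el u)}" by blast
      have "el t \<subseteq> el P" by (rule t(4)[OF P(1)]) (use P(2) t(2,3) in blast)+
      then have "z = x \<or> (\<exists>u\<in>el t. z \<in> el u)" using P(2) z(1) by blast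
      then show "a = em \<or> (\<exists>b\<in>D. pr a b \<in> el R \<or> pr b a \<in> el R)"
      proof
        assume "z = x"
        then have "a = em" using hinj[of a z em] z h(3) aD x by simp
        then show ?thesis by blast
      next
        assume "\<exists>u\<in>el t. z \<in> el u"
        then obtain u where u: "u \<in> el t" "z \<in> el u" by blast
        obtain b where b: "b \<in> el \<alpha>" "pr b u \<in> el h" using honto[OF u(1)] by blast
        then have "pr a b \<in> el R" using Rval[OF z(2) b(2) a b(1)] z u by blast
        then show ?thesis using b(1) by blast
      qed
    next
      fix a assume aD: "a \<in> D" and "a = em \<or> (\<exists>b\<in>D. pr a b \<in> el R \<or> pr b a \<in> el R)"
      then show "a \<in> el \<alpha>" using em\<alpha> R\<alpha> by blast
    qed
    show "\<forall>A\<in>D. el A \<subseteq> el \<alpha> \<and> A \<noteq> em \<longrightarrow> (\<exists>a\<in>el A. \<forall>b\<in>el A. pr b a \<notin> el R)"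
    proof (intro ballI impI)
      fix A assume A: "A \<in> D" "el A \<subseteq> el \<alpha> \<and> A \<noteq> em"
      \<comment> \<open>The image of \<open>A\<close> under \<open>h\<close>; an \<in>-minimal
        element of it is the value of an R-minimal point of \<open>A\<close>.\<close>
      have "\<exists>B\<in>D. el B = {v \<in> el t. \<exists>a\<in>el A. pr a v \<in> el h}"
        by (rule separation) (use A(1) h(1) t(1) in \<open>auto intro!: definable_intros\<close>)
      then obtain B where B: "B \<in> D" "el B = {v \<in> el t. \<exists>a\<in>el A. pr a v \<in> el h}" by blast
      have "el A \<noteq> {}" using A el_eqI[of A em] by auto
      then have "el B \<noteq> {}" using B(2) A(2) htot by blast
      then obtain v where v: "v \<in> el B" "\<forall>z\<in>el B. z \<notin> el v" using foundation[OF B(1)] by blast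
      then obtain a where a: "a \<in> el A" "pr a v \<in> el h" using B(2) by blast
      have "pr b a \<notin> el R" if b: "b \<in> el A" for b
      proof
        assume bR: "pr b a \<in> el R"
        obtain u where u: "u \<in> el t" "pr b u \<in> el h" using htot A(2) b by blast
        then have "u \<in> el B" using B(2) b by blast
        moreover have "u \<in> el v" using Rval[OF u(2) a(2)] bR A(2) a(1) b u(1) v(1) by blast
        ultimately show False using v(2) by blast
      qed
      then show "\<exists>a\<in>el A. \<forall>b\<in>el A. pr b a \<notin> el R" using a(1) by blast
    qed
    show "\<forall>a\<in>el \<alpha>. \<forall>b\<in>el \<alpha>. (\<forall>c\<in>el \<alpha>. pr c a \<in> el R \<longleftrightarrow> pr c b \<in> el R) \<longrightarrow> a = b"
    proof (intro ballI impI)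
      fix a b assume ab: "a \<in> el \<alpha>" "b \<in> el \<alpha>" and eq: "\<forall>c\<in>el \<alpha>. pr c a \<in> el R \<longleftrightarrow> pr c b \<in> el R"
      obtain u where u: "u \<in> el t" "pr a u \<in> el h" using htot[OF ab(1)] by blast
      obtain v where v: "v \<in> el t" "pr b v \<in> el h" using htot[OF ab(2)] by blast
      have uvD: "u \<in> D" "v \<in> D" using u v by blast+
      have "w \<in> el u \<longleftrightarrow> w \<in> el v" if "w \<in> D" for w
        using collapseD[OF col u(2) ab(1) uvD(1) that] collapseD[OF col v(2) ab(2) uvD(2) that] eq by blast
      then have "u = v" using el_eqI[OF uvD] by blast
      then show "a = b" using hinj[OF u(2)] v(2) ab uvD by blast
    qed
    show "\<forall>Q\<in>D. el R \<subseteq> el Q \<and>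
        (\<forall>x\<in>D. \<forall>y\<in>D. \<forall>z\<in>D. pr x y \<in> el Q \<and> pr y z \<in> el Q \<longrightarrow> pr x z \<in> el Q) \<longrightarrow>
        (\<forall>a\<in>el \<alpha>. a = em \<or> pr a em \<in> el Q)"
    proof (intro ballI impI)
      fix Q a assume Q: "Q \<in> D" and RQ: "el R \<subseteq> el Q \<and>
        (\<forall>x\<in>D. \<forall>y\<in>D. \<forall>z\<in>D. pr x y \<in> el Q \<and> pr y z \<in> el Q \<longrightarrow> pr x z \<in> el Q)" and a: "a \<in> el \<alpha>"
      \<comment> \<open>The members of \<open>t\<close> that are \<open>x\<close> or have an index
        Q-below 0. Passing to elements does not leave this set, as \<open>Q\<close> contains
        \<open>R\<close> and is transitive, so it is all of \<open>t\<close>.\<close>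
      have "\<exists>P\<in>D. el P = {w \<in> el t. w = x \<or> (\<exists>a\<in>D. pr a w \<in> el h \<and> pr a em \<in> el Q)}"
        by (rule separation) (use t(1) x h(1) Q in \<open>auto intro!: definable_intros\<close>)
      then obtain P where P: "P \<in> D" "el P = {w \<in> el t. w = x \<or> (\<exists>a\<in>D. pr a w \<in> el h \<and> pr a em \<in> el Q)}"
        by blast
      have "el t \<subseteq> el P"
      proof (rule t(4)[OF P(1)])
        show "x \<in> el P" using P(2) t(2) by blast
        fix z assume z: "z \<in> el P" "z \<in> el t"
        show "el z \<subseteq> el P"
        proof
          fix w assume w: "w \<in> el z"
          have wt: "w \<in> el t" using w z t(3) by blast
          obtain b where b: "b \<in> el \<alpha>" "pr b w \<in> el h" using honto[OF wt] by blast
          have bD: "b \<in> D" "w \<in> D" "z \<in> D" "em \<in> D" using b w z by auto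
          have "pr b em \<in> el Q"
          proof (cases "z = x")
            case True
            then have "pr b em \<in> el R" using Rval[OF b(2) h(3) b(1) em\<alpha>] w bD by blast
            then show ?thesis using RQ by blast
          next
            case False
            then obtain c where c: "c \<in> D" "pr c z \<in> el h" "pr c em \<in> el Q" using P(2) z by blast
            then have "pr b c \<in> el R" using Rval[OF b(2) c(2) b(1)] hdom(1) w bD by blast
            then have "pr b c \<in> el Q" using RQ by blast
            then show ?thesis using RQ c bD by blast
          qed
          then show "w \<in> el P" using P(2) wt b bD by blast
        qed
      qed
      moreover obtain w where w: "w \<in> el t" "pr a w \<in> el h" using htot[OF a] by blast
      ultimately have "w = x \<or> (\<exists>a\<in>D. pr a w \<in> el h \<and> pr a em \<in> el Q)" using P(2) by blast
      moreover have "a = em" if "w = x" using hinj[of a w em] w h(3) a x that by auto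
      moreover have "b = a" if "pr b w \<in> el h" "b \<in> D" for b using hinj[OF that(1) w(2) that(2)] a w by blast
      ultimately show "a = em \<or> pr a em \<in> el Q" by blast
    qed
  qed
  show ?thesis unfolding codes_def using y(1) R(1) rep \<alpha>(1) wfe h(1,3) col by blast
qed

end

section \<open>Evaluation of the coding formulas and of the axioms about \<kappa>\<close>

context set_structure
begin

lemma eval_FIff: "eval M e (\<phi> \<^bold>\<longleftrightarrow> \<psi>) \<longleftrightarrow> (eval M e \<phi> \<longleftrightarrow> eval M e \<psi>)"
  by auto

lemma eval_Is_WFE_on:
  assumes "teval M e \<kappa> \<in> D" "teval M e \<alpha> \<in> D" "teval M e R \<in> D"
  shows "eval M e (Is_WFE_on \<kappa> \<alpha> R) \<longleftrightarrow> wfe (teval M e \<kappa>) (teval M e \<alpha>) (teval M e R)"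
proof -
  let ?a = "teval M e \<alpha>" and ?R = "teval M e R"
  note rules = eval_rules eval_Subset
  have 1: "eval M e (Forall [\<alpha>, R] (\<lambda>x. x \<^bold>\<in> \<alpha> \<^bold>\<longleftrightarrow>
        x \<^bold>= Empty \<^bold>\<or> Exists [R, x] (\<lambda>y. OPair x y \<^bold>\<in> R \<^bold>\<or> OPair y x \<^bold>\<in> R))) \<longleftrightarrow>
      (\<forall>x\<in>D. x \<in> el ?a \<longleftrightarrow> x = em \<or> (\<exists>y\<in>D. pr x y \<in> el ?R \<or> pr y x \<in> el ?R))"
    using assms by (simp add: rules del: teval.simps(1) fun_upd_apply; blast)
  have 2: "eval M e (Forall [\<alpha>, R] (\<lambda>A. A \<^bold>\<subseteq> \<alpha> \<^bold>\<and> \<^bold>\<not> A \<^bold>= Empty \<^bold>\<longrightarrow>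
        Exists_in [R, A] A (\<lambda>x. Forall_in [R, A, x] A (\<lambda>y. \<^bold>\<not> OPair y x \<^bold>\<in> R)))) \<longleftrightarrow>
      (\<forall>A\<in>D. el A \<subseteq> el ?a \<and> A \<noteq> em \<longrightarrow> (\<exists>x\<in>el A. \<forall>y\<in>el A. pr y x \<notin> el ?R))"
    using assms by (simp add: rules del: teval.simps(1) fun_upd_apply; blast)
  have 3: "eval M e (Forall_in [\<alpha>, R] \<alpha> (\<lambda>x. Forall_in [\<alpha>, R, x] \<alpha> (\<lambda>y.
        Forall_in [\<alpha>, R, x, y] \<alpha> (\<lambda>z. OPair z x \<^bold>\<in> R \<^bold>\<longleftrightarrow> OPair z y \<^bold>\<in> R) \<^bold>\<longrightarrow> x \<^bold>= y))) \<longleftrightarrow>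
      (\<forall>x\<in>el ?a. \<forall>y\<in>el ?a. (\<forall>z\<in>el ?a. pr z x \<in> el ?R \<longleftrightarrow> pr z y \<in> el ?R) \<longrightarrow> x = y)"
    using assms by (simp add: rules del: teval.simps(1) fun_upd_apply; blast)
  have 4: "eval M e (Forall [\<alpha>, R] (\<lambda>Q.
        R \<^bold>\<subseteq> Q \<^bold>\<and>
        Forall [Q] (\<lambda>x. Forall [Q, x] (\<lambda>y. Forall [Q, x, y] (\<lambda>z.
          OPair x y \<^bold>\<in> Q \<^bold>\<and> OPair y z \<^bold>\<in> Q \<^bold>\<longrightarrow> OPair x z \<^bold>\<in> Q))) \<^bold>\<longrightarrow>
        Forall_in [\<alpha>, Q] \<alpha> (\<lambda>x. x \<^bold>= Empty \<^bold>\<or> OPair x Empty \<^bold>\<in> Q))) \<longleftrightarrow>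
      (\<forall>Q\<in>D. el ?R \<subseteq> el Q \<and>
        (\<forall>x\<in>D. \<forall>y\<in>D. \<forall>z\<in>D. pr x y \<in> el Q \<and> pr y z \<in> el Q \<longrightarrow> pr x z \<in> el Q) \<longrightarrow>
        (\<forall>x\<in>el ?a. x = em \<or> pr x em \<in> el Q))"
    using assms by (simp add: rules del: teval.simps(1) fun_upd_apply; blast)
  have 5: "eval M e (R \<^bold>\<subseteq> G2 G_Times \<kappa> \<kappa>) \<longleftrightarrow> el ?R \<subseteq> el (ti (teval M e \<kappa>) (teval M e \<kappa>))"
    using assms by (simp add: eval_Subset goedel_defs[symmetric])
  have 6: "eval M e (\<alpha> \<^bold>\<in> \<kappa> \<^bold>\<or> \<alpha> \<^bold>= \<kappa>) \<longleftrightarrow> ?a \<in> el (teval M e \<kappa>) \<or> ?a = teval M e \<kappa>"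
    using assms by (simp add: RelI_Mem)
  show ?thesis
    unfolding Is_WFE_on_def wfe_def eval.simps(5) 1 2 3 4 5 6 by (rule refl)
qed

lemma eval_Is_collapse:
  assumes "teval M e f \<in> D" "teval M e \<alpha> \<in> D" "teval M e R \<in> D"
  shows "eval M e (Is_collapse f \<alpha> R) \<longleftrightarrow> collapse (teval M e f) (teval M e \<alpha>) (teval M e R)"
  using assms
  by (simp add: Is_collapse_def collapse_def eval_Is_func eval_rules del: teval.simps(1) fun_upd_apply; blast)

lemma eval_Is_Cod:
  assumes "teval M e \<kappa> \<in> D" "teval M e R \<in> D" "teval M e x \<in> D"
  shows "eval M e (Is_Cod \<kappa> R x) \<longleftrightarrow> (\<exists>\<alpha>\<in>D. wfe (teval M e \<kappa>) \<alpha> (teval M e R) \<and>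
     (\<exists>f\<in>D. collapse f \<alpha> (teval M e R) \<and> pr em (teval M e x) \<in> el f))"
  using assms
  by (simp add: Is_Cod_def eval_Is_WFE_on eval_Is_collapse eval_rules del: teval.simps(1) fun_upd_apply)

lemma eval_Goedel_less:
  assumes "teval M e a \<in> D" "teval M e b \<in> D" "teval M e c \<in> D" "teval M e d \<in> D"
  shows "eval M e (Goedel_less a b c d) \<longleftrightarrow>
    goedel_less (teval M e a) (teval M e b) (teval M e c) (teval M e d)"
  using assms
  by (simp add: Goedel_less_def goedel_less_def bu_def eval_rules del: teval.simps(1) fun_upd_apply; blast)

lemma eval_Is_pairing:
  assumes "teval M e \<kappa> \<in> D" "teval M e g \<in> D"
  shows "eval M e (Is_pairing \<kappa> g) \<longleftrightarrow> pairing (teval M e \<kappa>) (teval M e g)"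
  using assms
  by (simp add: Is_pairing_def pairing_def eval_Is_func eval_Goedel_less eval_rules
      del: teval.simps(1) fun_upd_apply; blast)

lemma eval_Represents:
  assumes "teval M e \<kappa> \<in> D" "teval M e y \<in> D" "teval M e R \<in> D"
  shows "eval M e (Represents \<kappa> y R) \<longleftrightarrow> represents (teval M e \<kappa>) (teval M e y) (teval M e R)"
  using assms
  by (simp add: Represents_def represents_def eval_Is_pairing eval_Subset eval_rules
      del: teval.simps(1) fun_upd_apply; blast)

lemma eval_Codes:
  assumes "teval M e \<kappa> \<in> D" "teval M e y \<in> D" "teval M e x \<in> D"
  shows "eval M e (Codes \<kappa> y x) \<longleftrightarrow> codes (teval M e \<kappa>) (teval M e y) (teval M e x)"
  using assms
  by (simp add: Codes_def codes_def eval_Represents eval_Is_Cod eval_rules del: teval.simps(1) fun_upd_apply)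

text \<open>Inside (P3) codes and coded sets share one environment, with the codes moved up by n.
  Here they become separate environments Y and w, which can be chosen independently beyond n since
  \<phi> has no free variables there.\<close>

lemma P3_iff:
  assumes k: "k \<in> funs \<tau>" "farity \<tau> k = 0" and \<phi>: "fv \<phi> \<subseteq> {..<n}"
    and P3: "satisfies M (P3 (Fn k []) n \<phi> R)" and Y: "range Y \<subseteq> D"
  shows "RelI M R (map Y [0..<n]) \<longleftrightarrow>
    (\<exists>w. range w \<subseteq> D \<and> (\<forall>i<n. codes (FnI M k []) (Y i) (w i)) \<and> eval M w \<phi>)"
proof -
  \<comment> \<open>Truncated subtraction gives the variables below \<open>n\<close> the value
    \<open>Y 0\<close>; they are quantified next, so any point of the domain would do.\<close>
  let ?e = "\<lambda>v. Y (v - n)"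
  have kD: "FnI M k [] \<in> D" using FnI_D k by simp
  have e: "range ?e \<subseteq> D" using Y by auto
  have args: "map (teval M ?e) (vars [n..<n + n]) = map Y [0..<n]"
    by (rule nth_equalityI) simp_all
  have "satisfies M (FExs [0..<n] (FConj (map (\<lambda>i. Codes (Fn k []) (Var (n + i)) (Var i)) [0..<n]) \<^bold>\<and> \<phi>)
        \<^bold>\<longleftrightarrow> Rel R (vars [n..<n + n]))"
    using P3 unfolding P3_def satisfies_FAlls .
  then have "eval M ?e (FExs [0..<n] (FConj (map (\<lambda>i. Codes (Fn k []) (Var (n + i)) (Var i)) [0..<n]) \<^bold>\<and> \<phi>)
        \<^bold>\<longleftrightarrow> Rel R (vars [n..<n + n]))"
    using e unfolding satisfies_def by blast
  then have "RelI M R (map Y [0..<n]) \<longleftrightarrow>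
      eval M ?e (FExs [0..<n] (FConj (map (\<lambda>i. Codes (Fn k []) (Var (n + i)) (Var i)) [0..<n]) \<^bold>\<and> \<phi>))"
    unfolding eval_FIff eval.simps(3) args by blast
  also have "\<dots> \<longleftrightarrow> (\<exists>w. range w \<subseteq> D \<and> (\<forall>v. v \<notin> set [0..<n] \<longrightarrow> w v = Y (v - n)) \<and>
      (\<forall>i<n. codes (FnI M k []) (w (n + i)) (w i)) \<and> eval M w \<phi>)"
  proof -
    have "eval M w (Codes (Fn k []) (Var (n + i)) (Var i)) \<longleftrightarrow> codes (FnI M k []) (w (n + i)) (w i)"
      if "range w \<subseteq> D" for w i
      using eval_Codes[of w "Fn k []" "Var (n + i)" "Var i"] kD that by (simp add: image_subset_iff)
    then have "eval M w (FConj (map (\<lambda>i. Codes (Fn k []) (Var (n + i)) (Var i)) [0..<n]) \<^bold>\<and> \<phi>) \<longleftrightarrow>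
        (\<forall>i<n. codes (FnI M k []) (w (n + i)) (w i)) \<and> eval M w \<phi>" if "range w \<subseteq> D" for w
      using that by (auto simp: eval_FConj)
    then show ?thesis unfolding eval_FExs[OF e] by blast
  qed
  also have "\<dots> \<longleftrightarrow> (\<exists>w. range w \<subseteq> D \<and> (\<forall>i<n. codes (FnI M k []) (Y i) (w i)) \<and> eval M w \<phi>)"
  proof
    assume "\<exists>w. range w \<subseteq> D \<and> (\<forall>v. v \<notin> set [0..<n] \<longrightarrow> w v = Y (v - n)) \<and>
      (\<forall>i<n. codes (FnI M k []) (w (n + i)) (w i)) \<and> eval M w \<phi>"
    then obtain w where w: "range w \<subseteq> D" "\<forall>v. v \<notin> set [0..<n] \<longrightarrow> w v = Y (v - n)"
      "\<forall>i<n. codes (FnI M k []) (w (n + i)) (w i)" "eval M w \<phi>" by blast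
    moreover have "w (n + i) = Y i" for i using w(2) by simp
    ultimately show "\<exists>w. range w \<subseteq> D \<and> (\<forall>i<n. codes (FnI M k []) (Y i) (w i)) \<and> eval M w \<phi>" by auto
  next
    assume "\<exists>w. range w \<subseteq> D \<and> (\<forall>i<n. codes (FnI M k []) (Y i) (w i)) \<and> eval M w \<phi>"
    then obtain w where w: "range w \<subseteq> D" "\<forall>i<n. codes (FnI M k []) (Y i) (w i)" "eval M w \<phi>" by blast
    \<comment> \<open>From \<open>n\<close> on the witness has to repeat the codes, because the
      block of quantifiers changes only the variables below \<open>n\<close>.\<close>
    let ?w = "\<lambda>v. if v < n then w v else Y (v - n)"
    have "eval M ?w \<phi> = eval M w \<phi>" by (rule eval_cong) (use \<phi> in auto)
    then have "eval M ?w \<phi>" using w(3) by simp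
    moreover have "range ?w \<subseteq> D" using w(1) Y by auto
    ultimately show "\<exists>w. range w \<subseteq> D \<and> (\<forall>v. v \<notin> set [0..<n] \<longrightarrow> w v = Y (v - n)) \<and>
      (\<forall>i<n. codes (FnI M k []) (w (n + i)) (w i)) \<and> eval M w \<phi>"
      using w(2) by (intro exI[of _ ?w]) auto
  qed
  finally show ?thesis .
qed

lemma P7_iff:
  assumes k: "k \<in> funs \<tau>" "farity \<tau> k = 0"
    and P7: "satisfies M (P7 \<tau> (Fn k []) R i U)" and Y: "range Y \<subseteq> D"
  shows "RelI M U (map Y ([0..<i] @ [Suc i..<rarity \<tau> R])) \<longleftrightarrow>
    (\<exists>a\<in>D. el a \<subseteq> el (FnI M k []) \<and> RelI M R (map (Y(i := a)) [0..<rarity \<tau> R]))"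
proof -
  have kD: "FnI M k [] \<in> D" using FnI_D k by simp
  have map_vars: "map (teval M e) (vars xs) = map e xs" for e xs by simp
  have "eval M Y (Rel U (vars ([0..<i] @ [Suc i..<rarity \<tau> R])) \<^bold>\<longleftrightarrow>
      FEx i (Var i \<^bold>\<subseteq> Fn k [] \<^bold>\<and> Rel R (vars [0..<rarity \<tau> R])))"
    using P7 Y unfolding P7_def Let_def satisfies_FAlls unfolding satisfies_def by (elim allE impE)
  then have "RelI M U (map Y ([0..<i] @ [Suc i..<rarity \<tau> R])) \<longleftrightarrow>
      (\<exists>a\<in>D. eval M (Y(i := a)) (Var i \<^bold>\<subseteq> Fn k []) \<and> RelI M R (map (Y(i := a)) [0..<rarity \<tau> R]))"
    unfolding eval_FIff unfolding eval.simps(3,5,6) map_vars .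
  moreover have "eval M (Y(i := a)) (Var i \<^bold>\<subseteq> Fn k []) \<longleftrightarrow> el a \<subseteq> el (FnI M k [])" if "a \<in> D" for a
    using eval_Subset[of "Y(i := a)" "Var i" "Fn k []"] that kD by simp
  ultimately show ?thesis by blast
qed

lemma surjection_ax_iff:
  assumes k: "k \<in> funs \<tau>" "farity \<tau> k = 0" and "satisfies M (surjection_ax (Fn k []))"
    and x: "x \<in> D" "x \<noteq> em"
  shows "\<exists>s\<in>D. surj_on s (FnI M k []) x"
proof -
  have kD: "FnI M k [] \<in> D" using FnI_D k by simp
  have "eval M (\<lambda>_. default) (surjection_ax (Fn k []))"
    using assms(3) unfolding satisfies_def by auto
  then have "\<forall>x\<in>D. x \<noteq> em \<longrightarrow> (\<exists>s\<in>D. surj_on s (FnI M k []) x)"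
    using kD by (simp add: surjection_ax_def eval_rules eval_Is_surj del: teval.simps(1) fun_upd_apply; blast)
  then show ?thesis using x by blast
qed

lemma P1_iff:
  assumes k: "k \<in> funs \<tau>" "farity \<tau> k = 0" and "satisfies M (P1 (Fn k []))"
  shows "cardinal (FnI M k [])"
proof -
  have kD: "FnI M k [] \<in> D" using FnI_D k by simp
  have "eval M (\<lambda>_. default) (P1 (Fn k []))"
    using assms(3) unfolding satisfies_def by auto
  then show ?thesis using kD eval_Is_card[of "\<lambda>_. default" "Fn k []"] by (simp add: P1_def)
qed

end

section \<open>Translation into quantifier-free formulas about codes\<close>

context set_structure
begin

text \<open>The recursion removes the outermost code. This matches the way in which levels arise, by
  applying (P3) to a formula that already speaks about l-fold codes.\<close>

primrec code_pow :: "'u \<Rightarrow> nat \<Rightarrow> 'u \<Rightarrow> 'u \<Rightarrow> bool" where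
  "code_pow \<kappa> 0 y x \<longleftrightarrow> y = x"
| "code_pow \<kappa> (Suc l) y x \<longleftrightarrow> (\<exists>z\<in>D. codes \<kappa> y z \<and> code_pow \<kappa> l z x)"

end

locale coded_model = zf_model \<tau> M for \<tau> :: "('f, 'r) ssig" and M :: "('f fsym, 'r rsym, 'u) model" +
  fixes k :: "'f fsym"
  assumes k: "k \<in> funs \<tau>" "farity \<tau> k = 0" and card: "cardinal (FnI M k [])"
    and surj: "\<And>x. x \<in> D \<Longrightarrow> x \<noteq> em \<Longrightarrow> \<exists>s\<in>D. surj_on s (FnI M k []) x"
begin

abbreviation kp :: 'u where "kp \<equiv> FnI M k []"

lemma kp: "ordinal kp" "kp \<in> D"
  using card FnI_D k unfolding cardinal_def by auto

lemma code_pow_unique: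
  "y \<in> D \<Longrightarrow> x \<in> D \<Longrightarrow> x' \<in> D \<Longrightarrow> code_pow kp l y x \<Longrightarrow> code_pow kp l y x' \<Longrightarrow> x = x'"
proof (induction l arbitrary: y)
  case (Suc l)
  from Suc.prems obtain z z' where z: "z \<in> D" "codes kp y z" "code_pow kp l z x"
    and z': "z' \<in> D" "codes kp y z'" "code_pow kp l z' x'" by auto
  have "z = z'" using codes_unique[OF kp Suc.prems(1) z(1) z'(1) z(2) z'(2)] .
  then show ?case using Suc.IH[OF z(1) Suc.prems(2,3)] z z' by blast
qed auto

lemma code_pow_exists: "x \<in> D \<Longrightarrow> \<exists>y\<in>D. code_pow kp l y x"
proof (induction l)
  case (Suc l)
  then obtain z where z: "z \<in> D" "code_pow kp l z x" by blast
  obtain y where "y \<in> D" "codes kp y z" using code_exists[OF card kp(2) surj z(1)] by blast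
  then show ?case using z by auto
qed auto

lemma code_pow_subset: "code_pow kp (Suc l) y x \<Longrightarrow> el y \<subseteq> el kp"
  unfolding code_pow.simps codes_def represents_def by blast

text \<open>Only the first n entries are tied to Y; the other values of w are arbitrary points of
  the domain, because an environment has to be total.\<close>

definition coded :: "nat \<Rightarrow> nat \<Rightarrow> (nat \<Rightarrow> 'u) \<Rightarrow> (nat \<Rightarrow> 'u) \<Rightarrow> bool" where
  "coded n l Y w \<longleftrightarrow> range w \<subseteq> D \<and> (\<forall>i<n. code_pow kp l (Y i) (w i))"

lemma coded_unique: "range Y \<subseteq> D \<Longrightarrow> coded n l Y w \<Longrightarrow> coded n l Y w' \<Longrightarrow> i < n \<Longrightarrow> w i = w' i"
  unfolding coded_def by (meson code_pow_unique range_subsetD)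

lemma coded_eval:
  "range Y \<subseteq> D \<Longrightarrow> coded n l Y w \<Longrightarrow> coded n l Y w' \<Longrightarrow> fv \<phi> \<subseteq> {..<n} \<Longrightarrow> eval M w \<phi> = eval M w' \<phi>"
  by (intro eval_cong coded_unique[of Y n l w w']) auto

lemma coded_exists:
  assumes "range w \<subseteq> D"
  shows "\<exists>Y. range Y \<subseteq> D \<and> coded n l Y w"
proof -
  have "\<forall>i. \<exists>y. y \<in> D \<and> code_pow kp l y (w i)" using assms code_pow_exists by blast
  then obtain Y where "\<forall>i. Y i \<in> D \<and> code_pow kp l (Y i) (w i)" by metis
  then show ?thesis using assms unfolding coded_def by blast
qed

lemma coded_update:
  "coded n l Z w \<Longrightarrow> b \<in> D \<Longrightarrow> code_pow kp l a b \<Longrightarrow> coded n l (Z(i := a)) (w(i := b))"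
  unfolding coded_def by auto

text \<open>Splits off a tuple Y of intermediate codes, which is the tuple over which (P3)
  quantifies.\<close>

lemma coded_Suc:
  assumes Z: "range Z \<subseteq> D"
  shows "coded n (Suc l) Z w \<longleftrightarrow>
    (\<exists>Y. range Y \<subseteq> D \<and> (\<forall>i<n. codes kp (Z i) (Y i)) \<and> coded n l Y w)"
proof
  assume c: "coded n (Suc l) Z w"
  then have "\<forall>i. \<exists>z. i < n \<longrightarrow> z \<in> D \<and> codes kp (Z i) z \<and> code_pow kp l z (w i)"
    unfolding coded_def by auto
  then obtain f where f: "\<And>i. i < n \<Longrightarrow> f i \<in> D \<and> codes kp (Z i) (f i) \<and> code_pow kp l (f i) (w i)" by metis
  \<comment> \<open>From \<open>n\<close> on the value only has to lie in the domain, and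
    \<open>Z i\<close> does.\<close>
  define Y where "Y i = (if i < n then f i else Z i)" for i
  have "range Y \<subseteq> D" using f Z by (auto simp: Y_def)
  moreover have "\<forall>i<n. codes kp (Z i) (Y i)" "coded n l Y w"
    using f c by (auto simp: Y_def coded_def)
  ultimately show "\<exists>Y. range Y \<subseteq> D \<and> (\<forall>i<n. codes kp (Z i) (Y i)) \<and> coded n l Y w" by blast
next
  assume "\<exists>Y. range Y \<subseteq> D \<and> (\<forall>i<n. codes kp (Z i) (Y i)) \<and> coded n l Y w"
  then obtain Y where Y: "range Y \<subseteq> D" "\<forall>i<n. codes kp (Z i) (Y i)" "coded n l Y w" by blast
  moreover have "Y i \<in> D" for i using Y(1) by blast
  ultimately show "coded n (Suc l) Z w" unfolding coded_def by auto
qed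

end

text \<open>Bound variables are counted as well: a formula and its subformulas are translated with
  the same n, and a quantified variable must be among the n arguments in order to be
  projected.\<close>

fun qvars :: "('f, 'r) fm \<Rightarrow> nat set" where
  "qvars (\<^bold>\<not> \<phi>) = qvars \<phi>"
| "qvars (\<phi> \<^bold>\<and> \<psi>) = qvars \<phi> \<union> qvars \<psi>"
| "qvars (FEx v \<phi>) = insert v (qvars \<phi>)"
| "qvars _ = {}"

lemma finite_qvars: "finite (qvars \<phi>)"
  by (induction \<phi>) auto

text \<open>The predicates R and V are chosen before the model, hence uniformly for
  \<open>Mods\<close>; this is what makes one translation correct in both models of an extension.
  The projections V are attached to R because (P7) offers them for the predicates obtained from
  (P3), not for arbitrary formulas.\<close>

locale projective_models =
  fixes \<tau> :: "('f, 'r) ssig" and k :: "'f fsym" and Mods :: "('f fsym, 'r rsym, 'u) model set"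
  assumes coded_model: "\<And>M. M \<in> Mods \<Longrightarrow> coded_model \<tau> M k"
    and projection: "\<And>n \<phi>. is_qf_fm \<tau> n \<phi> \<Longrightarrow> \<exists>R\<in>rels \<tau>. rarity \<tau> R = n \<and>
      (\<forall>M\<in>Mods. satisfies M (P3 (Fn k []) n \<phi> R)) \<and>
      (\<forall>i<n. \<exists>V\<in>rels \<tau>. Suc (rarity \<tau> V) = n \<and> (\<forall>M\<in>Mods. satisfies M (P7 \<tau> (Fn k []) R i V)))"
begin

text \<open>Conjunctions and negations of predicates from \<open>\<tau>\<^sub>0\<close> with common arguments are again
  quantifier-free, hence represented at the cost of a further level \<open>l\<close> of coding.\<close>
definition translates :: "nat \<Rightarrow> nat \<Rightarrow> ('f, 'r) sfm \<Rightarrow> ('f, 'r) sfm \<Rightarrow> bool" where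
  "translates n l \<chi> \<phi> \<longleftrightarrow> is_qf_fm \<tau> n \<chi> \<and>
     (\<forall>M\<in>Mods. \<forall>Y. range Y \<subseteq> Dom M \<longrightarrow>
        (eval M Y \<chi> \<longleftrightarrow> (\<exists>w. coded_model.coded M k n l Y w \<and> eval M w \<phi>)))"

lemma translates_qf:
  assumes \<phi>: "is_qf_fm \<tau> n \<phi>"
  shows "translates n 0 \<phi> \<phi>"
  unfolding translates_def
proof (intro conjI ballI allI impI)
  fix M and Y :: "nat \<Rightarrow> 'u" assume "M \<in> Mods" and Y: "range Y \<subseteq> Dom M"
  then interpret coded_model \<tau> M k by (simp add: coded_model)
  have "coded n 0 Y Y" using Y by (simp add: coded_def)
  moreover have "fv \<phi> \<subseteq> {..<n}" using \<phi> by (simp add: is_qf_fm_def)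
  ultimately show "eval M Y \<phi> \<longleftrightarrow> (\<exists>w. coded n 0 Y w \<and> eval M w \<phi>)"
    using coded_eval[OF Y] by blast
qed (rule \<phi>)

lemma is_qf_Rel: "R \<in> rels \<tau> \<Longrightarrow> length vs = rarity \<tau> R \<Longrightarrow> set vs \<subseteq> {..<n} \<Longrightarrow> is_qf_fm \<tau> n (Rel R (vars vs))"
  by (auto simp: is_qf_fm_def)

text \<open>(P3) for \<chi> itself gives a predicate saying that Z codes a tuple which satisfies
  \<chi>. Besides raising the level, this turns the translation into a single predicate, the form in
  which it can be projected.\<close>

lemma translates_lift:
  assumes \<chi>: "translates n l \<chi> \<phi>"
  shows "\<exists>R\<in>rels \<tau>. rarity \<tau> R = n \<and> translates n (Suc l) (Rel R (vars [0..<n])) \<phi> \<and>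
    (\<forall>i<n. \<exists>V\<in>rels \<tau>. Suc (rarity \<tau> V) = n \<and> (\<forall>M\<in>Mods. satisfies M (P7 \<tau> (Fn k []) R i V)))"
proof -
  have qf: "is_qf_fm \<tau> n \<chi>" using \<chi> unfolding translates_def by blast
  obtain R where R: "R \<in> rels \<tau>" "rarity \<tau> R = n" "\<And>M. M \<in> Mods \<Longrightarrow> satisfies M (P3 (Fn k []) n \<chi> R)"
    "\<forall>i<n. \<exists>V\<in>rels \<tau>. Suc (rarity \<tau> V) = n \<and> (\<forall>M\<in>Mods. satisfies M (P7 \<tau> (Fn k []) R i V))"
    using projection[OF qf] by blast
  have "translates n (Suc l) (Rel R (vars [0..<n])) \<phi>" unfolding translates_def
  proof (intro conjI ballI allI impI)
    show "is_qf_fm \<tau> n (Rel R (vars [0..<n]))" using R(1,2) by (intro is_qf_Rel) auto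
    fix M and Z :: "nat \<Rightarrow> 'u" assume M: "M \<in> Mods" and Z: "range Z \<subseteq> Dom M"
    then interpret coded_model \<tau> M k by (simp add: coded_model)
    have \<chi>M: "eval M Y \<chi> \<longleftrightarrow> (\<exists>w. coded n l Y w \<and> eval M w \<phi>)" if "range Y \<subseteq> D" for Y
      using \<chi> M that unfolding translates_def by blast
    have "eval M Z (Rel R (vars [0..<n])) \<longleftrightarrow> RelI M R (map Z [0..<n])"
      by (simp add: comp_def)
    also have "\<dots> \<longleftrightarrow> (\<exists>Y. range Y \<subseteq> D \<and> (\<forall>i<n. codes kp (Z i) (Y i)) \<and> eval M Y \<chi>)"
      using qf by (intro P3_iff k R(3)[OF M] Z) (simp add: is_qf_fm_def)
    also have "\<dots> \<longleftrightarrow> (\<exists>w. coded n (Suc l) Z w \<and> eval M w \<phi>)"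
    proof
      assume "\<exists>Y. range Y \<subseteq> D \<and> (\<forall>i<n. codes kp (Z i) (Y i)) \<and> eval M Y \<chi>"
      then obtain Y where Y: "range Y \<subseteq> D" "\<forall>i<n. codes kp (Z i) (Y i)" "eval M Y \<chi>" by (elim exE conjE)
      then obtain w where w: "coded n l Y w" "eval M w \<phi>" unfolding \<chi>M[OF Y(1)] by (elim exE conjE)
      have "coded n (Suc l) Z w"
        unfolding coded_Suc[OF Z] using Y(1,2) w(1) by (intro exI conjI)
      then show "\<exists>w. coded n (Suc l) Z w \<and> eval M w \<phi>" using w(2) by (intro exI conjI)
    next
      assume "\<exists>w. coded n (Suc l) Z w \<and> eval M w \<phi>"
      then obtain w where w: "coded n (Suc l) Z w" "eval M w \<phi>" by (elim exE conjE)
      then obtain Y where Y: "range Y \<subseteq> D" "\<forall>i<n. codes kp (Z i) (Y i)" "coded n l Y w"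
        unfolding coded_Suc[OF Z] by (elim exE conjE)
      have "eval M Y \<chi>" unfolding \<chi>M[OF Y(1)] using Y(3) w(2) by (intro exI conjI)
      then show "\<exists>Y. range Y \<subseteq> D \<and> (\<forall>i<n. codes kp (Z i) (Y i)) \<and> eval M Y \<chi>"
        using Y(1,2) by (intro exI conjI)
    qed
    finally show "eval M Z (Rel R (vars [0..<n])) \<longleftrightarrow> (\<exists>w. coded n (Suc l) Z w \<and> eval M w \<phi>)" .
  qed
  then show ?thesis using R by blast
qed

lemma translates_mono: "translates n l \<chi> \<phi> \<Longrightarrow> l \<le> l' \<Longrightarrow> \<exists>\<chi>'. translates n l' \<chi>' \<phi>"
proof (induction l')
  case (Suc l')
  then show ?case using translates_lift by (metis le_Suc_eq)
qed auto

text \<open>Such a formula says that the first n entries are l-fold codes, which is a restriction as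
  soon as l > 0.\<close>

lemma translates_True: "\<exists>\<chi>. translates n l \<chi> FTrue"
  by (rule translates_mono[OF translates_qf]) (simp_all add: is_qf_fm_def)

text \<open>Decodings agree below n, so \<phi> fails for one of them iff it fails for all. The
  conjunct \<theta> keeps tuples without any decoding from satisfying the negation.\<close>

lemma translates_FNot:
  assumes \<chi>: "translates n l \<chi> \<phi>" and fv: "fv \<phi> \<subseteq> {..<n}"
  shows "\<exists>\<chi>'. translates n l \<chi>' (\<^bold>\<not> \<phi>)"
proof -
  obtain \<theta> where \<theta>: "translates n l \<theta> FTrue" using translates_True by blast
  have "translates n l (\<^bold>\<not> \<chi> \<^bold>\<and> \<theta>) (\<^bold>\<not> \<phi>)" unfolding translates_def
  proof (intro conjI ballI allI impI)
    show "is_qf_fm \<tau> n (\<^bold>\<not> \<chi> \<^bold>\<and> \<theta>)" using \<chi> \<theta> unfolding translates_def is_qf_fm_def by simp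
    fix M and Y :: "nat \<Rightarrow> 'u" assume M: "M \<in> Mods" and Y: "range Y \<subseteq> Dom M"
    then interpret coded_model \<tau> M k by (simp add: coded_model)
    have "eval M Y \<chi> \<longleftrightarrow> (\<exists>w. coded n l Y w \<and> eval M w \<phi>)" "eval M Y \<theta> \<longleftrightarrow> (\<exists>w. coded n l Y w)"
      using \<chi> \<theta> M Y unfolding translates_def by simp_all
    moreover have "eval M w \<phi> = eval M w' \<phi>" if "coded n l Y w" "coded n l Y w'" for w w'
      by (rule coded_eval[OF Y that fv])
    ultimately show "eval M Y (\<^bold>\<not> \<chi> \<^bold>\<and> \<theta>) \<longleftrightarrow> (\<exists>w. coded n l Y w \<and> eval M w (\<^bold>\<not> \<phi>))"
      unfolding eval.simps by blast
  qed
  then show ?thesis by blast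
qed

text \<open>Both translations are raised to a common level, where uniqueness of decoding lets one
  tuple w serve both conjuncts.\<close>

lemma translates_FAnd:
  assumes \<phi>: "translates n l \<chi> \<phi>" "fv \<phi> \<subseteq> {..<n}" and \<psi>: "translates n l' \<chi>' \<psi>" "fv \<psi> \<subseteq> {..<n}"
  shows "\<exists>m \<theta>. translates n m \<theta> (\<phi> \<^bold>\<and> \<psi>)"
proof -
  define m where "m = max l l'"
  obtain \<alpha> \<beta> where \<alpha>: "translates n m \<alpha> \<phi>" and \<beta>: "translates n m \<beta> \<psi>"
    using translates_mono[OF \<phi>(1), of m] translates_mono[OF \<psi>(1), of m] by (auto simp: m_def)
  have "translates n m (\<alpha> \<^bold>\<and> \<beta>) (\<phi> \<^bold>\<and> \<psi>)" unfolding translates_def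
  proof (intro conjI ballI allI impI)
    show "is_qf_fm \<tau> n (\<alpha> \<^bold>\<and> \<beta>)" using \<alpha> \<beta> unfolding translates_def is_qf_fm_def by simp
    fix M and Y :: "nat \<Rightarrow> 'u" assume M: "M \<in> Mods" and Y: "range Y \<subseteq> Dom M"
    then interpret coded_model \<tau> M k by (simp add: coded_model)
    have "eval M Y \<alpha> \<longleftrightarrow> (\<exists>w. coded n m Y w \<and> eval M w \<phi>)" "eval M Y \<beta> \<longleftrightarrow> (\<exists>w. coded n m Y w \<and> eval M w \<psi>)"
      using \<alpha> \<beta> M Y unfolding translates_def by simp_all
    moreover have "eval M w \<phi> = eval M w' \<phi>" if "coded n m Y w" "coded n m Y w'" for w w'
      by (rule coded_eval[OF Y that \<phi>(2)])
    ultimately show "eval M Y (\<alpha> \<^bold>\<and> \<beta>) \<longleftrightarrow> (\<exists>w. coded n m Y w \<and> eval M w (\<phi> \<^bold>\<and> \<psi>))"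
      unfolding eval.simps by blast
  qed
  then show ?thesis by blast
qed

text \<open>The additional level serves two ends: the translation becomes a predicate, and codes
  become subsets of \<kappa>, so that a quantifier over sets becomes the projection (P7). The
  projection says nothing about entry i of Z, which nevertheless has to be a code; \<theta> takes
  care of this.\<close>

lemma translates_FEx:
  assumes \<chi>: "translates n l \<chi> \<phi>" and fv: "fv \<phi> \<subseteq> {..<n}" and i: "i < n"
  shows "\<exists>m \<theta>. translates n m \<theta> (FEx i \<phi>)"
proof -
  obtain R where R: "R \<in> rels \<tau>" "rarity \<tau> R = n" "translates n (Suc l) (Rel R (vars [0..<n])) \<phi>"
    "\<forall>i<n. \<exists>V\<in>rels \<tau>. Suc (rarity \<tau> V) = n \<and> (\<forall>M\<in>Mods. satisfies M (P7 \<tau> (Fn k []) R i V))"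
    using translates_lift[OF \<chi>] by blast
  obtain V where V: "V \<in> rels \<tau>" "Suc (rarity \<tau> V) = n" "\<And>M. M \<in> Mods \<Longrightarrow> satisfies M (P7 \<tau> (Fn k []) R i V)"
    using R(4) i by blast
  obtain \<theta> where \<theta>: "translates n (Suc l) \<theta> FTrue" using translates_True by blast
  let ?xs = "[0..<i] @ [Suc i..<n]"
  have "translates n (Suc l) (Rel V (vars ?xs) \<^bold>\<and> \<theta>) (FEx i \<phi>)" unfolding translates_def
  proof (intro conjI ballI allI impI)
    have "is_qf_fm \<tau> n (Rel V (vars ?xs))" using V(1,2) i by (intro is_qf_Rel) auto
    then show "is_qf_fm \<tau> n (Rel V (vars ?xs) \<^bold>\<and> \<theta>)" using \<theta> unfolding translates_def is_qf_fm_def by simp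
    fix M and Z :: "nat \<Rightarrow> 'u" assume M: "M \<in> Mods" and Z: "range Z \<subseteq> Dom M"
    then interpret coded_model \<tau> M k by (simp add: coded_model)
    have Za: "range (Z(i := a)) \<subseteq> D" if "a \<in> D" for a using Z that by auto
    have \<theta>M: "eval M Z \<theta> \<longleftrightarrow> (\<exists>w. coded n (Suc l) Z w)"
      using \<theta> M Z unfolding translates_def by simp
    have RM: "RelI M R (map (Z(i := a)) [0..<n]) \<longleftrightarrow> (\<exists>w. coded n (Suc l) (Z(i := a)) w \<and> eval M w \<phi>)"
      if "a \<in> D" for a
    proof -
      have "eval M (Z(i := a)) (Rel R (vars [0..<n])) \<longleftrightarrow> (\<exists>w. coded n (Suc l) (Z(i := a)) w \<and> eval M w \<phi>)"
        using R(3) M Za[OF that] unfolding translates_def by blast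
      then show ?thesis by (simp add: comp_def del: fun_upd_apply)
    qed
    have VM: "eval M Z (Rel V (vars ?xs)) \<longleftrightarrow> (\<exists>a\<in>D. el a \<subseteq> el kp \<and> RelI M R (map (Z(i := a)) [0..<n]))"
    proof -
      have "eval M Z (Rel V (vars ?xs)) \<longleftrightarrow> RelI M V (map Z ?xs)" by (simp add: comp_def)
      then show ?thesis using P7_iff[OF k V(3)[OF M] Z] R(2) by simp
    qed
    show "eval M Z (Rel V (vars ?xs) \<^bold>\<and> \<theta>) \<longleftrightarrow> (\<exists>w. coded n (Suc l) Z w \<and> eval M w (FEx i \<phi>))"
    proof
      assume "eval M Z (Rel V (vars ?xs) \<^bold>\<and> \<theta>)"
      then have "eval M Z (Rel V (vars ?xs))" "eval M Z \<theta>" by simp_all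
      then obtain a w w' where a: "a \<in> D" and w': "coded n (Suc l) (Z(i := a)) w'" "eval M w' \<phi>"
        and w: "coded n (Suc l) Z w"
        using VM RM \<theta>M by blast
      have w'D: "w' i \<in> D" using w'(1) unfolding coded_def by blast
      have "code_pow kp (Suc l) ((Z(i := a)) i) (w' i)" using w'(1) i unfolding coded_def by blast
      then have "coded n (Suc l) (Z(i := a)) (w(i := w' i))"
        using coded_update[OF w w'D, of a i] by (simp only: fun_upd_same)
      then have "eval M (w(i := w' i)) \<phi>" using coded_eval[OF Za[OF a] w'(1) _ fv] w'(2) by blast
      then have "eval M w (FEx i \<phi>)" using w'D by auto
      then show "\<exists>w. coded n (Suc l) Z w \<and> eval M w (FEx i \<phi>)" using w by blast
    next
      assume "\<exists>w. coded n (Suc l) Z w \<and> eval M w (FEx i \<phi>)"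
      then obtain w b where w: "coded n (Suc l) Z w" and b: "b \<in> D" "eval M (w(i := b)) \<phi>" by auto
      obtain a where a: "a \<in> D" "code_pow kp (Suc l) a b" using code_pow_exists[OF b(1)] by blast
      have "coded n (Suc l) (Z(i := a)) (w(i := b))" by (rule coded_update[OF w b(1) a(2)])
      then have "eval M Z (Rel V (vars ?xs))"
        using VM RM[OF a(1)] a code_pow_subset b(2) by blast
      then show "eval M Z (Rel V (vars ?xs) \<^bold>\<and> \<theta>)" using \<theta>M w unfolding eval.simps by blast
    qed
  qed
  then show ?thesis by blast
qed

theorem translation:
  "is_fm \<tau> \<phi> \<Longrightarrow> fv \<phi> \<union> qvars \<phi> \<subseteq> {..<n} \<Longrightarrow> \<exists>l \<chi>. translates n l \<chi> \<phi>"
proof (induction \<phi>)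
  case (FNot \<phi>)
  then show ?case using translates_FNot[of n _ _ \<phi>] by (metis fv.simps(4) is_fm.simps(4) le_sup_iff qvars.simps(1))
next
  case (FAnd \<phi> \<psi>)
  then obtain l \<chi> l' \<chi>' where "translates n l \<chi> \<phi>" "translates n l' \<chi>' \<psi>" by auto
  then show ?case using translates_FAnd[of n l \<chi> \<phi> l' \<chi>' \<psi>] FAnd.prems by auto
next
  case (FEx v \<phi>)
  then have "fv \<phi> \<subseteq> {..<n}" "v < n" "qvars \<phi> \<subseteq> {..<n}" by auto
  moreover from this obtain l \<chi> where "translates n l \<chi> \<phi>" using FEx by auto
  ultimately show ?case using translates_FEx by blast
next
  case FTrue
  then have "is_qf_fm \<tau> n FTrue" by (simp add: is_qf_fm_def)
  then show ?case using translates_qf by blast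
next
  case (FEq s t)
  then have "is_qf_fm \<tau> n (s \<^bold>= t)" by (simp add: is_qf_fm_def)
  then show ?case using translates_qf by blast
next
  case (Rel R ts)
  then have "is_qf_fm \<tau> n (Rel R ts)" by (simp add: is_qf_fm_def)
  then show ?case using translates_qf by blast
qed

end

section \<open>Absoluteness and model completeness\<close>

lemma teval_substructure:
  assumes "substructure \<tau> M N" "is_structure \<tau> M" "range e \<subseteq> Dom M"
  shows "is_tm \<tau> t \<Longrightarrow> teval M e t = teval N e t \<and> teval M e t \<in> Dom M"
proof (induction t)
  case (Var v)
  then show ?case using assms(3) by auto
next
  case (Fn f ts)
  then have f: "f \<in> funs \<tau>" "length ts = farity \<tau> f"
    and ts_tm: "\<And>t. t \<in> set ts \<Longrightarrow> is_tm \<tau> t" by auto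
  have ts: "teval M e t = teval N e t \<and> teval M e t \<in> Dom M" if "t \<in> set ts" for t
    by (rule Fn.IH[OF that ts_tm[OF that]])
  have "map (teval M e) ts = map (teval N e) ts" using ts by simp
  moreover have "set (map (teval M e) ts) \<subseteq> Dom M" unfolding set_map using ts by blast
  ultimately show ?case
    using assms(1,2) f unfolding substructure_def is_structure_def
    by (simp del: map_eq_conv)
qed

lemma eval_qf_substructure:
  assumes "substructure \<tau> M N" "is_structure \<tau> M" "range e \<subseteq> Dom M"
  shows "is_fm \<tau> \<phi> \<Longrightarrow> quantifier_free \<phi> \<Longrightarrow> eval M e \<phi> = eval N e \<phi>"
proof (induction \<phi>)
  case (Rel r ts)
  have ts: "teval M e t = teval N e t \<and> teval M e t \<in> Dom M" if "t \<in> set ts" for t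
    using that Rel.prems by (intro teval_substructure[OF assms]) auto
  have "map (teval M e) ts = map (teval N e) ts" using ts by simp
  moreover have "set (map (teval M e) ts) \<subseteq> Dom M" unfolding set_map using ts by blast
  ultimately show ?case
    using assms(1) Rel.prems unfolding substructure_def
    by (simp del: map_eq_conv)
qed (use teval_substructure[OF assms] in auto)

locale model_extension = m: coded_model \<tau> M k + n: coded_model \<tau> N k
  for \<tau> :: "('f, 'r) ssig" and M N :: "('f fsym, 'r rsym, 'u) model" and k :: "'f fsym" +
  assumes sub: "substructure \<tau> M N"
begin

lemma FnI_eq: "f \<in> funs \<tau> \<Longrightarrow> length as = farity \<tau> f \<Longrightarrow> set as \<subseteq> Dom M \<Longrightarrow> FnI N f as = FnI M f as"
  using sub unfolding substructure_def by simp

lemma Dom_mono: "x \<in> Dom M \<Longrightarrow> x \<in> Dom N"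
  using sub unfolding substructure_def by blast

lemma kp_eq: "FnI N k [] = FnI M k []"
  using FnI_eq m.k by simp

text \<open>Membership is compared between points of M only; in N the point y may have further
  elements that lie outside M.\<close>

lemma el_eq: "x \<in> Dom M \<Longrightarrow> y \<in> Dom M \<Longrightarrow> x \<in> n.el y \<longleftrightarrow> x \<in> m.el y"
  using sub Dom_mono m.rels_Mem unfolding substructure_def m.el_def n.el_def by simp

lemma goedel_eq:
  "x \<in> Dom M \<Longrightarrow> y \<in> Dom M \<Longrightarrow> n.up x y = m.up x y"
  "x \<in> Dom M \<Longrightarrow> y \<in> Dom M \<Longrightarrow> n.ti x y = m.ti x y"
  "x \<in> Dom M \<Longrightarrow> y \<in> Dom M \<Longrightarrow> n.ep x y = m.ep x y"
  "x \<in> Dom M \<Longrightarrow> y \<in> Dom M \<Longrightarrow> n.df x y = m.df x y"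
  "x \<in> Dom M \<Longrightarrow> y \<in> Dom M \<Longrightarrow> n.it x y = m.it x y"
  "x \<in> Dom M \<Longrightarrow> n.un x = m.un x"
  "x \<in> Dom M \<Longrightarrow> n.dm x = m.dm x"
  "x \<in> Dom M \<Longrightarrow> n.cv x = m.cv x"
  "x \<in> Dom M \<Longrightarrow> n.sw x = m.sw x"
  "x \<in> Dom M \<Longrightarrow> n.ro x = m.ro x"
  "n.em = m.em"
  unfolding n.goedel_defs m.goedel_defs by (rule FnI_eq; simp add: m.farity_D0)+

lemma pr_eq: "x \<in> Dom M \<Longrightarrow> y \<in> Dom M \<Longrightarrow> n.pr x y = m.pr x y"
  and bu_eq: "x \<in> Dom M \<Longrightarrow> y \<in> Dom M \<Longrightarrow> n.bu x y = m.bu x y"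
  and cmp_eq: "x \<in> Dom M \<Longrightarrow> y \<in> Dom M \<Longrightarrow> n.cmp x y = m.cmp x y"
  unfolding n.pr_def m.pr_def n.bu_def m.bu_def n.cmp_def m.cmp_def by (simp_all add: goedel_eq)

lemma neq_eq: "x \<in> Dom M \<Longrightarrow> n.neq x = m.neq x"
  and eqk_eq: "x \<in> Dom M \<Longrightarrow> n.eqk x = m.eqk x"
  and pull_eq: "x \<in> Dom M \<Longrightarrow> y \<in> Dom M \<Longrightarrow> z \<in> Dom M \<Longrightarrow> n.pull x y z = m.pull x y z"
  unfolding n.neq_def m.neq_def n.eqk_def m.eqk_def n.pull_def m.pull_def Let_def
  by (simp_all add: goedel_eq bu_eq cmp_eq)

lemma fstk_eq: "x \<in> Dom M \<Longrightarrow> n.fstk x = m.fstk x"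
  and sndk_eq: "x \<in> Dom M \<Longrightarrow> n.sndk x = m.sndk x"
  unfolding n.fstk_def m.fstk_def n.sndk_def m.sndk_def by (simp_all add: goedel_eq eqk_eq)

lemma maxlt_eq: "x \<in> Dom M \<Longrightarrow> n.maxlt x = m.maxlt x"
  unfolding n.maxlt_def m.maxlt_def Let_def by (simp add: goedel_eq bu_eq pull_eq fstk_eq sndk_eq)

lemma ltk_eq: "x \<in> Dom M \<Longrightarrow> n.ltk x = m.ltk x"
  unfolding n.ltk_def m.ltk_def n.maxeq_def m.maxeq_def
  by (simp add: goedel_eq bu_eq pull_eq fstk_eq sndk_eq maxlt_eq eqk_eq)

text \<open>All clauses are equations between Goedel terms in points of M. The terms have the same
  values in both models, and equality of points does not depend on the model.\<close>

lemma collapse_eq_absolute: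
  "f \<in> Dom M \<Longrightarrow> a \<in> Dom M \<Longrightarrow> R \<in> Dom M \<Longrightarrow> n.collapse_eq f a R \<longleftrightarrow> m.collapse_eq f a R"
  unfolding n.collapse_eq_def m.collapse_eq_def Let_def by (simp add: goedel_eq cmp_eq neq_eq)

lemma core_absolute:
  assumes "\<kappa> \<in> Dom M" "y \<in> Dom M" "x \<in> Dom M" "g \<in> Dom M" "f \<in> Dom M"
  shows "n.core \<kappa> y x g f \<longleftrightarrow> m.core \<kappa> y x g f"
  using assms unfolding n.core_def m.core_def Let_def
  by (simp add: goedel_eq bu_eq ltk_eq pr_eq el_eq collapse_eq_absolute)

text \<open>The witnesses for x in M form a core in N, and a core determines the set which N takes y
  to code.\<close>

lemma codes_upward:
  assumes coded: "\<And>x'. m.codes m.kp y x' \<Longrightarrow> x' \<in> Dom M \<Longrightarrow> \<exists>x''\<in>Dom N. n.codes n.kp y x''"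
    and D: "y \<in> Dom M" "x \<in> Dom M" and c: "m.codes m.kp y x"
  shows "n.codes n.kp y x"
proof -
  obtain g f where gf: "g \<in> Dom M" "f \<in> Dom M" "m.core m.kp y x g f"
    using m.codes_core[OF m.kp D(1) c] by blast
  then have "n.core n.kp y x g f" using core_absolute[OF m.kp(2) D gf(1,2)] kp_eq by simp
  moreover obtain x'' where "x'' \<in> Dom N" "n.codes n.kp y x''" using coded c D(2) by blast
  ultimately show ?thesis
    using n.core_codes_unique[OF n.kp] Dom_mono D gf(1,2) by metis
qed

end

context projective_models
begin

lemma code_pow_upward:
  assumes MN: "M \<in> Mods" "N \<in> Mods" "substructure \<tau> M N"
  shows "y \<in> Dom M \<Longrightarrow> x \<in> Dom M \<Longrightarrow> set_structure.code_pow M (FnI M k []) l y x \<Longrightarrow>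
    set_structure.code_pow N (FnI N k []) l y x"
proof -
  interpret model_extension \<tau> M N k
    by (intro model_extension.intro model_extension_axioms.intro coded_model MN)
  \<comment> \<open>For the formula \<open>FTrue\<close> in one variable, (P3) says that
    \<open>R\<close> holds of exactly the codes. Its truth at a point of M is the same in N,
    although the definition of a code quantifies over all sets.\<close>
  obtain R where R: "R \<in> rels \<tau>" "rarity \<tau> R = 1" "\<And>M. M \<in> Mods \<Longrightarrow> satisfies M (P3 (Fn k []) 1 FTrue R)"
    using projection[of 1 FTrue] by (auto simp: is_qf_fm_def)
  have RM: "RelI M R [y] \<longleftrightarrow> (\<exists>x\<in>Dom M. m.codes m.kp y x)" if "y \<in> Dom M" for y
  proof -
    have "RelI M R (map (\<lambda>_. y) [0..<1]) \<longleftrightarrow>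
        (\<exists>w. range w \<subseteq> Dom M \<and> (\<forall>i<1. m.codes m.kp y (w i)) \<and> eval M w FTrue)"
      by (rule m.P3_iff[OF m.k _ R(3)[OF MN(1)]]) (use that in auto)
    also have "\<dots> \<longleftrightarrow> (\<exists>x\<in>Dom M. m.codes m.kp y x)"
      by (auto intro: exI[of _ "\<lambda>_. _"])
    finally show ?thesis by simp
  qed
  have RN: "RelI N R [y] \<longleftrightarrow> (\<exists>x\<in>Dom N. n.codes n.kp y x)" if "y \<in> Dom N" for y
  proof -
    have "RelI N R (map (\<lambda>_. y) [0..<1]) \<longleftrightarrow>
        (\<exists>w. range w \<subseteq> Dom N \<and> (\<forall>i<1. n.codes n.kp y (w i)) \<and> eval N w FTrue)"
      by (rule n.P3_iff[OF n.k _ R(3)[OF MN(2)]]) (use that in auto)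
    also have "\<dots> \<longleftrightarrow> (\<exists>x\<in>Dom N. n.codes n.kp y x)"
      by (auto intro: exI[of _ "\<lambda>_. _"])
    finally show ?thesis by simp
  qed
  have "RelI M R [y] = RelI N R [y]" if "y \<in> Dom M" for y
    using sub R(1,2) that unfolding substructure_def by simp
  then have up: "n.codes n.kp y x" if "y \<in> Dom M" "x \<in> Dom M" "m.codes m.kp y x" for y x
    using codes_upward[of y x] RM RN Dom_mono that by blast
  show "y \<in> Dom M \<Longrightarrow> x \<in> Dom M \<Longrightarrow> m.code_pow m.kp l y x \<Longrightarrow> n.code_pow n.kp l y x"
  proof (induction l arbitrary: y)
    case (Suc l)
    then obtain z where z: "z \<in> Dom M" "m.codes m.kp y z" "m.code_pow m.kp l z x" by auto
    then have "n.codes n.kp y z" "n.code_pow n.kp l z x" using up Suc by blast+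
    then show ?case using Dom_mono[OF z(1)] by auto
  qed simp
qed

text \<open>Codes Y of e are chosen in M. There \<phi> at e amounts to \<chi> at Y, which is
  quantifier-free and so keeps its truth value in N; since N also takes Y to code e, it can be
  decoded to \<phi> at e.\<close>

theorem elementary:
  assumes MN: "M \<in> Mods" "N \<in> Mods" "substructure \<tau> M N" and \<phi>: "is_fm \<tau> \<phi>" and e: "range e \<subseteq> Dom M"
  shows "eval M e \<phi> = eval N e \<phi>"
proof -
  interpret model_extension \<tau> M N k
    by (intro model_extension.intro model_extension_axioms.intro coded_model MN)
  have eN: "range e \<subseteq> Dom N" using e Dom_mono by blast
  have "finite (fv \<phi> \<union> qvars \<phi>)" by (simp add: finite_fv finite_qvars)
  then obtain n where "\<forall>v\<in>fv \<phi> \<union> qvars \<phi>. v < n" unfolding finite_nat_set_iff_bounded by blast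
  then have n: "fv \<phi> \<union> qvars \<phi> \<subseteq> {..<n}" by blast
  then obtain l \<chi> where \<chi>: "translates n l \<chi> \<phi>" using translation[OF \<phi>] by blast
  obtain Y where Y: "range Y \<subseteq> Dom M" "m.coded n l Y e" using m.coded_exists[OF e] by blast
  have YN: "range Y \<subseteq> Dom N" using Y(1) Dom_mono by blast
  have cN: "n.coded n l Y e"
    unfolding n.coded_def
  proof (intro conjI allI impI eN)
    fix i assume "i < n"
    then have "m.code_pow m.kp l (Y i) (e i)" using Y(2) unfolding m.coded_def by blast
    moreover have "Y i \<in> Dom M" "e i \<in> Dom M" using Y(1) e by blast+
    ultimately show "n.code_pow n.kp l (Y i) (e i)" by (intro code_pow_upward[OF MN])
  qed
  have fv: "fv \<phi> \<subseteq> {..<n}" using n by blast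
  have "eval M Y \<chi> \<longleftrightarrow> (\<exists>w. m.coded n l Y w \<and> eval M w \<phi>)"
    using \<chi> MN(1) Y(1) unfolding translates_def by blast
  then have "eval M e \<phi> \<longleftrightarrow> eval M Y \<chi>"
    using m.coded_eval[OF Y _ fv] Y(2) by blast
  also have "\<dots> \<longleftrightarrow> eval N Y \<chi>"
    using \<chi> by (intro eval_qf_substructure[OF MN(3) m.is_structure Y(1)])
      (simp_all add: translates_def is_qf_fm_def)
  also have "\<dots> \<longleftrightarrow> (\<exists>w. n.coded n l Y w \<and> eval N w \<phi>)"
    using \<chi> MN(2) YN unfolding translates_def by blast
  also have "\<dots> \<longleftrightarrow> eval N e \<phi>"
    using n.coded_eval[OF YN cN _ fv] cN by blast
  finally show ?thesis .
qed

end

text \<open>The types 'u and 'v are independent: consequence over 'u only decides which instances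
  belong to the theory, which from then on is a fixed set of sentences, so its models may be drawn
  from any type.\<close>

theorem theorem3p19:
  fixes \<tau> :: "('f, 'r) ssig" and k :: "'f fsym"
    and T :: "('f, 'r) sfm set" and \<tau>\<^sub>0 :: "'r rsym set"
  assumes "projectively_closed_by TYPE('u) \<tau> k T \<tau>\<^sub>0"
    and "ZFC \<tau> \<subseteq> T"
  shows "model_complete TYPE('v) \<tau> (S_theory TYPE('u) \<tau> k T \<tau>\<^sub>0)"
proof -
  let ?S = "S_theory TYPE('u) \<tau> k T \<tau>\<^sub>0"
  let ?Mods = "{M :: ('f fsym, 'r rsym, 'v) model. is_model \<tau> ?S M}"
  have ext: "extends \<tau> sig_D0" and k: "k \<in> funs \<tau>" "farity \<tau> k = 0" and \<tau>\<^sub>0: "\<tau>\<^sub>0 \<subseteq> rels \<tau>"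
    and P1: "entails TYPE('u) \<tau> T (P1 (Fn k []))"
    and P3: "\<And>n \<phi>. is_qf_fm \<tau> n \<phi> \<Longrightarrow>
      \<exists>R\<in>\<tau>\<^sub>0. rarity \<tau> R = n \<and> entails TYPE('u) \<tau> T (P3 (Fn k []) n \<phi> R)"
    and P7: "\<And>R i. R \<in> \<tau>\<^sub>0 \<Longrightarrow> i < rarity \<tau> R \<Longrightarrow>
      \<exists>V\<in>\<tau>\<^sub>0. Suc (rarity \<tau> V) = rarity \<tau> R \<and> entails TYPE('u) \<tau> T (P7 \<tau> (Fn k []) R i V)"
    using assms(1) unfolding projectively_closed_by_def Let_def by simp_all
  have S: "ZFm \<tau> \<subseteq> ?S" "surjection_ax (Fn k []) \<in> ?S"
    and S_P: "\<And>\<phi>. \<phi> \<in> P_instances \<tau> (Fn k []) \<tau>\<^sub>0 \<Longrightarrow> entails TYPE('u) \<tau> T \<phi> \<Longrightarrow> \<phi> \<in> ?S"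
    unfolding S_theory_def ZFCm_def Let_def by blast+
  have sat: "satisfies M \<phi>" if "M \<in> ?Mods" "\<phi> \<in> ?S" for M \<phi>
    using that unfolding is_model_def by blast
  interpret projective_models \<tau> k ?Mods
  proof (rule projective_models.intro)
    fix M :: "('f fsym, 'r rsym, 'v) model" assume M: "M \<in> ?Mods"
    have "is_structure \<tau> M" using M unfolding is_model_def by blast
    then interpret zf_model \<tau> M
      by unfold_locales (use ext sat[OF M] S(1) in blast)+
    have "P1 (Fn k []) \<in> ?S" by (rule S_P[OF _ P1]) (simp add: P_instances_def)
    then show "coded_model \<tau> M k"
      by unfold_locales (use k P1_iff[OF k] surjection_ax_iff[OF k] sat[OF M] S(2) in blast)+
  next
    fix n \<phi> assume \<phi>: "is_qf_fm \<tau> n \<phi>"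
    obtain R where R: "R \<in> \<tau>\<^sub>0" "rarity \<tau> R = n" "entails TYPE('u) \<tau> T (P3 (Fn k []) n \<phi> R)"
      using P3[OF \<phi>] by blast
    have "P3 (Fn k []) n \<phi> R \<in> ?S"
      by (rule S_P[OF _ R(3)]) (use \<phi> R(1,2) in \<open>auto simp: P_instances_def\<close>)
    moreover have "\<exists>V\<in>rels \<tau>. Suc (rarity \<tau> V) = n \<and> P7 \<tau> (Fn k []) R i V \<in> ?S" if i: "i < n" for i
    proof -
      obtain V where V: "V \<in> \<tau>\<^sub>0" "Suc (rarity \<tau> V) = rarity \<tau> R" "entails TYPE('u) \<tau> T (P7 \<tau> (Fn k []) R i V)"
        using P7[OF R(1)] i R(2) by blast
      have "P7 \<tau> (Fn k []) R i V \<in> ?S"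
        by (rule S_P[OF _ V(3)]) (unfold P_instances_def, use i R(1,2) V(1,2) in blast)
      then show ?thesis using V R(2) \<tau>\<^sub>0 by auto
    qed
    ultimately show "\<exists>R\<in>rels \<tau>. rarity \<tau> R = n \<and>
      (\<forall>M\<in>?Mods. satisfies M (P3 (Fn k []) n \<phi> R)) \<and>
      (\<forall>i<n. \<exists>V\<in>rels \<tau>. Suc (rarity \<tau> V) = n \<and> (\<forall>M\<in>?Mods. satisfies M (P7 \<tau> (Fn k []) R i V)))"
      using R(1,2) \<tau>\<^sub>0 sat by (intro bexI[of _ R]) blast+
  qed
  show ?thesis
    unfolding model_complete_def elementary_substructure_def using elementary by blast
qed

end
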